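(* Let $f\colon \mathbb{D}\to\mathbb{D}$ be a non-elliptic map with Denjoy--Wolff point $\tau\in\partial\mathbb{D}$, Koenigs function $h$ and Koenigs domain $\Omega$. There exists a fundamental domain $V\subseteq \mathbb{D}$ of $f$ such that $h$ is univalent on $V$, $h(V)$ is starlike at infinity and $$\bigcup_{t\geq0}\left( h(V)-t\right)=\bigcup_{n\in\mathbb{N}}\left( \Omega-n\right).$$ When $f$ is hyperbolic or parabolic of zero hyperbolic step, any sequence $\{z_n\}\subseteq\mathbb{D}$ converging non-tangentially to $\tau$ is eventually contained in $V$, and $$\lim_{n\to+\infty}\frac{\lambda_{\mathbb{D}}(z_n)}{\lambda_V(z_n)}=1.$$
   Context: $\mathbb{D}$ is the open unit disc and $\mathbb{N}=\{1,2,\dots\}$. For a holomorphic $f\colon\mathbb{D}\to\mathbb{D}$, $f^n$ denotes the $n$-fold composition of $f$ with itself. A holomorphic map $f\colon\mathbb{D}\to\mathbb{D}$ is non-elliptic if it has no fixed point in $\mathbb{D}$; then there is a unique $\tau\in\partial\mathbb{D}$, the Denjoy--Wolff point of $f$, such that $f^n(z)\to\tau$ for all $z\in\mathbb{D}$. A domain $\Omega\subseteq\mathbb{C}$ is starlike at infinity if $\Omega+t\subseteq\Omega$ for all $t\ge 0$; it is asymptotically starlike at infinity if $\Omega+1\subseteq\Omega$ and the domain $\widetilde{\Omega}:=\bigcup_{n=1}^\infty(\Omega-n)$ is starlike at infinity. A simply connected domain $U\subseteq\mathbb{D}$ is a fundamental domain of $f$ if $f$ is univalent on $U$, $f(U)\subseteq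 U$ and $\bigcup_{n\in\mathbb{N}}f^{-n}(U)=\mathbb{D}$, where $f^{-n}(U)$ is the preimage of $U$ under $f^n$. For any non-elliptic $f$ there exist a domain $\Omega$ asymptotically starlike at infinity and an onto holomorphic map $h\colon\mathbb{D}\to\Omega$ with $h\circ f=h+1$; these are called a Koenigs domain and a Koenigs function for $f$, respectively. Both $\Omega$ and $h$ are unique up to translation. There are essentially only three possibilities for $\widetilde\Omega$, which determine the type of $f$: $f$ is hyperbolic if $\widetilde{\Omega}$ is a horizontal strip, parabolic of positive hyperbolic step if $\widetilde\Omega$ is a horizontal half-plane, and parabolic of zero hyperbolic step if $\widetilde\Omega=\mathbb{C}$. A sequence $\{z_n\}\subseteq\mathbb{D}$ converging to $\sigma\in\partial\mathbb{D}$ converges non-tangentially if there is $R>1$ with $|\sigma-z_n|<R(1-|z_n|)$ for all $n$. The hyperbolic metric of $\mathbb{D}$ is $\lambda_{\mathbb{D}}(z)|dz|=\frac{|dz|}{1-|z|^2}$, and for a simply connected domain $D\subsetneq\mathbb{C}$ the hyperbolic metric $\lambda_D(z)|dz|$ is given by $\lambda_D(\pi(z))|\pi'(z)|=\lambda_{\mathbb{D}}(z)$, $z\in\mathbb{D}$, for any Riemann map $\pi\colon\mathbb{D}\to D$.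
   Formalization: The Koenigs function h is also required to satisfy: h(z)=h(w) only if f^n(z)=f^n(w) for some n. The stated conditions alone do not make h unique up to translation and the claim then fails; the condition is necessary for h to be univalent on a fundamental domain. *)

theory Defs
  imports "HOL-Complex_Analysis.Complex_Analysis"
begin

abbreviation unit_disc :: "complex set"
  where "unit_disc \<equiv> ball 0 1"

definition planar_domain :: "complex set \<Rightarrow> bool"
  where "planar_domain S \<longleftrightarrow> S \<noteq> {} \<and> open S \<and> connected S"

definition univalent_on :: "(complex \<Rightarrow> complex) \<Rightarrow> complex set \<Rightarrow> bool"
  where "univalent_on f S \<longleftrightarrow> f holomorphic_on S \<and> inj_on f S"

definition disc_self_map :: "(complex \<Rightarrow> complex) \<Rightarrow> bool"
  where "disc_self_map f \<longleftrightarrow> f holomorphic_on unit_disc \<and> f ` unit_disc \<subseteq> unit_disc"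

definition non_elliptic :: "(complex \<Rightarrow> complex) \<Rightarrow> bool"
  where "non_elliptic f \<longleftrightarrow> disc_self_map f \<and> (\<forall>z\<in>unit_disc. f z \<noteq> z)"

definition denjoy_wolff_point :: "(complex \<Rightarrow> complex) \<Rightarrow> complex \<Rightarrow> bool"
  where "denjoy_wolff_point f \<tau> \<longleftrightarrow>
    \<tau> \<in> sphere 0 1 \<and> (\<forall>z\<in>unit_disc. (\<lambda>n. (f ^^ n) z) \<longlonglongrightarrow> \<tau>)"

definition starlike_at_infinity :: "complex set \<Rightarrow> bool"
  where "starlike_at_infinity S \<longleftrightarrow>
    planar_domain S \<and> (\<forall>t\<ge>0. (\<lambda>w. w + complex_of_real t) ` S \<subseteq> S)"

definition backward_union :: "complex set \<Rightarrow> complex set"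
  where "backward_union S = (\<Union>n\<in>{1::nat..}. (\<lambda>w. w - of_nat n) ` S)"

definition asymptotically_starlike_at_infinity :: "complex set \<Rightarrow> bool"
  where "asymptotically_starlike_at_infinity S \<longleftrightarrow>
    planar_domain S \<and> (\<lambda>w. w + 1) ` S \<subseteq> S \<and> starlike_at_infinity (backward_union S)"

definition fundamental_domain :: "(complex \<Rightarrow> complex) \<Rightarrow> complex set \<Rightarrow> bool"
  where "fundamental_domain f U \<longleftrightarrow>
    planar_domain U \<and> simply_connected U \<and> U \<subseteq> unit_disc \<and>
    univalent_on f U \<and> f ` U \<subseteq> U \<and>
    (\<Union>n\<in>{1::nat..}. {z \<in> unit_disc. (f ^^ n) z \<in> U}) = unit_disc"

text \<open>
  The last conjunct makes precise what it means for \<open>h\<close> and \<open>\<Omega>\<close> to be unique up to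
  translation: \<open>h\<close> identifies two points only if their orbits eventually coincide
  (the converse follows from the functional equation). The other conjuncts alone do not
  determine \<open>h\<close>: if \<open>f\<close> is a parabolic automorphism, so that \<open>h\<close> is a bijection of the disc
  onto a half-plane \<open>H\<close>, then \<open>g \<circ> h\<close> also satisfies them for every holomorphic surjection
  \<open>g\<close> of \<open>H\<close> onto the plane with \<open>g (w + 1) = g w + 1\<close>, and such \<open>g\<close> exist. For these the
  type read off from the image would be wrong, and \<open>g \<circ> h\<close> is not injective on any
  fundamental domain.
\<close>
definition koenigs :: "(complex \<Rightarrow> complex) \<Rightarrow> (complex \<Rightarrow> complex) \<Rightarrow> complex set \<Rightarrow> bool"
  where "koenigs f h \<Omega> \<longleftrightarrow>
    asymptotically_starlike_at_infinity \<Omega> \<and>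
    h holomorphic_on unit_disc \<and> h ` unit_disc = \<Omega> \<and>
    (\<forall>z\<in>unit_disc. h (f z) = h z + 1) \<and>
    (\<forall>z\<in>unit_disc. \<forall>w\<in>unit_disc. h z = h w \<longrightarrow> (\<exists>n. (f ^^ n) z = (f ^^ n) w))"

text \<open>
  The type of a non-elliptic map is expressed through its Koenigs domain \<open>\<Omega>\<close>; it does not
  depend on the choice of \<open>\<Omega>\<close>, since \<open>\<Omega>\<close> is unique up to translation.
\<close>
definition hyperbolic_type :: "complex set \<Rightarrow> bool"
  where "hyperbolic_type \<Omega> \<longleftrightarrow>
    (\<exists>a b. a < b \<and> backward_union \<Omega> = {w. a < Im w \<and> Im w < b})"

definition parabolic_zero_step_type :: "complex set \<Rightarrow> bool"
  where "parabolic_zero_step_type \<Omega> \<longleftrightarrow> backward_union \<Omega> = UNIV"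

definition converges_non_tangentially :: "(nat \<Rightarrow> complex) \<Rightarrow> complex \<Rightarrow> bool"
  where "converges_non_tangentially z \<sigma> \<longleftrightarrow>
    z \<longlonglongrightarrow> \<sigma> \<and> (\<exists>R>1. \<forall>n. norm (\<sigma> - z n) < R * (1 - norm (z n)))"

definition hyp_density_disc :: "complex \<Rightarrow> real"
  where "hyp_density_disc z = 1 / (1 - (norm z)\<^sup>2)"

definition riemann_map :: "(complex \<Rightarrow> complex) \<Rightarrow> complex set \<Rightarrow> bool"
  where "riemann_map p D \<longleftrightarrow> univalent_on p unit_disc \<and> p ` unit_disc = D"

text \<open>
  Meaningful for simply connected domains \<open>D\<close> other than the whole plane and points \<open>w\<close>
  of \<open>D\<close>, where a unique such value exists by the Riemann mapping theorem and the
  Schwarz--Pick lemma.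
\<close>
definition hyp_density :: "complex set \<Rightarrow> complex \<Rightarrow> real"
  where "hyp_density D w = (THE l. \<forall>p. riemann_map p D \<longrightarrow>
    (\<forall>z\<in>unit_disc. p z = w \<longrightarrow> l * norm (deriv p z) = hyp_density_disc z))"

end

theory Submission
  imports Defs
begin

text \<open>
  Write \<open>\<Omega>'\<close> for the union of the translates \<open>\<Omega> - n\<close>. Since \<open>h\<close> identifies two points only
  when their orbits merge, \<open>h\<close> can be inverted over \<open>\<Omega>'\<close> at the price of iterating \<open>f\<close>: every
  compact subset of \<open>\<Omega>'\<close> has, after translation by some \<open>n\<close>, a holomorphic right inverse of \<open>h\<close>
  (a section) defined near it (\<open>section_over_compact\<close>). Over a connected set two sections that
  agree at one point agree everywhere (\<open>koenigs_section_unique\<close>).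
  
  The set \<open>V\<close> is \<open>flow_domain\<close>: the points \<open>z\<close> for which a neighbourhood of the ray
  \<open>h z + t\<close>, \<open>t \<ge> 0\<close>, carries a section through \<open>z\<close> that turns \<open>w + 1\<close> into \<open>f\<close>. On \<open>V\<close> the
  translations \<open>w + t\<close> lift to a semiflow with time-one map \<open>f\<close>, so \<open>h(V)\<close> is starlike at
  infinity by construction, and \<open>h\<close> is injective on \<open>V\<close> by uniqueness of sections. A section
  through \<open>z\<close> over the segment from \<open>h z\<close> to \<open>h z + 2\<close> with the value \<open>f z\<close> at \<open>h z + 1\<close> extends to
  the whole ray by iterating \<open>f\<close>. As orbits with equal values of \<open>h\<close> merge, there are such sections
  for the late points \<open>z\<close> of every orbit, so every orbit enters \<open>V\<close>. This proves the first half for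
  every \<open>f\<close>.
  
  The second half reduces to one inclusion. In the half-plane coordinate
  \<open>x = (\<tau> + z) / (\<tau> - z)\<close> non-tangential approach to \<open>\<tau>\<close> means \<open>|x| \<longlongrightarrow> \<infinity>\<close> inside a cone
  \<open>|x| \<le> M Re x\<close>, and such cones are stable under passing to points at bounded hyperbolic
  distance. Hence if \<open>V\<close> contains the tail of every cone, it contains hyperbolic discs about
  \<open>z\<^sub>n\<close> with radii tending to infinity, and the Schwarz lemma squeezes the quotient of the
  densities (\<open>nontangential_density_ratio\<close>).
  
  In the case of zero hyperbolic step, sections over large discs show that the hyperbolic steps of
  an orbit tend to \<open>0\<close>. By Wolff's lemma \<open>p = x \<circ> f - x\<close> has non-negative real part, and the
  Schwarz-Pick lemma for \<open>p + \<epsilon> x\<close> yields \<open>p / x \<longlongrightarrow> 0\<close> in cones, so the distance from \<open>z\<close> to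
  \<open>f z\<close> tends to \<open>0\<close> there. A point whose step is small enough lies in \<open>V\<close>
  (\<open>small_step_imp_in_flow_domain\<close>): the function \<open>f - id\<close> has no zero, so \<open>f\<close> is close to the
  identity, hence injective, on a hyperbolic disc about each point of the orbit; therefore \<open>h\<close> is
  injective on such a disc about \<open>z\<close>. Because \<open>h\<close> increases by \<open>1\<close> between the close points \<open>z\<close>
  and \<open>f z\<close>, a weak form of Koebe's theorem shows that the image of the disc contains a large disc
  about \<open>h z\<close>, and the inverse of \<open>h\<close> there is the required section.
  
  In the hyperbolic case an exponential maps the strip \<open>\<Omega>'\<close> to the half-plane and shows that
  orbits move at linear speed for the hyperbolic distance. Together with Wolff's lemma this makes
  \<open>Re x\<close> double after a fixed number of steps; summing the steps, the orbit of \<open>0\<close> stays in a cone,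
  and every point of a cone far out is within bounded distance of this orbit. Finally \<open>h - n\<close> maps
  the hyperbolic disc of a fixed radius about \<open>f\<^sup>n(0)\<close> into a compact subset of the strip which does
  not depend on \<open>n\<close>. Over it there is a section, whose image contains the disc by connectedness and
  is absorbed by \<open>V\<close>.
\<close>

section \<open>The hyperbolic distance of the disc and of the half-plane\<close>

text \<open>
  The squared hyperbolic cosine of the distance for the metric \<open>|dz| / (1 - |z|\<^sup>2)\<close>, and below its
  half-plane counterpart. Used in place of the distance itself, they keep all estimates algebraic.
\<close>

definition disc_cosh2 :: "complex \<Rightarrow> complex \<Rightarrow> real"
  where "disc_cosh2 z w = (norm (1 - cnj z * w))\<^sup>2 / ((1 - (norm z)\<^sup>2) * (1 - (norm w)\<^sup>2))"

definition halfplane_cosh2 :: "complex \<Rightarrow> complex \<Rightarrow> real"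
  where "halfplane_cosh2 x y = (norm (x + cnj y))\<^sup>2 / (4 * Re x * Re y)"

lemma one_minus_norm_sq_pos: "norm (z::complex) < 1 \<Longrightarrow> 0 < 1 - (norm z)\<^sup>2"
  by (simp add: power_less_one_iff abs_square_less_1)

lemma one_minus_cnj_mult_nz:
  assumes "norm a < 1" "norm z < 1" shows "1 - cnj a * z \<noteq> 0"
proof
  assume "1 - cnj a * z = 0"
  then have "norm (cnj a * z) = 1" by (metis eq_iff_diff_eq_0 norm_one)
  moreover have "norm a * norm z < 1"
    using assms by (metis mult_less_cancel_right1 norm_ge_zero less_le_not_le linorder_not_le mult.commute order_less_le_trans)
  ultimately show False by (simp add: norm_mult)
qed

lemma moebius_norm_sq:
  assumes "norm a < 1" "norm z < 1"
  shows "1 - (norm (Moebius_function 0 a z))\<^sup>2 = inverse (disc_cosh2 a z)"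
proof -
  have nz: "norm (1 - cnj a * z) \<noteq> 0" using one_minus_cnj_mult_nz[OF assms] by simp
  have *: "(norm (1 - cnj a * z))\<^sup>2 - (norm (z - a))\<^sup>2 = (1 - (norm a)\<^sup>2) * (1 - (norm z)\<^sup>2)"
    by (simp only: cmod_power2) (simp add: algebra_simps power2_eq_square)
  have "(norm (Moebius_function 0 a z))\<^sup>2 = (norm (z - a))\<^sup>2 / (norm (1 - cnj a * z))\<^sup>2"
    by (simp add: Moebius_function_simple norm_divide power_divide)
  then have "1 - (norm (Moebius_function 0 a z))\<^sup>2
      = ((norm (1 - cnj a * z))\<^sup>2 - (norm (z - a))\<^sup>2) / (norm (1 - cnj a * z))\<^sup>2"
    using nz by (simp add: diff_divide_distrib)
  then show ?thesis by (simp add: * disc_cosh2_def)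
qed

lemma disc_cosh2_pos: "norm a < 1 \<Longrightarrow> norm z < 1 \<Longrightarrow> 0 < disc_cosh2 a z"
  using moebius_norm_sq[of a z] Moebius_function_norm_lt_1[of a z 0]
  by (metis inverse_positive_iff_positive one_minus_norm_sq_pos)

lemma disc_cosh2_ge_1: "norm a < 1 \<Longrightarrow> norm z < 1 \<Longrightarrow> 1 \<le> disc_cosh2 a z"
  using moebius_norm_sq[of a z] disc_cosh2_pos[of a z]
  by (smt (verit, best) one_le_inverse_iff inverse_inverse_eq inverse_positive_iff_positive zero_le_power2)

lemma disc_cosh2_self: "norm a < 1 \<Longrightarrow> disc_cosh2 a a = 1"
  using moebius_norm_sq[of a a] by (simp add: Moebius_function_eq_zero)

lemma disc_cosh2_commute: "disc_cosh2 a z = disc_cosh2 z a"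
proof -
  have "norm (1 - cnj a * z) = norm (1 - cnj z * a)"
    using complex_mod_cnj[of "1 - cnj a * z"] by (simp add: mult.commute)
  then show ?thesis by (simp add: disc_cosh2_def mult.commute)
qed

lemma disc_cosh2_zero: "disc_cosh2 0 w = 1 / (1 - (norm w)\<^sup>2)"
  by (simp add: disc_cosh2_def)

lemma disc_cosh2_le_iff_moebius:
  assumes "norm a < 1" "norm z < 1" "norm b < 1" "norm w < 1"
  shows "disc_cosh2 a z \<le> disc_cosh2 b w \<longleftrightarrow>
    norm (Moebius_function 0 a z) \<le> norm (Moebius_function 0 b w)"
proof -
  have "norm (Moebius_function 0 a z) \<le> norm (Moebius_function 0 b w) \<longleftrightarrow>
      (norm (Moebius_function 0 a z))\<^sup>2 \<le> (norm (Moebius_function 0 b w))\<^sup>2"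
    by (simp add: abs_le_square_iff[symmetric])
  also have "\<dots> \<longleftrightarrow> inverse (disc_cosh2 b w) \<le> inverse (disc_cosh2 a z)"
    using moebius_norm_sq[OF assms(1,2)] moebius_norm_sq[OF assms(3,4)] by linarith
  also have "\<dots> \<longleftrightarrow> disc_cosh2 a z \<le> disc_cosh2 b w"
    using disc_cosh2_pos assms by (simp add: inverse_le_iff_le)
  finally show ?thesis by simp
qed

text \<open>
  Moving \<open>z\<close> and \<open>g z\<close> to the origin by disc automorphisms reduces this to the Schwarz lemma.
\<close>

lemma Schwarz_Pick_disc:
  assumes g: "g holomorphic_on ball 0 1" "\<And>z. norm z < 1 \<Longrightarrow> norm (g z) < 1"
    and z: "norm z < 1" and w: "norm w < 1"
  shows "disc_cosh2 (g z) (g w) \<le> disc_cosh2 z w"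
proof -
  let ?F = "\<lambda>\<zeta>. Moebius_function 0 (g z) (g (Moebius_function 0 (-z) \<zeta>))"
  have M: "Moebius_function 0 (-z) \<zeta> \<in> ball 0 1" if "norm \<zeta> < 1" for \<zeta>
    using Moebius_function_norm_lt_1[of "-z" \<zeta>] z that by simp
  have holF: "?F holomorphic_on ball 0 1"
    by (rule holomorphic_on_compose_gen[OF holomorphic_on_compose_gen[OF _ g(1)] Moebius_function_holomorphic, unfolded o_def])
       (use g z M in \<open>auto intro!: Moebius_function_holomorphic\<close>)
  have F0: "?F 0 = 0" by (simp add: Moebius_function_of_zero Moebius_function_eq_zero)
  have Fb: "norm (?F \<zeta>) < 1" if "norm \<zeta> < 1" for \<zeta>
    using M[OF that] g(2) z by (intro Moebius_function_norm_lt_1) auto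
  let ?\<zeta> = "Moebius_function 0 z w"
  have \<zeta>: "norm ?\<zeta> < 1" using Moebius_function_norm_lt_1 z w by blast
  have "norm (?F ?\<zeta>) \<le> norm ?\<zeta>"
    using Schwarz_Lemma(1)[OF holF F0 Fb \<zeta>] .
  moreover have "Moebius_function 0 (-z) ?\<zeta> = w"
    using Moebius_function_compose[of "-z" z w] z w by simp
  ultimately show ?thesis
    using disc_cosh2_le_iff_moebius[of "g z" "g w" z w] g(2) z w by simp
qed

lemma halfplane_moebius_norm:
  assumes "0 < Re q" shows "norm ((q - 1) / (q + 1)) < 1"
proof -
  have "(norm (q - 1))\<^sup>2 < (norm (q + 1))\<^sup>2"
    using assms by (simp only: cmod_power2) (simp add: algebra_simps power2_eq_square)
  then have "norm (q - 1) < norm (q + 1)" using power2_less_imp_less norm_ge_zero by blast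
  then show ?thesis by (simp add: norm_divide divide_simps)
qed

lemma halfplane_cosh2_moebius:
  assumes "0 < Re q" "0 < Re p"
  shows "disc_cosh2 ((q - 1) / (q + 1)) ((p - 1) / (p + 1)) = halfplane_cosh2 q p"
proof -
  have nz: "q + 1 \<noteq> 0" "p + 1 \<noteq> 0" "cnj q + 1 \<noteq> 0"
    using assms by (auto simp: complex_eq_iff)
  have 1: "1 - (norm ((q - 1) / (q + 1)))\<^sup>2 = 4 * Re q / (norm (q + 1))\<^sup>2" if "0 < Re q" for q
  proof -
    have "(norm (q + 1))\<^sup>2 - (norm (q - 1))\<^sup>2 = 4 * Re q"
      by (simp only: cmod_power2) (simp add: algebra_simps power2_eq_square)
    moreover have "norm (q + 1) \<noteq> 0" using that by (auto simp: complex_eq_iff)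
    then have "1 - (norm ((q - 1) / (q + 1)))\<^sup>2 = ((norm (q + 1))\<^sup>2 - (norm (q - 1))\<^sup>2) / (norm (q + 1))\<^sup>2"
      by (subst norm_divide) (simp only: power_divide diff_divide_distrib[of _ _ "(norm (q + 1))\<^sup>2"], simp)
    ultimately show ?thesis by simp
  qed
  have aux: "1 - (c - 1) / (c + 1) * ((p - 1) / (p + 1)) = 2 * (c + p) / ((c + 1) * (p + 1))"
    if "c + 1 \<noteq> 0" "p + 1 \<noteq> 0" for c p :: complex
    using that by (simp add: divide_simps) (simp add: algebra_simps)
  have "1 - cnj ((q - 1) / (q + 1)) * ((p - 1) / (p + 1)) = 2 * (cnj q + p) / ((cnj q + 1) * (p + 1))"
    using aux[OF nz(3,2)] by simp
  then have "norm (1 - cnj ((q - 1) / (q + 1)) * ((p - 1) / (p + 1)))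
      = 2 * norm (cnj q + p) / (norm (cnj q + 1) * norm (p + 1))"
    by (simp only: norm_mult norm_divide norm_numeral)
  moreover have "norm (cnj q + 1) = norm (q + 1)"
    using complex_mod_cnj[of "q + 1"] by simp
  moreover have "norm (cnj q + p) = norm (q + cnj p)"
    using complex_mod_cnj[of "q + cnj p"] by simp
  ultimately have "norm (1 - cnj ((q - 1) / (q + 1)) * ((p - 1) / (p + 1)))
      = 2 * norm (q + cnj p) / (norm (q + 1) * norm (p + 1))" by simp
  moreover have "(2 * n / (a * b))\<^sup>2 / ((4 * A / a\<^sup>2) * (4 * B / b\<^sup>2)) = n\<^sup>2 / (4 * A * B)"
    if "a \<noteq> 0" "b \<noteq> 0" "A > 0" "B > 0" for a b A B n :: real
    using that by (simp add: field_simps power2_eq_square)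
  ultimately show ?thesis
    unfolding disc_cosh2_def halfplane_cosh2_def 1[OF assms(1)] 1[OF assms(2)]
    using nz assms by simp
qed

text \<open>
  The map \<open>(q - 1) / (q + 1)\<close> is an isometry of the half-plane onto the disc.
\<close>

lemma Schwarz_Pick_halfplane:
  assumes g: "g holomorphic_on ball 0 1" "\<And>z. norm z < 1 \<Longrightarrow> 0 < Re (g z)"
    and z: "norm z < 1" and w: "norm w < 1"
  shows "halfplane_cosh2 (g z) (g w) \<le> disc_cosh2 z w"
proof -
  have nz: "g z + 1 \<noteq> 0" if "norm z < 1" for z
    using g(2)[OF that] by (auto simp: complex_eq_iff)
  have "disc_cosh2 ((g z - 1) / (g z + 1)) ((g w - 1) / (g w + 1)) \<le> disc_cosh2 z w"
  proof (rule Schwarz_Pick_disc[where g = "\<lambda>z. (g z - 1) / (g z + 1)"])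
    show "(\<lambda>z. (g z - 1) / (g z + 1)) holomorphic_on ball 0 1"
      using nz by (intro holomorphic_intros g(1)) auto
  qed (use halfplane_moebius_norm g z w in auto)
  then show ?thesis using halfplane_cosh2_moebius g(2) z w by simp
qed

lemma hyperbolic_disc_eq_moebius_image:
  assumes "norm a < 1" "0 \<le> r" "r < 1"
  shows "Moebius_function 0 (-a) ` ball 0 r = {w \<in> ball 0 1. disc_cosh2 a w < 1 / (1 - r\<^sup>2)}"
proof -
  have r2: "0 < 1 - r\<^sup>2" using assms by (simp add: power_less_one_iff abs_square_less_1)
  have key: "norm (Moebius_function 0 a w) < r \<longleftrightarrow> disc_cosh2 a w < 1 / (1 - r\<^sup>2)" if w: "norm w < 1" for w
  proof -
    have "norm (Moebius_function 0 a w) < r \<longleftrightarrow> (norm (Moebius_function 0 a w))\<^sup>2 < r\<^sup>2"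
      using power_mono_iff[of r "norm (Moebius_function 0 a w)" 2] assms
      by (simp add: linorder_not_le[symmetric])
    also have "\<dots> \<longleftrightarrow> 1 - r\<^sup>2 < inverse (disc_cosh2 a w)"
      using moebius_norm_sq[OF assms(1) w] by linarith
    also have "\<dots> \<longleftrightarrow> disc_cosh2 a w < 1 / (1 - r\<^sup>2)"
      using disc_cosh2_pos[OF assms(1) w] r2 by (simp add: field_simps)
    finally show ?thesis .
  qed
  show ?thesis
  proof safe
    fix \<zeta> :: complex assume \<zeta>: "\<zeta> \<in> ball 0 r"
    then have n: "norm \<zeta> < 1" using assms by simp
    show b: "Moebius_function 0 (-a) \<zeta> \<in> ball 0 1"
      using Moebius_function_norm_lt_1[of "-a" \<zeta>] assms n by simp
    have "Moebius_function 0 a (Moebius_function 0 (-a) \<zeta>) = \<zeta>"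
      using Moebius_function_compose[of a "-a" \<zeta>] assms n by simp
    then show "disc_cosh2 a (Moebius_function 0 (-a) \<zeta>) < 1 / (1 - r\<^sup>2)"
      using key[of "Moebius_function 0 (-a) \<zeta>"] b \<zeta> by simp
  next
    fix w assume w: "w \<in> ball 0 1" "disc_cosh2 a w < 1 / (1 - r\<^sup>2)"
    then have "w = Moebius_function 0 (-a) (Moebius_function 0 a w)"
      using Moebius_function_compose[of "-a" a w] assms by simp
    then show "w \<in> Moebius_function 0 (-a) ` ball 0 r"
      using key[of w] w by (intro image_eqI) auto
  qed
qed

text \<open>
  Harnack's inequality: \<open>Re\<close> is a positive harmonic function on the half-plane, so at two points of
  bounded distance its values are comparable.
\<close>

lemma halfplane_cosh2_Re_left_le:
  assumes "0 < Re x" "0 < Re y"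
  shows "Re x \<le> 4 * halfplane_cosh2 x y * Re y"
proof -
  have "(Re x)\<^sup>2 \<le> (Re (x + cnj y))\<^sup>2" using assms by (intro power_mono) auto
  also have "\<dots> \<le> (norm (x + cnj y))\<^sup>2" by (metis abs_Re_le_cmod abs_le_square_iff abs_norm_cancel)
  finally have "(Re x)\<^sup>2 \<le> (norm (x + cnj y))\<^sup>2" .
  then show ?thesis using assms by (simp add: halfplane_cosh2_def field_simps power2_eq_square)
qed

lemma halfplane_cosh2_Re_right_le:
  assumes "0 < Re x" "0 < Re y" shows "Re y \<le> 4 * halfplane_cosh2 x y * Re x"
proof -
  have "norm (y + cnj x) = norm (x + cnj y)"
    using complex_mod_cnj[of "x + cnj y"] by (simp add: add.commute)
  then have "halfplane_cosh2 y x = halfplane_cosh2 x y" by (simp add: halfplane_cosh2_def mult.commute)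
  then show ?thesis using halfplane_cosh2_Re_left_le[OF assms(2,1)] by simp
qed

text \<open>
  Together with \<open>norm_diff_le_norm_add_cnj\<close> this bounds the Euclidean distance of two points by
  their hyperbolic distance and the distance of one of them from the boundary.
\<close>

lemma halfplane_cosh2_norm_le:
  assumes "0 < Re x" "0 < Re y" "halfplane_cosh2 x y \<le> D"
  shows "norm (x + cnj y) \<le> 4 * D * Re x"
proof -
  have D: "D \<ge> 0" using assms by (smt (verit) halfplane_cosh2_def divide_nonneg_pos mult_pos_pos zero_le_power2)
  have "(norm (x + cnj y))\<^sup>2 = halfplane_cosh2 x y * (4 * Re x * Re y)"
    using assms by (simp add: halfplane_cosh2_def)
  also have "\<dots> \<le> D * (4 * Re x * Re y)" using assms by (intro mult_right_mono) auto
  also have "\<dots> \<le> D * (4 * Re x * (4 * D * Re x))"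
  proof -
    have "Re y \<le> 4 * halfplane_cosh2 x y * Re x" by (rule halfplane_cosh2_Re_right_le[OF assms(1,2)])
    also have "\<dots> \<le> 4 * D * Re x" using assms by (intro mult_right_mono) auto
    finally have "4 * Re x * Re y \<le> 4 * Re x * (4 * D * Re x)"
      by (rule mult_left_mono) (use assms(1) in simp)
    then show ?thesis by (rule mult_left_mono) (rule D)
  qed
  also have "\<dots> = (4 * D * Re x)\<^sup>2" by (simp add: power2_eq_square)
  finally show ?thesis
    by (rule power2_le_imp_le) (intro mult_nonneg_nonneg; use D assms(1) in simp)
qed

lemma norm_diff_le_norm_add_cnj:
  assumes "0 \<le> Re x" "0 \<le> Re y" shows "norm (x - y) \<le> norm (x + cnj y)"
proof -
  have "(norm (x + cnj y))\<^sup>2 - (norm (x - y))\<^sup>2 = 4 * Re x * Re y"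
    by (simp only: cmod_power2) (simp add: algebra_simps power2_eq_square)
  then have "(norm (x - y))\<^sup>2 \<le> (norm (x + cnj y))\<^sup>2" using assms by (smt (verit) mult_nonneg_nonneg)
  then show ?thesis by (rule power2_le_imp_le) simp
qed

lemma halfplane_cosh2_scale:
  assumes "s > 0"
  shows "halfplane_cosh2 (of_real s * x) (of_real s * y) = halfplane_cosh2 x y"
proof -
  have "of_real s * x + cnj (of_real s * y) = of_real s * (x + cnj y)" by (simp add: algebra_simps)
  then have "norm (of_real s * x + cnj (of_real s * y)) = s * norm (x + cnj y)"
    using assms by (simp only: norm_mult norm_of_real abs_of_pos)
  then show ?thesis using assms by (simp add: halfplane_cosh2_def power2_eq_square)
qed

text \<open>
  The isometry of the disc onto the right half-plane that sends \<open>\<tau>\<close> to infinity.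
\<close>

definition cayley :: "complex \<Rightarrow> complex \<Rightarrow> complex"
  where "cayley \<tau> z = (\<tau> + z) / (\<tau> - z)"

lemma Re_cayley:
  assumes "norm \<tau> = 1" "norm z < 1"
  shows "Re (cayley \<tau> z) = (1 - (norm z)\<^sup>2) / (norm (\<tau> - z))\<^sup>2"
proof -
  have "Re (cayley \<tau> z) = Re ((\<tau> + z) * cnj (\<tau> - z)) / (norm (\<tau> - z))\<^sup>2"
    unfolding cayley_def by (simp add: Re_complex_div_eq_0 complex_div_cnj[of "\<tau> + z" "\<tau> - z"] flip: of_real_power)
  moreover have "Re ((\<tau> + z) * cnj (\<tau> - z)) = (norm \<tau>)\<^sup>2 - (norm z)\<^sup>2"
    by (simp only: cmod_power2) (simp add: algebra_simps power2_eq_square)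
  ultimately show ?thesis using assms by simp
qed

lemma Re_cayley_pos:
  assumes "norm \<tau> = 1" "norm z < 1" shows "0 < Re (cayley \<tau> z)"
proof -
  have "\<tau> - z \<noteq> 0" using assms by auto
  then show ?thesis using Re_cayley[OF assms] one_minus_norm_sq_pos assms by simp
qed

lemma cayley_holomorphic: "norm \<tau> = 1 \<Longrightarrow> cayley \<tau> holomorphic_on ball 0 1"
  unfolding cayley_def by (intro holomorphic_intros) auto

lemma cayley_cosh2:
  assumes \<tau>: "norm \<tau> = 1" and "norm z < 1" "norm w < 1"
  shows "halfplane_cosh2 (cayley \<tau> z) (cayley \<tau> w) = disc_cosh2 z w"
proof -
  have nz: "\<tau> - z \<noteq> 0" "\<tau> - w \<noteq> 0" "cnj \<tau> - cnj w \<noteq> 0"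
    using assms complex_cnj_cancel_iff[of \<tau> w] by auto
  have \<tau>1: "\<tau> * cnj \<tau> = 1" using \<tau> by (simp add: complex_norm_square[symmetric])
  have "(\<tau> + z) * (cnj \<tau> - cnj w) + (cnj \<tau> + cnj w) * (\<tau> - z) = 2 * (\<tau> * cnj \<tau> - cnj w * z)"
    by (simp add: algebra_simps)
  then have "cayley \<tau> z + cnj (cayley \<tau> w) = 2 * (1 - cnj w * z) / ((\<tau> - z) * (cnj \<tau> - cnj w))"
    unfolding cayley_def using nz \<tau>1 by (simp add: add_frac_eq)
  then have "norm (cayley \<tau> z + cnj (cayley \<tau> w))
      = 2 * norm (1 - cnj w * z) / (norm (\<tau> - z) * norm (cnj (\<tau> - w)))"
    by (simp only: norm_mult norm_divide norm_numeral complex_cnj_diff)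
  then have "norm (cayley \<tau> z + cnj (cayley \<tau> w)) = 2 * norm (1 - cnj w * z) / (norm (\<tau> - z) * norm (\<tau> - w))"
    by (simp only: complex_mod_cnj)
  moreover have aux: "(2 * n / (a * b))\<^sup>2 / (4 * (A / a\<^sup>2) * (B / b\<^sup>2)) = n\<^sup>2 / (B * A)"
    if "a \<noteq> 0" "b \<noteq> 0" "A > 0" "B > 0" for a b A B n :: real
    using that by (simp add: field_simps power2_eq_square)
  ultimately have "halfplane_cosh2 (cayley \<tau> z) (cayley \<tau> w) = disc_cosh2 w z"
    unfolding halfplane_cosh2_def disc_cosh2_def Re_cayley[OF \<tau> assms(2)] Re_cayley[OF \<tau> assms(3)]
    using aux[of "norm (\<tau> - z)" "norm (\<tau> - w)" "1 - (norm z)\<^sup>2" "1 - (norm w)\<^sup>2" "norm (1 - cnj w * z)"]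
      nz one_minus_norm_sq_pos assms by simp
  then show ?thesis by (simp add: disc_cosh2_commute)
qed

section \<open>Univalent functions and maps close to the identity\<close>

text \<open>
  A weak Koebe theorem with an unspecified constant: if \<open>H\<close> moves the small vector \<open>p\<close> a distance
  \<open>d\<close>, then its image contains the disc of radius \<open>d / (C |p|)\<close> about \<open>H 0\<close>. If \<open>H\<close> omits \<open>w\<close>, then
  \<open>1 - (H - H 0) / (w - H 0)\<close> has a holomorphic square root \<open>q\<close> with \<open>q 0 = 1\<close>. Univalence prevents
  \<open>q\<close> from taking the value \<open>-1\<close>, so Schottky's theorem applies to \<open>-q\<close> and bounds \<open>H\<close> on a
  smaller disc in terms of \<open>|w - H 0|\<close>; the Schwarz lemma does the rest.
\<close>

lemma univalent_omitted_value_bound: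
  "\<exists>C>0. \<forall>H w p. H holomorphic_on ball 0 1 \<and> inj_on H (ball 0 1) \<and> w \<notin> H ` ball 0 1 \<and> norm p < 1/4
     \<longrightarrow> norm (H p - H 0) \<le> C * norm p * norm (w - H (0::complex))"
proof -
  define B where "B = exp (pi * exp (pi * (2 + 2 * 1 + 12 * (1/2) / (1 - 1/2))))"
  have main: "norm (H p - H 0) \<le> (8 * (1 + B\<^sup>2)) * norm p * norm (w - H 0)"
    if H: "H holomorphic_on ball 0 1" "inj_on H (ball 0 1)" "w \<notin> H ` ball 0 1" and p: "norm p < 1/4"
    for H :: "complex \<Rightarrow> complex" and w p
  proof -
    have w0: "w - H 0 \<noteq> 0" using H(3) by auto
    define k where "k = (\<lambda>z. 1 - (H z - H 0) / (w - H 0))"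
    have kh: "k holomorphic_on ball 0 1" unfolding k_def using w0 by (intro holomorphic_intros H(1)) auto
    have k0: "k z \<noteq> 0" if "z \<in> ball 0 1" for z
      using H(3) that w0 by (auto simp: k_def field_simps)
    have "simply_connected (ball (0::complex) 1)" by (simp add: convex_imp_simply_connected)
    then obtain q0 where q0: "q0 holomorphic_on ball 0 1" "\<And>z. z \<in> ball 0 1 \<Longrightarrow> k z = (q0 z)\<^sup>2"
      using simply_connected_eq_holomorphic_sqrt[of "ball (0::complex) 1"] kh k0 by (metis open_ball)
    have q00: "(q0 0)\<^sup>2 = 1" using q0(2)[of 0] by (simp add: k_def)
    then have nz: "q0 0 \<noteq> 0" by auto
    define q where "q = (\<lambda>z. q0 z / q0 0)"
    have qh: "q holomorphic_on ball 0 1" unfolding q_def using nz by (intro holomorphic_intros q0(1)) auto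
    have q2: "k z = (q z)\<^sup>2" if "z \<in> ball 0 1" for z
      using q0(2)[OF that] q00 by (simp add: q_def power_divide)
    have q1: "q 0 = 1" using nz by (simp add: q_def)
    \<comment> \<open>The values of \<open>q\<close> and \<open>-q\<close> never coincide, as \<open>q\<^sup>2\<close> is injective and has no zero.\<close>
    have qm: "q z \<noteq> -1" if "z \<in> ball 0 1" for z
    proof
      assume a: "q z = -1"
      then have "k z = 1" using q2[OF that] by simp
      then have "H z = H 0" using w0 by (simp add: k_def)
      then have "z = 0" using H(2) that by (auto dest: inj_onD)
      then show False using a q1 by simp
    qed
    have qb: "norm (q z) \<le> B" if "norm z \<le> 1/4" for z
    proof -
      let ?f = "\<lambda>\<zeta>. - q (\<zeta> / 2)"
      have "norm (?f (2 * z)) \<le> exp (pi * exp (pi * (2 + 2 * 1 + 12 * (1/2) / (1 - 1/2))))"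
      proof (rule Schottky[where f = ?f and z = "2 * z" and r = 1 and t = "1/2"])
        show "?f holomorphic_on cball 0 1"
          by (intro holomorphic_intros holomorphic_on_compose_gen[OF _ qh, unfolded o_def]) auto
        show "\<not> (?f \<zeta> = 0 \<or> ?f \<zeta> = 1)" if "\<zeta> \<in> cball 0 1" for \<zeta>
        proof -
          have i: "\<zeta> / 2 \<in> ball 0 1" using that by (simp add: norm_divide)
          then show ?thesis using k0[OF i] q2[OF i] qm[OF i] by (auto simp: minus_equation_iff)
        qed
      qed (use that q1 in \<open>auto simp: norm_mult\<close>)
      then show ?thesis by (simp add: B_def)
    qed
    have B1: "0 < 1 + B\<^sup>2" by (simp add: add_pos_nonneg)
    define K where "K = 2 * (1 + B\<^sup>2) * norm (w - H 0)"
    have K0: "K > 0" using w0 B1 unfolding K_def by (intro mult_pos_pos) auto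
    have Hb: "norm (H z - H 0) < K" if "norm z \<le> 1/4" for z
    proof -
      have "H z - H 0 = (1 - (q z)\<^sup>2) * (w - H 0)"
        using q2[of z] that w0 by (simp add: k_def field_simps)
      then have "norm (H z - H 0) = norm (1 - (q z)\<^sup>2) * norm (w - H 0)" by (simp add: norm_mult)
      also have "\<dots> \<le> (1 + B\<^sup>2) * norm (w - H 0)"
        using norm_triangle_ineq4[of 1 "(q z)\<^sup>2"] qb[OF that] power_mono[of "norm (q z)" B 2]
        by (intro mult_right_mono) (auto simp: norm_power)
      also have "\<dots> < K" unfolding K_def by (rule mult_strict_right_mono) (use w0 B1 in auto)
      finally show ?thesis .
    qed
    let ?G = "\<lambda>\<zeta>. (H (\<zeta> / 4) - H 0) / K"
    have "norm (?G (4 * p)) \<le> norm (4 * p)"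
    proof (rule Schwarz_Lemma(1)[where f = ?G and \<xi> = "4 * p"])
      show "?G holomorphic_on ball 0 1"
        using K0 by (intro holomorphic_intros holomorphic_on_compose_gen[OF _ H(1), unfolded o_def]) auto
      show "norm (?G \<zeta>) < 1" if "norm \<zeta> < 1" for \<zeta>
        using Hb[of "\<zeta> / 4"] that K0 by (simp add: norm_divide)
    qed (use p in \<open>auto simp: norm_mult\<close>)
    then have "norm (H p - H 0) \<le> 4 * norm p * K"
      using K0 by (simp add: norm_divide norm_mult field_simps)
    then show ?thesis by (simp add: K_def algebra_simps)
  qed
  show ?thesis
  proof (intro exI[of _ "8 * (1 + B\<^sup>2)"] conjI allI impI)
    show "0 < 8 * (1 + B\<^sup>2)" by (simp add: add_pos_nonneg)
  qed (use main in blast)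
qed

text \<open>
  Let \<open>v = (g - id) / 2\<close>, a zero-free function bounded by \<open>1\<close>. Then \<open>- log |v|\<close> is a positive
  harmonic function, so by Harnack's inequality it is large on the whole disc of radius \<open>3/4\<close> as soon
  as it is large at \<open>0\<close>.
\<close>

lemma fixed_point_free_near_identity:
  assumes "0 < \<delta>"
  shows "\<exists>\<epsilon>>0. \<forall>g. g holomorphic_on ball 0 1 \<and> (\<forall>z. norm z < 1 \<longrightarrow> norm (g z) < 1 \<and> g z \<noteq> z) \<and>
      norm (g 0) < \<epsilon> \<longrightarrow> (\<forall>z. norm z \<le> 3/4 \<longrightarrow> norm (g z - z) < (\<delta>::real))"
proof (intro exI[of _ "2 * exp (- (64 / 7) * (1 + \<bar>ln (2 / \<delta>)\<bar>))"] conjI allI impI)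
  fix g :: "complex \<Rightarrow> complex" and z :: complex
  assume g: "g holomorphic_on ball 0 1 \<and> (\<forall>z. norm z < 1 \<longrightarrow> norm (g z) < 1 \<and> g z \<noteq> z) \<and>
      norm (g 0) < 2 * exp (- (64 / 7) * (1 + \<bar>ln (2 / \<delta>)\<bar>))" and z: "norm z \<le> 3/4"
  let ?v = "\<lambda>z. (g z - z) / 2"
  have "?v holomorphic_on ball 0 1" using g by (intro holomorphic_intros) auto
  moreover have "\<forall>z\<in>ball 0 1. ?v z \<noteq> 0" using g by auto
  moreover have "simply_connected (ball (0::complex) 1)" by (simp add: convex_imp_simply_connected)
  ultimately obtain l where l: "l holomorphic_on ball 0 1" "\<And>z. z \<in> ball 0 1 \<Longrightarrow> ?v z = exp (l z)"
    using simply_connected_eq_holomorphic_log[of "ball (0::complex) 1"] by (metis (no_types, lifting) open_ball)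
  define q where "q = (\<lambda>z. - l z)"
  have qh: "q holomorphic_on ball 0 1" unfolding q_def by (intro holomorphic_intros l(1))
  have nv: "norm (?v z) = exp (- Re (q z))" if "norm z < 1" for z
    using l(2)[of z] that by (simp only: q_def mem_ball_0 norm_exp_eq_Re) simp
  have qpos: "0 < Re (q z)" if "norm z < 1" for z
  proof -
    have "norm (g z - z) < 2" using g that norm_triangle_ineq4[of "g z" z] by force
    then have "exp (- Re (q z)) < 1" using nv[OF that] by (simp add: norm_divide)
    then show ?thesis by simp
  qed
  have z1: "norm z < 1" using z by simp
  have "Re (q 0) \<le> 4 * halfplane_cosh2 (q 0) (q z) * Re (q z)"
    using qpos z1 by (intro halfplane_cosh2_Re_left_le) auto
  also have "\<dots> \<le> 4 * disc_cosh2 0 z * Re (q z)"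
    using Schwarz_Pick_halfplane[OF qh qpos, of 0 z] z1 qpos[OF z1] by simp
  also have "\<dots> \<le> 4 * (16 / 7) * Re (q z)"
  proof -
    have "(norm z)\<^sup>2 \<le> (3/4)\<^sup>2" using z by (intro power_mono) auto
    then have "disc_cosh2 0 z \<le> 16 / 7"
      unfolding disc_cosh2_zero by (simp add: field_simps power2_eq_square)
    then show ?thesis using qpos[OF z1] by simp
  qed
  finally have 1: "Re (q 0) \<le> (64 / 7) * Re (q z)" by simp
  have "exp (- Re (q 0)) < exp (- (64 / 7) * (1 + \<bar>ln (2 / \<delta>)\<bar>))"
    using nv[of 0] g by (simp add: norm_divide)
  then have "Re (q 0) > (64 / 7) * (1 + \<bar>ln (2 / \<delta>)\<bar>)" by simp
  then have "(64 / 7) * (1 + \<bar>ln (2 / \<delta>)\<bar>) < (64 / 7) * Re (q z)" using 1 by (rule less_le_trans)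
  then have "1 + \<bar>ln (2 / \<delta>)\<bar> < Re (q z)" by (simp only: mult_less_cancel_left_pos)
  then have "Re (q z) > ln (2 / \<delta>)" using abs_ge_self[of "ln (2 / \<delta>)"] by linarith
  then have "exp (- Re (q z)) < exp (- ln (2 / \<delta>))" by simp
  also have "\<dots> = \<delta> / 2" using assms by (simp add: exp_minus)
  finally show "norm (g z - z) < \<delta>" using nv[OF z1] by (simp add: norm_divide)
qed auto

text \<open>
  By Cauchy's estimate \<open>g - id\<close> is a contraction on the smaller disc.
\<close>

lemma near_identity_injective:
  assumes g: "g holomorphic_on ball 0 1" and b: "\<And>z. norm z \<le> 3/4 \<Longrightarrow> norm (g z - z) < 1/8"
  shows "inj_on g (ball 0 (1/2))"
proof -
  let ?v = "\<lambda>z. g z - z"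
  have vh: "?v holomorphic_on ball 0 1" by (intro holomorphic_intros g)
  have dv: "norm (deriv ?v z) \<le> 1/2" if "z \<in> ball 0 (1/2)" for z
  proof -
    have sub: "cball z (1/4) \<subseteq> cball 0 (3/4)" 
      using that by (simp add: cball_subset_cball_iff dist_norm)
    have "norm (deriv ?v z) \<le> (1/8) / (1/4)"
    proof (rule Cauchy_inequality[where n = 1, simplified])
      have "cball z (1/4) \<subseteq> ball 0 1" using sub by (auto simp: subset_iff)
      then have "?v holomorphic_on cball z (1/4)" using vh holomorphic_on_subset by blast
      then show "?v holomorphic_on ball z (1/4)" "continuous_on (cball z (1/4)) ?v"
        using ball_subset_cball by (auto intro: holomorphic_on_imp_continuous_on holomorphic_on_subset)
      show "norm (?v x) \<le> 1/8" if "norm (z - x) = 1/4" for x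
        using b[of x] sub that by (force simp: dist_norm)
    qed simp
    then show ?thesis by simp
  qed
  show ?thesis
  proof (rule inj_onI)
    fix a c assume ac: "a \<in> ball 0 (1/2)" "c \<in> ball 0 (1/2)" "g a = g c"
    have "norm (?v a - ?v c) \<le> 1/2 * norm (a - c)"
    proof (rule field_differentiable_bound[where S = "ball 0 (1/2)" and f' = "deriv ?v"])
      show "(?v has_field_derivative deriv ?v z) (at z within ball 0 (1/2))" if "z \<in> ball 0 (1/2)" for z
        using holomorphic_derivI[OF vh, of z] that by (auto intro: has_field_derivative_at_within)
    qed (use dv ac in auto)
    then have "norm (c - a) \<le> 1/2 * norm (a - c)" using ac by (simp add: algebra_simps)
    then show "a = c" by (simp add: norm_minus_commute)
  qed
qed

section \<open>Local inverses of the Koenigs function\<close>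

locale koenigs_map =
  fixes f h :: "complex \<Rightarrow> complex" and \<Omega> :: "complex set"
  assumes self_map: "disc_self_map f" and koenigs: "koenigs f h \<Omega>"
begin

lemma f_holomorphic: "f holomorphic_on unit_disc"
  and f_in_disc: "z \<in> unit_disc \<Longrightarrow> f z \<in> unit_disc"
  using self_map unfolding disc_self_map_def by blast+

lemma funpow_in_disc: "z \<in> unit_disc \<Longrightarrow> (f ^^ n) z \<in> unit_disc"
  by (induction n) (use f_in_disc in auto)

lemma funpow_holomorphic: "(f ^^ n) holomorphic_on unit_disc"
proof (induction n)
  case (Suc n)
  show ?case
    unfolding funpow.simps(2) using holomorphic_on_compose_gen[OF Suc f_holomorphic] funpow_in_disc by blast
qed (simp add: id_def)

lemma h_holomorphic: "h holomorphic_on unit_disc"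
  and h_image: "h ` unit_disc = \<Omega>"
  and h_f: "z \<in> unit_disc \<Longrightarrow> h (f z) = h z + 1"
  using koenigs by (auto simp: koenigs_def)

lemma h_eq_imp_orbits_merge:
  "z \<in> unit_disc \<Longrightarrow> w \<in> unit_disc \<Longrightarrow> h z = h w \<Longrightarrow> \<exists>n. (f ^^ n) z = (f ^^ n) w"
  using koenigs by (auto simp: koenigs_def)

lemma h_funpow: "z \<in> unit_disc \<Longrightarrow> h ((f ^^ n) z) = h z + of_nat n"
  by (induction n) (use h_f funpow_in_disc in auto)

lemma orbits_stay_merged:
  assumes "(f ^^ m) z = (f ^^ m) w" "m \<le> n" shows "(f ^^ n) z = (f ^^ n) w"
proof -
  obtain d where d: "n = d + m" using assms(2) by (metis add.commute le_Suc_ex)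
  show ?thesis unfolding d funpow_add comp_apply assms(1) ..
qed

lemma eventually_orbits_merge:
  assumes "z \<in> unit_disc" "w \<in> unit_disc" "h z = h w"
  shows "\<forall>\<^sub>F n in sequentially. (f ^^ n) z = (f ^^ n) w"
proof -
  obtain m where "(f ^^ m) z = (f ^^ m) w" using h_eq_imp_orbits_merge[OF assms] by blast
  then show ?thesis unfolding eventually_sequentially using orbits_stay_merged by blast
qed

lemma backward_union_iff: "w \<in> backward_union \<Omega> \<longleftrightarrow> (\<exists>n. \<exists>z\<in>unit_disc. h z = w + of_nat n)"
proof
  assume "w \<in> backward_union \<Omega>"
  then obtain n v where "v \<in> \<Omega>" "w = v - of_nat n" by (auto simp: backward_union_def)
  then show "\<exists>n. \<exists>z\<in>unit_disc. h z = w + of_nat n" using h_image by force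
next
  assume "\<exists>n. \<exists>z\<in>unit_disc. h z = w + of_nat n"
  then obtain n z where z: "z \<in> unit_disc" "h z = w + of_nat n" by blast
  then have "h (f z) \<in> \<Omega>" using h_image f_in_disc by blast
  moreover have "w = h (f z) - of_nat (Suc n)" using z h_f by simp
  ultimately show "w \<in> backward_union \<Omega>" unfolding backward_union_def
    by (intro UN_I[of "Suc n"]) auto
qed

lemma h_in_backward_union: "z \<in> unit_disc \<Longrightarrow> h z \<in> backward_union \<Omega>"
  using backward_union_iff[of "h z"] by (metis add.right_neutral of_nat_0)

lemma backward_union_shift:
  assumes "w \<in> backward_union \<Omega>" "0 \<le> t" shows "w + of_real t \<in> backward_union \<Omega>"
  using koenigs assms
  unfolding koenigs_def asymptotically_starlike_at_infinity_def starlike_at_infinity_def by blast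

text \<open>
  Holomorphic right inverses of \<open>h\<close> up to the translation \<open>c\<close>. Iterating \<open>f\<close> raises \<open>c\<close> by integers,
  and this is what makes it possible to compare and to glue sections.
\<close>

definition koenigs_section :: "complex set \<Rightarrow> complex \<Rightarrow> (complex \<Rightarrow> complex) \<Rightarrow> bool"
  where "koenigs_section S c u \<longleftrightarrow>
    u holomorphic_on S \<and> u ` S \<subseteq> unit_disc \<and> (\<forall>w\<in>S. h (u w) = w + c)"

lemma koenigs_sectionD:
  assumes "koenigs_section S c u"
  shows "u holomorphic_on S" "w \<in> S \<Longrightarrow> u w \<in> unit_disc" "w \<in> S \<Longrightarrow> h (u w) = w + c"
  using assms by (auto simp: koenigs_section_def)

lemma koenigs_section_subset: "koenigs_section S c u \<Longrightarrow> T \<subseteq> S \<Longrightarrow> koenigs_section T c u"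
  by (auto simp: koenigs_section_def intro: holomorphic_on_subset)

lemma koenigs_section_iterate:
  assumes "koenigs_section S c u"
  shows "koenigs_section S (c + of_nat m) (\<lambda>w. (f ^^ m) (u w))"
  using koenigs_sectionD[OF assms] funpow_in_disc
  by (auto simp: koenigs_section_def h_funpow add.assoc
      intro!: holomorphic_on_compose_gen[OF _ funpow_holomorphic, unfolded o_def])

lemma koenigs_section_shift:
  assumes "koenigs_section S c u" "\<And>w. w \<in> T \<Longrightarrow> w + b \<in> S"
  shows "koenigs_section T (c + b) (\<lambda>w. u (w + b))"
proof -
  have "(\<lambda>w. u (w + b)) holomorphic_on T"
    by (rule holomorphic_on_compose_gen[OF _ koenigs_sectionD(1)[OF assms(1)], unfolded o_def])
       (auto intro!: holomorphic_intros assms(2))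
  then show ?thesis
    using koenigs_sectionD(2,3)[OF assms(1)] assms(2) by (auto simp: koenigs_section_def)
qed

lemma koenigs_section_inj:
  assumes "koenigs_section S c u" shows "inj_on u S"
  using koenigs_sectionD(3)[OF assms] by (metis add_right_cancel inj_onI)

lemma koenigs_section_open_image:
  assumes "koenigs_section S c u" "open S" shows "open (u ` S)"
  using open_mapping_thm3[OF koenigs_sectionD(1) _ koenigs_section_inj] assms by blast

text \<open>
  The image of a section is open and \<open>h\<close> is injective on it, so the set where two sections agree is
  open: it is the set where the second takes values in the image of the first.
\<close>

lemma koenigs_section_unique:
  assumes S: "open S" "connected S" and u: "koenigs_section S c u" and v: "koenigs_section S c v"
    and a: "a \<in> S" "u a = v a" and w: "w \<in> S"
  shows "u w = v w"
proof -
  have eq: "{w \<in> S. u w = v w} = S \<inter> v -` (u ` S)"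
  proof (intro set_eqI iffI)
    fix w assume "w \<in> {w \<in> S. u w = v w}"
    then have "w \<in> S" "v w = u w" by auto
    then show "w \<in> S \<inter> v -` (u ` S)" by blast
  next
    fix w assume "w \<in> S \<inter> v -` (u ` S)"
    then obtain w' where w: "w \<in> S" "w' \<in> S" "v w = u w'" by blast
    then have "w' = w"
      using koenigs_sectionD(3)[OF u w(2)] koenigs_sectionD(3)[OF v w(1)] by simp
    then show "w \<in> {w \<in> S. u w = v w}" using w by simp
  qed
  have cu: "continuous_on S u" "continuous_on S v"
    using u v koenigs_sectionD(1) holomorphic_on_imp_continuous_on by blast+
  have o1: "open {w \<in> S. u w = v w}"
    unfolding eq by (rule continuous_open_preimage[OF cu(2) S(1) koenigs_section_open_image[OF u S(1)]])
  have "{w \<in> S. u w \<noteq> v w} = S \<inter> (\<lambda>w. u w - v w) -` (- {0})" by auto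
  then have o2: "open {w \<in> S. u w \<noteq> v w}"
    using continuous_open_preimage[OF continuous_on_diff[OF cu] S(1), of "- {0}"] by (simp add: open_Compl)
  have "{w \<in> S. u w = v w} \<inter> S = {} \<or> {w \<in> S. u w \<noteq> v w} \<inter> S = {}"
    by (rule connectedD[OF S(2) o1 o2]) auto
  then show ?thesis using a w by blast
qed

text \<open>
  The same argument seen from the disc: a connected set \<open>A\<close> on which the section can be composed with
  \<open>h\<close> lies in the image of the section as soon as it meets it, since on \<open>A\<close> this image is the closed
  set where the composition is the identity.
\<close>

lemma koenigs_section_captures:
  assumes A: "open A" "connected A" "A \<subseteq> unit_disc" and S: "open S"
    and u: "koenigs_section S c u" and hA: "\<And>z. z \<in> A \<Longrightarrow> h z - c \<in> S"
    and a: "a \<in> A" "a \<in> u ` S"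
  shows "A \<subseteq> u ` S"
proof -
  have ch: "continuous_on A h"
    using h_holomorphic A(3) by (meson holomorphic_on_imp_continuous_on continuous_on_subset)
  have cc: "continuous_on A (\<lambda>z. u (h z - c))"
    using holomorphic_on_imp_continuous_on[OF koenigs_sectionD(1)[OF u]] hA
    by (auto intro!: continuous_on_compose2[of S u] continuous_intros ch)
  have eq: "A \<inter> u ` S = {z \<in> A. u (h z - c) = z}"
    using koenigs_sectionD(3)[OF u] hA by (auto simp: image_iff) (metis add_diff_cancel_right')+
  have o1: "open (A \<inter> u ` S)" using A koenigs_section_open_image[OF u S] by blast
  have "A - u ` S = A \<inter> (\<lambda>z. u (h z - c) - z) -` (- {0})" using eq by auto
  then have o2: "open (A - u ` S)"
    using continuous_open_preimage[OF continuous_on_diff[OF cc continuous_on_id] A(1), of "- {0}"]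
    by (simp add: open_Compl)
  have "(A \<inter> u ` S) \<inter> A = {} \<or> (A - u ` S) \<inter> A = {}"
    by (rule connectedD[OF A(2) o1 o2]) auto
  then show ?thesis using a by blast
qed

text \<open>
  At each point the two orbits merge after a number of steps that depends on the point. As there are
  only countably many such numbers, a single one works for uncountably many points, and then for all
  by the identity theorem.
\<close>

lemma eventually_sections_merge:
  assumes S: "open S" "connected S" and u: "u holomorphic_on S" "u ` S \<subseteq> unit_disc"
    and v: "v holomorphic_on S" "v ` S \<subseteq> unit_disc" and eq: "\<And>w. w \<in> S \<Longrightarrow> h (u w) = h (v w)"
  shows "\<forall>\<^sub>F n in sequentially. \<forall>w\<in>S. (f ^^ n) (u w) = (f ^^ n) (v w)"
proof (cases "S = {}")
  case False
  then obtain c r where r: "r > 0" "cball c r \<subseteq> S" using S(1) open_contains_cball by (metis ex_in_conv)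
  define T where "T = (\<lambda>n. {w \<in> cball c r. (f ^^ n) (u w) - (f ^^ n) (v w) = 0})"
  have "cball c r = (\<Union>n. T n)"
  proof
    show "cball c r \<subseteq> (\<Union>n. T n)"
    proof
      fix w assume w: "w \<in> cball c r"
      then have wS: "w \<in> S" using r(2) by blast
      then obtain n where "(f ^^ n) (u w) = (f ^^ n) (v w)"
        using h_eq_imp_orbits_merge[of "u w" "v w"] u(2) v(2) eq[OF wS] by blast
      then show "w \<in> (\<Union>n. T n)" using w by (auto simp: T_def)
    qed
  qed (auto simp: T_def)
  moreover have "uncountable (cball c r)" using r(1) uncountable_cball by blast
  ultimately have "\<not> (\<forall>n. countable (T n))" by (metis countable_UN countableI_type)
  then obtain n where n: "uncountable (T n)" by blast
  let ?F = "\<lambda>w. (f ^^ n) (u w) - (f ^^ n) (v w)"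
  have F: "?F holomorphic_on S"
    by (intro holomorphic_intros holomorphic_on_compose_gen[OF _ funpow_holomorphic, unfolded o_def] u v)
  have "\<not> finite (T n)" using n countable_finite by blast
  then have "?F constant_on S"
    using holomorphic_compact_finite_zeros[OF F S, of "cball c r"] r(2) by (auto simp: T_def)
  moreover obtain w where "w \<in> S" "?F w = 0" 
  proof -
    have "T n \<noteq> {}" using n by auto
    then obtain w where "w \<in> T n" by blast
    then show thesis using that[of w] r(2) unfolding T_def by blast
  qed
  ultimately have "\<forall>w\<in>S. (f ^^ n) (u w) = (f ^^ n) (v w)"
    unfolding constant_on_def by (metis eq_iff_diff_eq_0)
  then have "\<forall>m\<ge>n. \<forall>w\<in>S. (f ^^ m) (u w) = (f ^^ m) (v w)"
    using orbits_stay_merged by blast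
  then show ?thesis unfolding eventually_sequentially by blast
qed auto

text \<open>
  Let \<open>\<xi>\<close> be a point of the orbit where the order \<open>k\<close> of \<open>h - h \<xi>\<close> is least. A critical point of
  an iterate at \<open>\<xi>\<close> would make the order at \<open>\<xi>\<close> larger than the one at its image, so all iterates
  are injective near \<open>\<xi>\<close>. In a coordinate in which \<open>h - h \<xi>\<close> is the \<open>k\<close>-th power, the rotation by
  a primitive \<open>k\<close>-th root of unity leaves \<open>h\<close> invariant, hence also some iterate of \<open>f\<close> by
  \<open>eventually_sections_merge\<close>. This contradicts injectivity unless \<open>k = 1\<close>.
\<close>

lemma orbit_eventually_noncritical:
  assumes z: "z \<in> unit_disc" shows "\<exists>n. deriv h ((f ^^ n) z) \<noteq> 0"
proof -
  have hconst: "\<not> h constant_on unit_disc"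
    using h_f[OF z] f_in_disc[OF z] z unfolding constant_on_def by (metis add_cancel_right_right zero_neq_one)
  define Ord where "Ord = (\<lambda>a. LEAST n. 0 < n \<and> (deriv ^^ n) h a \<noteq> 0)"
  have Ord: "0 < Ord a" "(deriv ^^ Ord a) h a \<noteq> 0" "\<And>i. 0 < i \<Longrightarrow> i < Ord a \<Longrightarrow> (deriv ^^ i) h a = 0"
    if a: "a \<in> unit_disc" for a
  proof -
    have "\<exists>n. 0 < n \<and> (deriv ^^ n) h a \<noteq> 0"
      using holomorphic_fun_eq_const_on_connected[OF h_holomorphic open_ball connected_ball _ a] hconst
      unfolding constant_on_def by blast
    then show "0 < Ord a" "(deriv ^^ Ord a) h a \<noteq> 0"
      unfolding Ord_def by (metis (mono_tags, lifting) LeastI)+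
    show "\<And>i. 0 < i \<Longrightarrow> i < Ord a \<Longrightarrow> (deriv ^^ i) h a = 0"
      unfolding Ord_def using not_less_Least by blast
  qed
  obtain N where N: "\<And>n. Ord ((f ^^ N) z) \<le> Ord ((f ^^ n) z)"
    using ex_has_least_nat[of "\<lambda>_. True" _ "\<lambda>n. Ord ((f ^^ n) z)"] by blast
  define \<xi> where "\<xi> = (f ^^ N) z"
  define k where "k = Ord \<xi>"
  have \<xi>: "\<xi> \<in> unit_disc" using funpow_in_disc[OF z] by (simp add: \<xi>_def)
  note k = Ord[OF \<xi>, folded k_def]
  obtain g r where g: "0 < r" "g holomorphic_on ball \<xi> r"
    "\<And>w. w \<in> ball \<xi> r \<Longrightarrow> h w - h \<xi> = ((w - \<xi>) * g w) ^ k"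
    "\<And>w. w \<in> ball \<xi> r \<Longrightarrow> g w \<noteq> 0"
    using holomorphic_factor_order_of_zero_strong[OF h_holomorphic open_ball \<xi> k(1,2)] k(3) by metis
  \<comment> \<open>A zero of the derivative would force \<open>g \<xi> = 0\<close>, comparing the two factorizations of \<open>h\<close>.\<close>
  have dfn: "deriv (f ^^ m) \<xi> \<noteq> 0" for m
  proof
    assume d0: "deriv (f ^^ m) \<xi> = 0"
    define F where "F = f ^^ m"
    define \<eta> where "\<eta> = F \<xi>"
    have \<eta>: "\<eta> \<in> unit_disc" using funpow_in_disc[OF \<xi>] by (simp add: \<eta>_def F_def)
    define k' where "k' = Ord \<eta>"
    have "\<eta> = (f ^^ (m + N)) z" by (simp add: \<eta>_def F_def \<xi>_def funpow_add)
    then have kk: "k \<le> k'" using N by (simp add: k_def k'_def \<xi>_def)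
    note k' = Ord[OF \<eta>, folded k'_def]
    obtain g' r' where g': "0 < r'" "g' holomorphic_on ball \<eta> r'"
      "\<And>w. w \<in> ball \<eta> r' \<Longrightarrow> h w - h \<eta> = ((w - \<eta>) * g' w) ^ k'"
      using holomorphic_factor_order_of_zero_strong[OF h_holomorphic open_ball \<eta> k'(1,2)] k'(3) by metis
    have F: "F holomorphic_on unit_disc" unfolding F_def by (rule funpow_holomorphic)
    have dF: "(F has_field_derivative 0) (at \<xi>)"
      using holomorphic_derivI[OF F open_ball \<xi>] d0 F_def by simp
    have lim1: "((\<lambda>w. (F w - \<eta>) / (w - \<xi>)) \<longlongrightarrow> 0) (at \<xi>)"
      using dF by (simp add: has_field_derivative_iff \<eta>_def)
    have Flim: "(F \<longlongrightarrow> \<eta>) (at \<xi>)"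
      using DERIV_isCont[OF dF] by (simp add: isCont_def \<eta>_def)
    have "isCont g' \<eta>" using holomorphic_on_imp_continuous_on[OF g'(2)] g'(1) by (simp add: continuous_on_eq_continuous_at)
    then have glim: "((\<lambda>w. g' (F w)) \<longlongrightarrow> g' \<eta>) (at \<xi>)"
      using Flim by (rule isCont_tendsto_compose)
    have ev: "\<forall>\<^sub>F w in at \<xi>. g w ^ k =
        ((F w - \<eta>) / (w - \<xi>) * g' (F w)) ^ k * ((F w - \<eta>) * g' (F w)) ^ (k' - k)"
    proof -
      have "\<forall>\<^sub>F w in at \<xi>. F w \<in> ball \<eta> r'"
        using Flim g'(1) by (metis centre_in_ball open_ball topological_tendstoD)
      moreover have "\<forall>\<^sub>F w in at \<xi>. w \<in> ball \<xi> r \<and> w \<in> unit_disc \<and> w \<noteq> \<xi>"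
        using eventually_at_in_open[of "ball \<xi> r \<inter> unit_disc" \<xi>] g(1) \<xi> by (auto elim: eventually_mono)
      ultimately show ?thesis
      proof eventually_elim
        case (elim w)
        have "((w - \<xi>) * g w) ^ k = ((F w - \<eta>) * g' (F w)) ^ k'"
          using g(3)[of w] g'(3)[of "F w"] elim h_funpow[of w m] h_funpow[OF \<xi>, of m] by (simp add: F_def \<eta>_def)
        also have "\<dots> = ((F w - \<eta>) * g' (F w)) ^ k * ((F w - \<eta>) * g' (F w)) ^ (k' - k)"
          using kk by (simp flip: power_add)
        finally have "g w ^ k = ((F w - \<eta>) * g' (F w)) ^ k / (w - \<xi>) ^ k * ((F w - \<eta>) * g' (F w)) ^ (k' - k)"
          using elim by (simp add: power_mult_distrib[of "w - \<xi>" "g w"] power_mult_distrib[of "g w" "w - \<xi>"] eq_divide_eq mult.commute)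
        then show ?case by (simp add: power_divide[symmetric])
      qed
    qed
    have "((\<lambda>w. ((F w - \<eta>) / (w - \<xi>) * g' (F w)) ^ k * ((F w - \<eta>) * g' (F w)) ^ (k' - k))
        \<longlongrightarrow> (0 * g' \<eta>) ^ k * ((\<eta> - \<eta>) * g' \<eta>) ^ (k' - k)) (at \<xi>)"
      by (intro tendsto_intros lim1 glim Flim)
    then have "((\<lambda>w. g w ^ k) \<longlongrightarrow> 0) (at \<xi>)"
      using k(1) tendsto_cong[OF ev] by (simp add: zero_power)
    moreover have "isCont g \<xi>" using holomorphic_on_imp_continuous_on[OF g(2)] g(1) by (simp add: continuous_on_eq_continuous_at)
    then have "((\<lambda>w. g w ^ k) \<longlongrightarrow> g \<xi> ^ k) (at \<xi>)"
      by (intro tendsto_power) (simp add: isCont_def)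
    ultimately have "g \<xi> ^ k = 0" using tendsto_unique[of "at \<xi>"] by (metis trivial_limit_at)
    then show False using g(1,4) by simp
  qed
  have "k = 1"
  proof (rule ccontr)
    assume "k \<noteq> 1"
    define r1 where "r1 = min r (1 - norm \<xi>)"
    have r1: "r1 > 0" "ball \<xi> r1 \<subseteq> ball \<xi> r" "ball \<xi> r1 \<subseteq> unit_disc"
      using g(1) \<xi> by (auto simp: r1_def ball_subset_ball_iff dist_norm)
    define \<psi> where "\<psi> = (\<lambda>w. (w - \<xi>) * g w)"
    have gh: "g holomorphic_on ball \<xi> r1" using g(2) r1(2) holomorphic_on_subset by blast
    have \<psi>h: "\<psi> holomorphic_on ball \<xi> r1" unfolding \<psi>_def by (intro holomorphic_intros gh)
    have "(g has_field_derivative deriv g \<xi>) (at \<xi>)" using holomorphic_derivI[OF gh] r1 by auto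
    then have "(\<psi> has_field_derivative g \<xi>) (at \<xi>)"
      unfolding \<psi>_def by (auto intro!: derivative_eq_intros)
    then have "deriv \<psi> \<xi> \<noteq> 0" using g(1,4) by (simp add: DERIV_imp_deriv)
    then obtain s where s: "s > 0" "ball \<xi> s \<subseteq> ball \<xi> r1" "open (\<psi> ` ball \<xi> s)" "inj_on \<psi> (ball \<xi> s)"
      using has_complex_derivative_locally_invertible[OF \<psi>h _ open_ball] r1(1) by (metis centre_in_ball)
    obtain P where P: "P holomorphic_on \<psi> ` ball \<xi> s" "\<And>w. w \<in> ball \<xi> s \<Longrightarrow> P (\<psi> w) = w"
      using holomorphic_has_inverse[OF holomorphic_on_subset[OF \<psi>h s(2)] open_ball s(4)] by metis
    have "0 \<in> \<psi> ` ball \<xi> s" using s(1) by (auto simp: \<psi>_def image_iff)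
    then obtain \<delta> where \<delta>: "\<delta> > 0" "ball 0 \<delta> \<subseteq> \<psi> ` ball \<xi> s" using s(3) openE by blast
    define \<omega> where "\<omega> = exp (2 * of_real pi * \<i> * (1 / of_nat k))"
    have \<omega>: "\<omega> ^ k = 1" "norm \<omega> = 1" "\<omega> \<noteq> 1"
      using complex_root_unity[of k 1] complex_root_unity_eq_1[of k 1] k(1) \<open>k \<noteq> 1\<close>
      by (auto simp: \<omega>_def)
    have Px: "P x \<in> ball \<xi> s" "\<psi> (P x) = x" "h (P x) = h \<xi> + x ^ k" if x: "x \<in> ball 0 \<delta>" for x
    proof -
      obtain w where w: "w \<in> ball \<xi> s" "x = \<psi> w" using x \<delta> by blast
      then show 1: "P x \<in> ball \<xi> s" "\<psi> (P x) = x" using P(2) by auto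
      then have "P x \<in> ball \<xi> r" using s r1 by blast
      then show "h (P x) = h \<xi> + x ^ k" using g(3) 1(2) by (simp add: \<psi>_def algebra_simps)
    qed
    have \<omega>in: "\<omega> * x \<in> ball 0 \<delta>" if "x \<in> ball 0 \<delta>" for x using that \<omega> by (simp add: norm_mult)
    have Ph: "P holomorphic_on ball 0 \<delta>" using P(1) \<delta>(2) holomorphic_on_subset by blast
    have "\<forall>\<^sub>F n in sequentially. \<forall>x\<in>ball 0 \<delta>. (f ^^ n) (P x) = (f ^^ n) (P (\<omega> * x))"
    proof (rule eventually_sections_merge)
      show "(\<lambda>x. P (\<omega> * x)) holomorphic_on ball 0 \<delta>"
        by (rule holomorphic_on_compose_gen[OF _ Ph, unfolded o_def]) (auto intro!: holomorphic_intros \<omega>in)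
      show "P ` ball 0 \<delta> \<subseteq> unit_disc" using Px(1) s(2) r1(3) by blast
      show "(\<lambda>x. P (\<omega> * x)) ` ball 0 \<delta> \<subseteq> unit_disc" using Px(1) \<omega>in s(2) r1(3) by blast
      show "h (P x) = h (P (\<omega> * x))" if "x \<in> ball 0 \<delta>" for x
        using Px(3)[OF that] Px(3)[OF \<omega>in[OF that]] \<omega>(1) by (simp add: power_mult_distrib)
    qed (use Ph in auto)
    then obtain n where "\<forall>x\<in>ball 0 \<delta>. (f ^^ n) (P x) = (f ^^ n) (P (\<omega> * x))"
      unfolding eventually_sequentially by blast
    then have n: "\<And>x. x \<in> ball 0 \<delta> \<Longrightarrow> (f ^^ n) (P x) = (f ^^ n) (P (\<omega> * x))" by blast
    obtain t where t: "t > 0" "ball \<xi> t \<subseteq> unit_disc" "inj_on (f ^^ n) (ball \<xi> t)"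
      using has_complex_derivative_locally_injective[OF funpow_holomorphic \<xi> open_ball dfn] by metis
    have P0: "P 0 = \<xi>" using P(2)[of \<xi>] s(1) by (simp add: \<psi>_def)
    have "isCont P 0" using holomorphic_on_imp_continuous_on[OF Ph] \<delta>(1) by (simp add: continuous_on_eq_continuous_at)
    then obtain e where e: "e > 0" "\<And>x. norm x < e \<Longrightarrow> dist (P x) \<xi> < t"
      using t(1) P0 by (auto simp: continuous_at_eps_delta)
    define x :: complex where "x = of_real (min e \<delta> / 2)"
    have x: "x \<in> ball 0 \<delta>" "norm x < e" "x \<noteq> 0" using e(1) \<delta>(1) by (auto simp: x_def)
    have "P x \<in> ball \<xi> t" "P (\<omega> * x) \<in> ball \<xi> t"
      using e(2)[of x] e(2)[of "\<omega> * x"] x \<omega> by (auto simp: norm_mult dist_commute)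
    then have "P x = P (\<omega> * x)" using n[OF x(1)] t(3) by (auto dest: inj_onD)
    then have "x = \<omega> * x" using Px(2) x(1) \<omega>in by metis
    then show False using x(3) \<omega>(3) by simp
  qed
  then show ?thesis using k(2) by (auto simp: \<xi>_def intro!: exI[of _ N])
qed

lemma local_section:
  assumes w: "w \<in> backward_union \<Omega>"
  shows "\<exists>r>0. \<exists>n u. koenigs_section (ball w r) (of_nat n) u"
proof -
  obtain m z where z: "z \<in> unit_disc" "h z = w + of_nat m" using w backward_union_iff by blast
  obtain n where n: "deriv h ((f ^^ n) z) \<noteq> 0" using orbit_eventually_noncritical[OF z(1)] by blast
  define p where "p = (f ^^ n) z"
  have p: "p \<in> unit_disc" "h p = w + of_nat (m + n)"
    using funpow_in_disc[OF z(1)] h_funpow[OF z(1)] z(2) by (auto simp: p_def)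
  obtain s where s: "s > 0" "ball p s \<subseteq> unit_disc" "open (h ` ball p s)" "inj_on h (ball p s)"
    using has_complex_derivative_locally_invertible[OF h_holomorphic p(1) open_ball] n p_def by metis
  obtain P where P: "P holomorphic_on h ` ball p s" "\<And>w. w \<in> ball p s \<Longrightarrow> P (h w) = w"
    using holomorphic_has_inverse[OF holomorphic_on_subset[OF h_holomorphic s(2)] open_ball s(4)] by metis
  have P': "koenigs_section (h ` ball p s) 0 P"
    using P s(2) by (auto simp: koenigs_section_def)
  have "w + of_nat (m + n) \<in> h ` ball p s" using p(2) s(1) by (metis centre_in_ball image_eqI)
  then obtain r where r: "r > 0" "ball (w + of_nat (m + n)) r \<subseteq> h ` ball p s" using s(3) openE by blast
  have "koenigs_section (ball w r) (0 + of_nat (m + n)) (\<lambda>v. P (v + of_nat (m + n)))"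
    by (rule koenigs_section_shift[OF koenigs_section_subset[OF P' r(2)]]) (simp add: dist_norm)
  then have "koenigs_section (ball w r) (of_nat (m + n)) (\<lambda>v. P (v + of_nat (m + n)))" by simp
  then show ?thesis using r(1) by blast
qed

text \<open>
  Finitely many discs with local sections cover the compact set. The sections are brought to a common
  level by iteration; they agree on the (convex) intersections of two discs after finitely many
  further iterations, and can then be glued.
\<close>

lemma section_over_compact:
  assumes K: "compact K" "K \<subseteq> backward_union \<Omega>"
  shows "\<exists>S n u. open S \<and> K \<subseteq> S \<and> koenigs_section S (of_nat n) u"
proof -
  obtain r n u where loc: "\<And>w. w \<in> K \<Longrightarrow> 0 < r w" "\<And>w. w \<in> K \<Longrightarrow> koenigs_section (ball w (r w)) (of_nat (n w)) (u w)"
    using local_section K(2) by (metis in_mono)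
  obtain C where C: "C \<subseteq> K" "finite C" "K \<subseteq> (\<Union>c\<in>C. ball c (r c))"
    using compactE_image[OF K(1), of K "\<lambda>c. ball c (r c)"] loc(1) by force
  define M where "M = Max (insert 0 (n ` C))"
  define v where "v = (\<lambda>c w. (f ^^ (M - n c)) (u c w))"
  have v: "koenigs_section (ball c (r c)) (of_nat M) (v c)" if "c \<in> C" for c
  proof -
    have "n c \<le> M" unfolding M_def using C(2) that by (intro Max_ge) auto
    then have "(of_nat (n c) + of_nat (M - n c) :: complex) = of_nat M" by (simp flip: of_nat_add)
    then show ?thesis
      using koenigs_section_iterate[OF loc(2), of c "M - n c"] that C(1) by (auto simp: v_def)
  qed
  have "\<forall>\<^sub>F m in sequentially. \<forall>w\<in>ball a (r a) \<inter> ball b (r b). (f ^^ m) (v a w) = (f ^^ m) (v b w)"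
    if ab: "a \<in> C" "b \<in> C" for a b
  proof (rule eventually_sections_merge)
    show "connected (ball a (r a) \<inter> ball b (r b))"
      by (intro convex_connected convex_Int convex_ball)
  qed (use koenigs_sectionD[OF v[OF ab(1)]] koenigs_sectionD[OF v[OF ab(2)]] in
        \<open>auto intro: holomorphic_on_subset\<close>)
  then have "\<forall>\<^sub>F m in sequentially. \<forall>a\<in>C. \<forall>b\<in>C. \<forall>w\<in>ball a (r a) \<inter> ball b (r b). (f ^^ m) (v a w) = (f ^^ m) (v b w)"
    by (intro eventually_ball_finite[OF C(2)] ballI)
  then obtain m where "\<forall>a\<in>C. \<forall>b\<in>C. \<forall>w\<in>ball a (r a) \<inter> ball b (r b). (f ^^ m) (v a w) = (f ^^ m) (v b w)"
    unfolding eventually_sequentially by blast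
  then have m: "\<And>a b w. a \<in> C \<Longrightarrow> b \<in> C \<Longrightarrow> w \<in> ball a (r a) \<inter> ball b (r b) \<Longrightarrow> (f ^^ m) (v a w) = (f ^^ m) (v b w)"
    by blast
  define S where "S = (\<Union>c\<in>C. ball c (r c))"
  define x where "x = (\<lambda>w. (f ^^ m) (v (SOME c. c \<in> C \<and> w \<in> ball c (r c)) w))"
  have xv: "x w = (f ^^ m) (v c w)" if "c \<in> C" "w \<in> ball c (r c)" for c w
  proof -
    have "(SOME c. c \<in> C \<and> w \<in> ball c (r c)) \<in> C \<and> w \<in> ball (SOME c. c \<in> C \<and> w \<in> ball c (r c)) (r (SOME c. c \<in> C \<and> w \<in> ball c (r c)))"
      by (rule someI[of "\<lambda>c. c \<in> C \<and> w \<in> ball c (r c)"]) (use that in blast)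
    then show ?thesis unfolding x_def using m that by blast
  qed
  have it: "koenigs_section (ball c (r c)) (of_nat (M + m)) (\<lambda>w. (f ^^ m) (v c w))" if "c \<in> C" for c
    using koenigs_section_iterate[OF v[OF that], of m] by simp
  have "koenigs_section S (of_nat (M + m)) x"
    unfolding koenigs_section_def
  proof (intro conjI ballI)
    show "x holomorphic_on S" unfolding S_def
    proof (rule holomorphic_on_UN_open)
      fix c assume c: "c \<in> C"
      show "x holomorphic_on ball c (r c)"
        by (rule holomorphic_transform[OF koenigs_sectionD(1)[OF it[OF c]]]) (use xv c in auto)
    qed auto
  qed (use xv koenigs_sectionD(2,3)[OF it] in \<open>auto simp: S_def\<close>)
  moreover have "open S" "K \<subseteq> S" using C(3) by (auto simp: S_def)
  ultimately show ?thesis by blast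
qed
end

section \<open>The fundamental domain\<close>

definition stadium :: "complex \<Rightarrow> real \<Rightarrow> complex set"
  where "stadium p r = (\<Union>t\<in>{0..}. ball (p + of_real t) r)"

lemma mem_stadium: "w \<in> stadium p r \<longleftrightarrow> (\<exists>t\<ge>0. norm (w - (p + of_real t)) < r)"
  by (auto simp: stadium_def dist_norm norm_minus_commute)

lemma open_stadium: "open (stadium p r)"
  by (auto simp: stadium_def)

lemma centre_in_stadium: "0 < r \<Longrightarrow> p \<in> stadium p r"
  unfolding mem_stadium by (intro exI[of _ 0]) auto

lemma stadium_add: "w \<in> stadium p r \<Longrightarrow> 0 \<le> s \<Longrightarrow> w + of_real s \<in> stadium p r"
  unfolding mem_stadium by (metis (no_types, opaque_lifting) add.assoc add_diff_cancel_right add_nonneg_nonneg of_real_add)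

lemma stadium_mono: "r \<le> r' \<Longrightarrow> stadium p r \<subseteq> stadium p r'"
  by (force simp: mem_stadium)

lemma convex_stadium: "convex (stadium p r)"
proof (rule convexI)
  fix x y :: complex and u v :: real
  assume xy: "x \<in> stadium p r" "y \<in> stadium p r" and uv: "0 \<le> u" "0 \<le> v" "u + v = 1"
  obtain s t where s: "s \<ge> 0" "norm (x - (p + of_real s)) < r" and t: "t \<ge> 0" "norm (y - (p + of_real t)) < r"
    using xy unfolding mem_stadium by blast
  have "x - (p + of_real s) \<in> ball 0 r" "y - (p + of_real t) \<in> ball 0 r" using s t by auto
  then have "u *\<^sub>R (x - (p + of_real s)) + v *\<^sub>R (y - (p + of_real t)) \<in> ball 0 r"
    using uv by (intro convexD[OF convex_ball])
  moreover have "u *\<^sub>R (x - (p + of_real s)) + v *\<^sub>R (y - (p + of_real t))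
      = u *\<^sub>R x + v *\<^sub>R y - ((u + v) *\<^sub>R p + of_real (u * s + v * t))"
    by (simp add: algebra_simps scaleR_conv_of_real)
  ultimately show "u *\<^sub>R x + v *\<^sub>R y \<in> stadium p r"
    unfolding mem_stadium using uv s t by (intro exI[of _ "u * s + v * t"]) auto
qed

lemma stadium_contains_stadium:
  assumes "w \<in> stadium p r" obtains r' where "0 < r'" "stadium w r' \<subseteq> stadium p r"
proof -
  obtain t where t: "t \<ge> 0" "norm (w - (p + of_real t)) < r" using assms unfolding mem_stadium by blast
  show ?thesis
  proof
    show "0 < r - norm (w - (p + of_real t))" using t by simp
    show "stadium w (r - norm (w - (p + of_real t))) \<subseteq> stadium p r"
    proof
      fix x assume "x \<in> stadium w (r - norm (w - (p + of_real t)))"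
      then obtain s where s: "s \<ge> 0" "norm (x - (w + of_real s)) < r - norm (w - (p + of_real t))"
        unfolding mem_stadium by blast
      have "x - (p + of_real (t + s)) = (x - (w + of_real s)) + (w - (p + of_real t))"
        by (simp add: algebra_simps)
      then have "norm (x - (p + of_real (t + s))) < r"
        using s norm_triangle_ineq[of "x - (w + of_real s)" "w - (p + of_real t)"] by (smt (verit))
      then show "x \<in> stadium p r" unfolding mem_stadium using s t by (metis add_nonneg_nonneg)
    qed
  qed
qed

text \<open>
  From every point outside \<open>S\<close> a horizontal ray to the left avoids \<open>S\<close>, so the complement of \<open>S\<close> has
  no bounded component.
\<close>

lemma starlike_at_infinity_simply_connected:
  assumes "starlike_at_infinity S" shows "simply_connected S"
proof -
  have S: "open S" "connected S" "\<And>w t. w \<in> S \<Longrightarrow> 0 \<le> t \<Longrightarrow> w + of_real t \<in> S"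
    using assms by (auto simp: starlike_at_infinity_def planar_domain_def)
  have "w \<notin> inside S" for w
  proof
    assume w: "w \<in> inside S"
    then have wS: "w \<notin> S" "bounded (connected_component_set (- S) w)" by (auto simp: inside_def)
    define R where "R = (\<lambda>t. w - complex_of_real t) ` {0..}"
    have "connected R" unfolding R_def
      by (intro connected_continuous_image continuous_intros) simp
    moreover have "R \<subseteq> - S" using S(3) wS(1) by (force simp: R_def)
    moreover have "w \<in> R" by (auto simp: R_def intro!: image_eqI[of _ _ 0])
    ultimately have "R \<subseteq> connected_component_set (- S) w" by (intro connected_component_maximal)
    then have "bounded R" using wS(2) bounded_subset by blast
    then obtain B where B: "\<And>x. x \<in> R \<Longrightarrow> norm x \<le> B" by (auto simp: bounded_iff)
    have "w - complex_of_real (\<bar>B\<bar> + norm w + 1) \<in> R" unfolding R_def by (intro imageI) simp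
    from B[OF this] have "norm (w - complex_of_real (\<bar>B\<bar> + norm w + 1)) \<le> B" .
    moreover have "norm (complex_of_real (\<bar>B\<bar> + norm w + 1)) - norm w \<le> norm (w - complex_of_real (\<bar>B\<bar> + norm w + 1))"
      by (metis norm_minus_commute norm_triangle_ineq2)
    moreover have "norm (complex_of_real (\<bar>B\<bar> + norm w + 1)) = \<bar>B\<bar> + norm w + 1"
      using norm_of_real by (simp add: abs_of_nonneg del: of_real_add)
    ultimately show False by linarith
  qed
  then show ?thesis using simply_connected_eq_empty_inside[OF S(1)] S(2) by blast
qed

context koenigs_map begin

text \<open>
  The condition at the single point \<open>h z + 1\<close> forces the section to intertwine the translation by
  \<open>1\<close> with \<open>f\<close> on the whole stadium, by uniqueness of sections.
\<close>

definition ray_section :: "complex \<Rightarrow> real \<Rightarrow> (complex \<Rightarrow> complex) \<Rightarrow> bool"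
  where "ray_section z r s \<longleftrightarrow>
    z \<in> unit_disc \<and> 0 < r \<and> koenigs_section (stadium (h z) r) 0 s \<and> s (h z) = z \<and> s (h z + 1) = f z"

definition flow_domain :: "complex set"
  where "flow_domain = {z. \<exists>r s. ray_section z r s}"

lemma flow_domain_subset: "flow_domain \<subseteq> unit_disc"
  unfolding flow_domain_def ray_section_def by blast

lemma ray_sectionD:
  assumes "ray_section z r s"
  shows "z \<in> unit_disc" "0 < r" "koenigs_section (stadium (h z) r) 0 s" "s (h z) = z" "s (h z + 1) = f z"
  using assms by (simp_all add: ray_section_def)

lemma ray_section_step:
  assumes s: "ray_section z r s" and w: "w \<in> stadium (h z) r"
  shows "s (w + 1) = f (s w)"
proof (rule koenigs_section_unique[OF open_stadium convex_connected[OF convex_stadium] _ _ _ _ w])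
  show "koenigs_section (stadium (h z) r) (0 + 1) (\<lambda>w. s (w + 1))"
    by (rule koenigs_section_shift[OF ray_sectionD(3)[OF s]]) (use stadium_add[of _ _ _ 1] in auto)
  show "koenigs_section (stadium (h z) r) (0 + 1) (\<lambda>w. f (s w))"
    using koenigs_section_iterate[OF ray_sectionD(3)[OF s], of 1] by simp
  show "h z \<in> stadium (h z) r" using centre_in_stadium ray_sectionD(2)[OF s] .
  show "s (h z + 1) = f (s (h z))" using ray_sectionD[OF s] by simp
qed

lemma ray_section_iterate:
  assumes s: "ray_section z r s" and w: "w \<in> stadium (h z) r"
  shows "s (w + of_nat n) = (f ^^ n) (s w)"
proof (induction n)
  case (Suc n)
  have "w + of_nat n \<in> stadium (h z) r" using stadium_add[OF w, of "of_nat n"] by simp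
  from ray_section_step[OF s this] Suc have "s (w + of_nat n + 1) = f ((f ^^ n) (s w))" by simp
  moreover have "w + of_nat (Suc n) = w + of_nat n + 1" by simp
  ultimately show ?case by (simp only: funpow.simps comp_apply)
qed simp

lemma ray_section_in_flow_domain:
  assumes s: "ray_section z r s" and w: "w \<in> stadium (h z) r"
  shows "s w \<in> flow_domain" "h (s w) = w"
proof -
  note D = ray_sectionD[OF s]
  show h: "h (s w) = w" using koenigs_sectionD(3)[OF D(3) w] by simp
  obtain r' where r': "0 < r'" "stadium w r' \<subseteq> stadium (h z) r" using stadium_contains_stadium[OF w] .
  have "ray_section (s w) r' s"
    unfolding ray_section_def h
    using koenigs_section_subset[OF D(3) r'(2)] r'(1) koenigs_sectionD(2)[OF D(3) w] ray_section_step[OF s w] by simp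
  then show "s w \<in> flow_domain" by (auto simp: flow_domain_def)
qed

lemma open_flow_domain: "open flow_domain"
proof (rule openI)
  fix z assume "z \<in> flow_domain"
  then obtain r s where s: "ray_section z r s" by (auto simp: flow_domain_def)
  note D = ray_sectionD[OF s]
  have "open (s ` stadium (h z) r)" using koenigs_section_open_image[OF D(3) open_stadium] .
  moreover have "z \<in> s ` stadium (h z) r" using D centre_in_stadium by (metis image_eqI)
  moreover have "s ` stadium (h z) r \<subseteq> flow_domain" using ray_section_in_flow_domain[OF s] by blast
  ultimately show "\<exists>e>0. ball z e \<subseteq> flow_domain" by (metis (no_types, lifting) openE subset_trans)
qed

text \<open>
  If \<open>h a = h b\<close>, the orbits of \<open>a\<close> and \<open>b\<close> merge, so the two sections agree at \<open>h a + n\<close> for some \<open>n\<close>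
  and therefore at \<open>h a\<close>.
\<close>

lemma inj_on_flow_domain: "inj_on h flow_domain"
proof (rule inj_onI)
  fix a b assume "a \<in> flow_domain" "b \<in> flow_domain" and eq: "h a = h b"
  then obtain r s r' s' where s: "ray_section a r s" and s': "ray_section b r' s'" by (auto simp: flow_domain_def)
  note D = ray_sectionD[OF s] and D' = ray_sectionD[OF s']
  let ?S = "stadium (h a) (min r r')"
  have S: "?S \<subseteq> stadium (h a) r" "?S \<subseteq> stadium (h b) r'" using stadium_mono eq by auto
  obtain n where n: "(f ^^ n) a = (f ^^ n) b" using h_eq_imp_orbits_merge[OF D(1) D'(1) eq] by blast
  have aS: "h a \<in> ?S" using centre_in_stadium D(2) D'(2) by simp
  have "s (h a) = s' (h a)"
  proof (rule koenigs_section_unique[OF open_stadium convex_connected[OF convex_stadium] _ _ _ _ aS])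
    show "koenigs_section ?S 0 s" "koenigs_section ?S 0 s'"
      using koenigs_section_subset D(3) D'(3) S by blast+
    show "h a + of_nat n \<in> ?S" using stadium_add[OF aS, of "of_nat n"] by simp
    show "s (h a + of_nat n) = s' (h a + of_nat n)"
    proof -
      have "s (h a + of_nat n) = (f ^^ n) (s (h a))" using ray_section_iterate[OF s] aS S(1) by blast
      also have "\<dots> = (f ^^ n) (s' (h a))" using n D(4) D'(4) eq by simp
      also have "\<dots> = s' (h a + of_nat n)" using ray_section_iterate[OF s', of "h a" n] aS S(2) by auto
      finally show ?thesis .
    qed
  qed
  then have "a = s' (h a)" unfolding D(4) .
  also have "\<dots> = b" unfolding eq by (rule D'(4))
  finally show "a = b" .
qed

text \<open>
  Extension of a section \<open>u\<close> from a neighbourhood of the segment from \<open>h z\<close> to \<open>h z + 2\<close> to a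
  neighbourhood of the ray. On the translate by \<open>n\<close> of a neighbourhood \<open>C\<close> of the segment from \<open>h z\<close>
  to \<open>h z + 1\<close> the extension is the \<open>n\<close>-th iterate of \<open>f\<close> applied to \<open>u (w - n)\<close>. These pieces fit
  because \<open>u (w + 1) = f (u w)\<close> on \<open>C\<close>, which is why \<open>u\<close> is needed on a segment of length \<open>2\<close>.
\<close>

lemma section_imp_flow_domain:
  assumes z: "z \<in> unit_disc" and S: "open S" "koenigs_section S 0 u"
    and seg: "\<And>t. 0 \<le> t \<Longrightarrow> t \<le> 2 \<Longrightarrow> h z + of_real t \<in> S"
    and u: "u (h z) = z" "u (h z + 1) = f z"
  shows "z \<in> flow_domain"
proof -
  define p where "p = h z"
  define J where "J = (\<lambda>t::real. p + of_real t) ` {0..2}"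
  have J: "compact J" unfolding J_def by (intro compact_continuous_image continuous_intros) simp
  have JS: "J \<subseteq> S" using seg by (auto simp: J_def p_def)
  obtain \<epsilon> where \<epsilon>: "\<epsilon> > 0" "(\<Union>x\<in>J. cball x \<epsilon>) \<subseteq> S"
    using compact_subset_open_imp_cball_epsilon_subset[OF J S(1) JS] by blast
  define r where "r = min \<epsilon> (1/2)"
  have r: "0 < r" "r \<le> 1/2" "r \<le> \<epsilon>" using \<epsilon>(1) by (auto simp: r_def)
  define C where "C = {w. \<exists>t. 0 \<le> t \<and> t \<le> 1 \<and> norm (w - (p + of_real t)) < r}"
  have CS: "w \<in> S" "w + 1 \<in> S" if w: "w \<in> C" for w
  proof -
    obtain t where t: "0 \<le> t" "t \<le> 1" "norm (w - (p + of_real t)) < r" using w by (auto simp: C_def)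
    have "w \<in> cball (p + of_real t) \<epsilon>" using t r by (simp add: dist_norm norm_minus_commute)
    moreover have "p + of_real t \<in> J" using t by (auto simp: J_def)
    ultimately show "w \<in> S" using \<epsilon>(2) by blast
    have "w + 1 \<in> cball (p + of_real (t + 1)) \<epsilon>" using t r by (simp add: dist_norm norm_minus_commute algebra_simps)
    moreover have "p + of_real (t + 1) \<in> J" unfolding J_def using t by (intro imageI) auto
    ultimately show "w + 1 \<in> S" using \<epsilon>(2) by blast
  qed
  have Copen: "open C"
  proof -
    have "C = (\<Union>t\<in>{0..1}. ball (p + of_real t) r)" by (auto simp: C_def dist_norm norm_minus_commute)
    then show ?thesis by auto
  qed
  have Cconv: "convex C"
  proof (rule convexI)
    fix x y :: complex and a b :: real
    assume xy: "x \<in> C" "y \<in> C" and ab: "0 \<le> a" "0 \<le> b" "a + b = 1"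
    obtain s t where s: "s \<ge> 0" "s \<le> 1" "norm (x - (p + of_real s)) < r" and t: "t \<ge> 0" "t \<le> 1" "norm (y - (p + of_real t)) < r"
      using xy unfolding C_def by blast
    have "x - (p + of_real s) \<in> ball 0 r" "y - (p + of_real t) \<in> ball 0 r" using s t by auto
    then have "a *\<^sub>R (x - (p + of_real s)) + b *\<^sub>R (y - (p + of_real t)) \<in> ball 0 r"
      using ab by (intro convexD[OF convex_ball])
    moreover have "a *\<^sub>R (x - (p + of_real s)) + b *\<^sub>R (y - (p + of_real t))
        = a *\<^sub>R x + b *\<^sub>R y - ((a + b) *\<^sub>R p + of_real (a * s + b * t))"
      by (simp add: algebra_simps scaleR_conv_of_real)
    moreover have "a * s + b * t \<le> 1" using ab s t by (metis convex_bound_le)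
    ultimately show "a *\<^sub>R x + b *\<^sub>R y \<in> C"
      unfolding C_def using ab s t by (intro CollectI exI[of _ "a * s + b * t"]) auto
  qed
  have pC: "p \<in> C" unfolding C_def using r(1) by (intro CollectI exI[of _ 0]) simp
  have pC1: "p + 1 \<in> C" unfolding C_def using r(1) by (intro CollectI exI[of _ 1]) simp
  have step: "u (w + 1) = f (u w)" if "w \<in> C" for w
  proof (rule koenigs_section_unique[OF Copen convex_connected[OF Cconv] _ _ _ _ that])
    show "koenigs_section C (0 + 1) (\<lambda>w. u (w + 1))"
      by (rule koenigs_section_shift[OF S(2)]) (use CS in auto)
    show "koenigs_section C (0 + 1) (\<lambda>w. f (u w))"
      using koenigs_section_iterate[OF koenigs_section_subset[OF S(2)], of C 1] CS by auto
    show "p \<in> C" by (rule pC)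
    show "u (p + 1) = f (u p)" using u by (simp add: p_def)
  qed
  define k where "k = (\<lambda>w. nat \<lfloor>Re (w - p)\<rfloor>)"
  define s where "s = (\<lambda>w. (f ^^ k w) (u (w - of_nat (k w))))"
  have kC: "w - of_nat (k w) \<in> C" if w: "w \<in> stadium p r" for w
  proof -
    obtain t where t: "t \<ge> 0" "norm (w - (p + of_real t)) < r" using w unfolding mem_stadium by blast
    show ?thesis
    proof (cases "Re (w - p) < 0")
      case True
      then have "k w = 0" by (simp add: k_def)
      moreover have "norm (w - p) \<le> norm (w - (p + of_real t))"
        using True t(1) unfolding cmod_def by (intro real_sqrt_le_mono add_mono) (auto simp: abs_le_square_iff[symmetric])
      ultimately show ?thesis unfolding C_def using t by (intro CollectI exI[of _ 0]) auto
    next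
      case False
      define x where "x = Re (w - p) - of_nat (k w)"
      have x: "0 \<le> x" "x \<le> 1" using False by (auto simp: x_def k_def) linarith+
      have "w - of_nat (k w) - (p + of_real x) = \<i> * Im (w - (p + of_real t))"
        by (simp add: x_def complex_eq_iff)
      then have "norm (w - of_nat (k w) - (p + of_real x)) = \<bar>Im (w - (p + of_real t))\<bar>"
        by (simp only: norm_mult norm_ii norm_of_real mult_1)
      then have "norm (w - of_nat (k w) - (p + of_real x)) < r"
        using abs_Im_le_cmod[of "w - (p + of_real t)"] t(2) by linarith
      then show ?thesis unfolding C_def using x by blast
    qed
  qed
  have sn: "s w = (f ^^ n) (u (w - of_nat n))" if w: "w \<in> stadium p r" "w - of_nat n \<in> C" for w n
  proof -
    obtain t where t: "0 \<le> t" "t \<le> 1" "norm (w - of_nat n - (p + of_real t)) < r" using w(2) by (auto simp: C_def)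
    have "\<bar>Re (w - of_nat n - (p + of_real t))\<bar> < r" using abs_Re_le_cmod t(3) by (meson le_less_trans)
    then have *: "-1/2 < Re (w - p) - of_nat n" "Re (w - p) - of_nat n < 3/2"
      using t r by (auto simp: abs_less_iff)
    then consider "n = k w" | "n = k w + 1" | "k w = n + 1"
      unfolding k_def by linarith
    then show ?thesis
    proof cases
      case 2
      have "(f ^^ n) (u (w - of_nat n)) = (f ^^ k w) (f (u (w - of_nat n)))"
        by (simp add: 2 funpow_swap1)
      also have "f (u (w - of_nat n)) = u (w - of_nat n + 1)" using step[OF w(2)] by simp
      also have "w - of_nat n + 1 = w - of_nat (k w)" by (simp add: 2)
      finally show ?thesis by (simp add: s_def)
    next
      case 3
      have "s w = (f ^^ n) (f (u (w - of_nat (k w))))" by (simp add: s_def 3 funpow_swap1)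
      also have "f (u (w - of_nat (k w))) = u (w - of_nat (k w) + 1)" using step[OF kC[OF w(1)]] by simp
      also have "w - of_nat (k w) + 1 = w - of_nat n" by (simp add: 3)
      finally show ?thesis .
    qed (simp add: s_def)
  qed
  have uC: "koenigs_section C 0 u" using koenigs_section_subset[OF S(2)] CS by blast
  define Cn where "Cn = (\<lambda>n::nat. stadium p r \<inter> (\<lambda>w. w - of_nat n) -` C)"
  have Cn: "open (Cn n)" for n
    unfolding Cn_def by (intro continuous_open_preimage open_stadium Copen continuous_intros)
  have stC: "stadium p r = (\<Union>n\<in>UNIV. Cn n)" using kC by (auto simp: Cn_def)
  have "ray_section z r s"
    unfolding ray_section_def koenigs_section_def p_def[symmetric]
  proof (intro conjI z r ballI)
    show "s holomorphic_on stadium p r"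
      unfolding stC
    proof (rule holomorphic_on_UN_open[OF _ Cn])
      fix n
      have "koenigs_section (Cn n) (0 + - of_nat n) (\<lambda>w. u (w + - of_nat n))"
        by (rule koenigs_section_shift[OF uC]) (auto simp: Cn_def)
      then have "koenigs_section (Cn n) (0 + - of_nat n + of_nat n) (\<lambda>w. (f ^^ n) (u (w + - of_nat n)))"
        by (rule koenigs_section_iterate)
      then show "s holomorphic_on Cn n"
        by (rule holomorphic_transform[OF koenigs_sectionD(1)]) (auto simp: Cn_def sn)
    qed
    show "s ` stadium p r \<subseteq> unit_disc"
      using koenigs_sectionD(2)[OF uC kC] funpow_in_disc unfolding s_def by blast
    show "h (s w) = w + 0" if "w \<in> stadium p r" for w
      using koenigs_sectionD(2,3)[OF uC kC[OF that]] h_funpow unfolding s_def by simp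
    have ps: "p \<in> stadium p r" by (rule centre_in_stadium[OF r(1)])
    then show "s p = z" using sn[of p 0] pC u by (simp add: p_def)
    have "p + 1 \<in> stadium p r" using stadium_add[OF ps, of 1] by simp
    then show "s (p + 1) = f z" using sn[of "p + 1" 0] pC1 u by (simp add: p_def)
  qed
  then show ?thesis by (auto simp: flow_domain_def)
qed

text \<open>
  A section over the segment from \<open>h z\<close> to \<open>h z + 2\<close> need not pass through the orbit of \<open>z\<close>, but its
  values at \<open>h z\<close> and \<open>h z + 1\<close> have orbits that merge with that of \<open>z\<close>. After enough iterations of
  \<open>f\<close> it satisfies the hypotheses of \<open>section_imp_flow_domain\<close>.
\<close>

lemma eventually_in_flow_domain:
  assumes z: "z \<in> unit_disc" shows "\<exists>n. (f ^^ n) z \<in> flow_domain"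
proof -
  define w where "w = h z"
  define K where "K = (\<lambda>t::real. w + of_real t) ` {0..2}"
  have K: "compact K" unfolding K_def by (intro compact_continuous_image continuous_intros) simp
  have "K \<subseteq> backward_union \<Omega>"
    using backward_union_shift[OF h_in_backward_union[OF z]] by (auto simp: K_def w_def)
  then obtain S n u where S: "open S" "K \<subseteq> S" "koenigs_section S (of_nat n) u"
    using section_over_compact[OF K] by blast
  have "w + of_real 0 \<in> K" "w + of_real 1 \<in> K" unfolding K_def by (intro imageI; simp)+
  then have wK: "w \<in> S" "w + 1 \<in> S" using S(2) by auto
  note fz = f_in_disc[OF z] 
  have "\<forall>\<^sub>F m in sequentially. (f ^^ m) (u w) = (f ^^ m) ((f ^^ n) z)"
    using koenigs_sectionD[OF S(3)] wK funpow_in_disc[OF z] h_funpow[OF z]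
    by (intro eventually_orbits_merge) (auto simp: w_def)
  moreover have "\<forall>\<^sub>F m in sequentially. (f ^^ m) (u (w + 1)) = (f ^^ m) ((f ^^ n) (f z))"
    using koenigs_sectionD[OF S(3)] wK funpow_in_disc[OF fz] h_funpow[OF fz] h_f[OF z]
    by (intro eventually_orbits_merge) (auto simp: w_def)
  ultimately have "\<forall>\<^sub>F m in sequentially. (f ^^ m) (u w) = (f ^^ m) ((f ^^ n) z) \<and>
      (f ^^ m) (u (w + 1)) = (f ^^ m) ((f ^^ n) (f z))" by (rule eventually_conj)
  then obtain m where m: "(f ^^ m) (u w) = (f ^^ m) ((f ^^ n) z)" "(f ^^ m) (u (w + 1)) = (f ^^ m) ((f ^^ n) (f z))"
    unfolding eventually_sequentially by blast
  define c :: complex where "c = of_nat (n + m)"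
  define T where "T = (\<lambda>v. v + - c) -` S"
  define x where "x = (f ^^ (m + n)) z"
  have x: "x \<in> unit_disc" "h x = w + c" using funpow_in_disc[OF z] h_funpow[OF z] by (auto simp: x_def w_def c_def)
  have T: "open T" unfolding T_def by (intro open_vimage S(1) continuous_intros)
  have "koenigs_section T (of_nat n + of_nat m + - c) (\<lambda>v. (f ^^ m) (u (v + - c)))"
    by (rule koenigs_section_shift[OF koenigs_section_iterate[OF S(3)]]) (auto simp: T_def)
  then have sec: "koenigs_section T 0 (\<lambda>v. (f ^^ m) (u (v + - c)))" by (simp add: c_def)
  have "x \<in> flow_domain"
  proof (rule section_imp_flow_domain[OF x(1) T sec])
    show "h x + of_real t \<in> T" if "0 \<le> t" "t \<le> 2" for t
      using that S(2) by (auto simp: T_def x(2) K_def)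
    have "(f ^^ m) (u (h x + - c)) = (f ^^ m) (u w)" by (simp add: x(2))
    also have "\<dots> = x" unfolding m(1) x_def funpow_add by simp
    finally show "(f ^^ m) (u (h x + - c)) = x" .
    have "(f ^^ m) (u (h x + 1 + - c)) = (f ^^ m) (u (w + 1))" by (simp add: x(2))
    also have "\<dots> = f x" unfolding m(2) x_def funpow_add comp_apply by (simp add: funpow_swap1)
    finally show "(f ^^ m) (u (h x + 1 + - c)) = f x" .
  qed
  then show ?thesis by (auto simp: x_def)
qed

end

context koenigs_map begin

lemma f_in_flow_domain: assumes "z \<in> flow_domain" shows "f z \<in> flow_domain"
proof -
  obtain r s where s: "ray_section z r s" using assms by (auto simp: flow_domain_def)
  have "h z + 1 \<in> stadium (h z) r"
    using stadium_add[OF centre_in_stadium[OF ray_sectionD(2)[OF s]], of 1] by simp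
  then show ?thesis using ray_section_in_flow_domain(1)[OF s] ray_sectionD(5)[OF s] by metis
qed

lemma funpow_in_flow_domain:
  assumes "(f ^^ m) z \<in> flow_domain" "m \<le> n" shows "(f ^^ n) z \<in> flow_domain"
proof -
  obtain d where d: "n = d + m" using assms(2) by (metis add.commute le_Suc_ex)
  have "(f ^^ d) ((f ^^ m) z) \<in> flow_domain"
    by (induction d) (use assms(1) f_in_flow_domain in auto)
  then show ?thesis unfolding d funpow_add by simp
qed

lemma compact_eventually_in_flow_domain:
  assumes K: "compact K" "K \<subseteq> unit_disc"
  shows "\<exists>N. \<forall>n\<ge>N. (f ^^ n) ` K \<subseteq> flow_domain"
proof -
  define U where "U = (\<lambda>n::nat. unit_disc \<inter> (f ^^ n) -` flow_domain)"
  have "open (U n)" for n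
    unfolding U_def by (intro continuous_open_preimage holomorphic_on_imp_continuous_on funpow_holomorphic open_flow_domain) auto
  moreover have "K \<subseteq> (\<Union>n\<in>UNIV. U n)" using eventually_in_flow_domain K(2) by (auto simp: U_def)
  ultimately obtain C where C: "finite C" "K \<subseteq> (\<Union>n\<in>C. U n)"
    using compactE_image[OF K(1), of UNIV U] by metis
  have "(f ^^ n) ` K \<subseteq> flow_domain" if n: "n \<ge> Max (insert 0 C)" for n
  proof
    fix y assume "y \<in> (f ^^ n) ` K"
    then obtain z m where z: "y = (f ^^ n) z" "m \<in> C" "(f ^^ m) z \<in> flow_domain" using C(2) by (auto simp: U_def)
    have "m \<le> n" using n C(1) z(2) by (meson Max_ge finite.insertI insertI2 le_trans)
    then show "y \<in> flow_domain" using funpow_in_flow_domain z by blast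
  qed
  then show ?thesis by blast
qed

text \<open>
  Each point of the domain is joined to its images under the iterates of \<open>f\<close> along the lifted ray,
  and a segment between two points is moved into the domain by some iterate.
\<close>

lemma connected_flow_domain: "connected flow_domain"
  unfolding connected_iff_connected_component
proof (intro ballI)
  fix a b assume ab: "a \<in> flow_domain" "b \<in> flow_domain"
  have orbit: "connected_component flow_domain z ((f ^^ n) z)" if z: "z \<in> flow_domain" for z n
  proof -
    obtain r s where s: "ray_section z r s" using z by (auto simp: flow_domain_def)
    note D = ray_sectionD[OF s]
    have zs: "h z \<in> stadium (h z) r" by (rule centre_in_stadium[OF D(2)])
    have "connected (s ` stadium (h z) r)"
      using holomorphic_on_imp_continuous_on[OF koenigs_sectionD(1)[OF D(3)]] convex_connected[OF convex_stadium]
      by (rule connected_continuous_image)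
    moreover have "s ` stadium (h z) r \<subseteq> flow_domain" using ray_section_in_flow_domain[OF s] by blast
    moreover have "z \<in> s ` stadium (h z) r" using zs D(4) by (metis image_eqI)
    moreover have "h z + of_nat n \<in> stadium (h z) r" using stadium_add[OF zs, of "of_nat n"] by simp
    then have "(f ^^ n) z \<in> s ` stadium (h z) r" using ray_section_iterate[OF s zs, of n] D(4) by (metis image_eqI)
    ultimately show ?thesis by (auto simp: connected_component_def)
  qed
  have seg: "closed_segment a b \<subseteq> unit_disc"
    using ab flow_domain_subset by (intro closed_segment_subset) auto
  then obtain n where n: "(f ^^ n) ` closed_segment a b \<subseteq> flow_domain"
    using compact_eventually_in_flow_domain[OF compact_segment seg] by blast
  have "connected ((f ^^ n) ` closed_segment a b)"
    using holomorphic_on_imp_continuous_on[OF holomorphic_on_subset[OF funpow_holomorphic seg]]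
    by (rule connected_continuous_image) simp
  then have "connected_component flow_domain ((f ^^ n) a) ((f ^^ n) b)"
    using n by (auto simp: connected_component_def)
  then show "connected_component flow_domain a b"
    using orbit[OF ab(1), of n] orbit[OF ab(2), of n]
    by (meson connected_component_sym connected_component_trans)
qed

lemma flow_domain_nonempty: "flow_domain \<noteq> {}"
  using eventually_in_flow_domain[of 0] by auto

lemma univalent_h_flow_domain: "univalent_on h flow_domain"
  using h_holomorphic flow_domain_subset holomorphic_on_subset inj_on_flow_domain
  by (auto simp: univalent_on_def)

lemma univalent_f_flow_domain: "univalent_on f flow_domain"
proof -
  have "inj_on f flow_domain"
  proof (rule inj_onI)
    fix a b assume ab: "a \<in> flow_domain" "b \<in> flow_domain" "f a = f b"
    then have "h a + 1 = h b + 1" using h_f flow_domain_subset by (metis in_mono)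
    then show "a = b" using inj_on_flow_domain ab by (auto dest: inj_onD)
  qed
  then show ?thesis
    using f_holomorphic flow_domain_subset holomorphic_on_subset by (auto simp: univalent_on_def)
qed

lemma starlike_h_flow_domain: "starlike_at_infinity (h ` flow_domain)"
proof -
  have hh: "h holomorphic_on flow_domain" using univalent_h_flow_domain by (simp add: univalent_on_def)
  have "open (h ` flow_domain)"
    by (rule open_mapping_thm3[OF hh open_flow_domain inj_on_flow_domain])
  moreover have "connected (h ` flow_domain)"
    by (intro connected_continuous_image connected_flow_domain holomorphic_on_imp_continuous_on hh)
  moreover have "h z + of_real t \<in> h ` flow_domain" if z: "z \<in> flow_domain" and t: "0 \<le> t" for z t
  proof -
    obtain r s where s: "ray_section z r s" using z by (auto simp: flow_domain_def)
    have "h z + of_real t \<in> stadium (h z) r"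
      using stadium_add[OF centre_in_stadium[OF ray_sectionD(2)[OF s]] t] .
    then show ?thesis using ray_section_in_flow_domain[OF s] by (metis image_eqI)
  qed
  ultimately show ?thesis
    using flow_domain_nonempty by (auto simp: starlike_at_infinity_def planar_domain_def)
qed

lemma simply_connected_flow_domain: "simply_connected flow_domain"
proof -
  have hh: "h holomorphic_on flow_domain" using univalent_h_flow_domain by (simp add: univalent_on_def)
  obtain g where g: "g holomorphic_on h ` flow_domain" "\<And>z. z \<in> flow_domain \<Longrightarrow> g (h z) = z"
    using holomorphic_has_inverse[OF hh open_flow_domain inj_on_flow_domain] by metis
  have "homeomorphism flow_domain (h ` flow_domain) h g"
    unfolding homeomorphism_def using g hh by (auto simp: holomorphic_on_imp_continuous_on image_image)
  then have "flow_domain homeomorphic h ` flow_domain" by (auto simp: homeomorphic_def)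
  then show ?thesis
    using homeomorphic_simply_connected_eq starlike_at_infinity_simply_connected[OF starlike_h_flow_domain] by blast
qed

lemma fundamental_flow_domain: "fundamental_domain f flow_domain"
  unfolding fundamental_domain_def planar_domain_def
proof (intro conjI simply_connected_flow_domain flow_domain_nonempty open_flow_domain connected_flow_domain
    flow_domain_subset univalent_f_flow_domain)
  show "f ` flow_domain \<subseteq> flow_domain" using f_in_flow_domain by blast
  show "(\<Union>n\<in>{1..}. {z \<in> unit_disc. (f ^^ n) z \<in> flow_domain}) = unit_disc"
  proof
    show "unit_disc \<subseteq> (\<Union>n\<in>{1..}. {z \<in> unit_disc. (f ^^ n) z \<in> flow_domain})"
    proof
      fix z :: complex assume z: "z \<in> unit_disc"
      then obtain n where "(f ^^ n) z \<in> flow_domain" using eventually_in_flow_domain by blast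
      then have "(f ^^ Suc n) z \<in> flow_domain" using f_in_flow_domain by simp
      then show "z \<in> (\<Union>n\<in>{1..}. {z \<in> unit_disc. (f ^^ n) z \<in> flow_domain})"
        using z by (intro UN_I[of "Suc n"]) auto
    qed
  qed auto
qed

lemma backward_translates_flow_domain:
  "(\<Union>t\<in>{0::real..}. (\<lambda>w. w - complex_of_real t) ` (h ` flow_domain)) = backward_union \<Omega>"
proof (intro equalityI subsetI)
  fix w assume "w \<in> (\<Union>t\<in>{0::real..}. (\<lambda>w. w - complex_of_real t) ` (h ` flow_domain))"
  then obtain t z where t: "t \<ge> 0" "z \<in> flow_domain" "w = h z - of_real t" by auto
  define n where "n = nat \<lceil>t\<rceil>"
  have n: "t \<le> real n" unfolding n_def by (simp add: of_nat_ceiling)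
  have "h z - of_nat n \<in> backward_union \<Omega>"
    unfolding backward_union_iff using t(2) flow_domain_subset by (intro exI[of _ n] bexI[of _ z]) auto
  then have "h z - of_nat n + of_real (real n - t) \<in> backward_union \<Omega>"
    using n by (intro backward_union_shift) auto
  then show "w \<in> backward_union \<Omega>" using t(3) by simp
next
  fix w assume "w \<in> backward_union \<Omega>"
  then obtain n z where z: "z \<in> unit_disc" "h z = w + of_nat n" unfolding backward_union_iff by blast
  obtain m where m: "(f ^^ m) z \<in> flow_domain" using eventually_in_flow_domain[OF z(1)] by blast
  have "w = h ((f ^^ m) z) - complex_of_real (real (m + n))" using h_funpow[OF z(1), of m] z(2) by simp
  then show "w \<in> (\<Union>t\<in>{0::real..}. (\<lambda>w. w - complex_of_real t) ` (h ` flow_domain))"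
    using m by (intro UN_I[of "real (m + n)"]) auto
qed

end

section \<open>The hyperbolic density\<close>

lemma moebius_has_derivative_0:
  "(Moebius_function 0 (- a) has_field_derivative of_real (1 - (norm a)\<^sup>2)) (at 0)"
proof -
  have "((\<lambda>z. (z + a) / (1 + cnj a * z)) has_field_derivative
      (1 * (1 + cnj a * 0) - (0 + a) * cnj a) / ((1 + cnj a * 0) * (1 + cnj a * 0))) (at 0)"
    by (rule DERIV_divide) (auto intro!: derivative_eq_intros)
  moreover have "(1 * (1 + cnj a * 0) - (0 + a) * cnj a) / ((1 + cnj a * 0) * (1 + cnj a * 0)) = of_real (1 - (norm a)\<^sup>2)"
    using complex_norm_square[of a] by simp
  ultimately have "((\<lambda>z. (z + a) / (1 + cnj a * z)) has_field_derivative of_real (1 - (norm a)\<^sup>2)) (at 0)"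
    by (simp only:)
  moreover have "Moebius_function 0 (- a) = (\<lambda>z. (z + a) / (1 + cnj a * z))"
    by (simp add: fun_eq_iff Moebius_function_simple)
  ultimately show ?thesis by simp
qed

text \<open>
  The Schwarz-Pick lemma at a point for maps into \<open>D\<close>: the inverse of \<open>p\<close> composed with \<open>q\<close> is a
  self-map of the disc. With \<open>q\<close> another Riemann map of \<open>D\<close> it shows that \<open>hyp_density\<close> is well
  defined; with other choices it compares densities.
\<close>

lemma Schwarz_Pick_riemann_map:
  assumes p: "riemann_map p D" and q: "q holomorphic_on unit_disc" "q ` unit_disc \<subseteq> D"
    and z: "z \<in> unit_disc" and y: "y \<in> unit_disc" and eq: "p z = q y"
  shows "norm (deriv q y) * (1 - (norm y)\<^sup>2) \<le> norm (deriv p z) * (1 - (norm z)\<^sup>2)"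
proof -
  have ph: "p holomorphic_on unit_disc" "inj_on p unit_disc" "p ` unit_disc = D"
    using p by (auto simp: riemann_map_def univalent_on_def)
  obtain g where g: "g holomorphic_on D" "\<And>x. x \<in> unit_disc \<Longrightarrow> g (p x) = x"
    using holomorphic_has_inverse[OF ph(1) open_ball ph(2)] ph(3) by metis
  have gD: "g w \<in> unit_disc" "p (g w) = w" if "w \<in> D" for w using that ph(3) g(2) by force+
  have M: "Moebius_function 0 b x \<in> unit_disc" if "b \<in> unit_disc" "x \<in> unit_disc" for b x
    using Moebius_function_norm_lt_1[of b x 0] that by simp
  let ?m = "Moebius_function 0 (- y)"
  let ?F = "\<lambda>x. Moebius_function 0 z (g (q (?m x)))"
  have my: "?m x \<in> unit_disc" if "x \<in> unit_disc" for x using M[of "- y" x] y that by simp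
  have gq: "g (q (?m x)) \<in> unit_disc" if "x \<in> unit_disc" for x using my[OF that] q(2) gD(1) by blast
  have F: "?F holomorphic_on unit_disc"
  proof -
    have 1: "?m holomorphic_on unit_disc" using y by (intro Moebius_function_holomorphic) simp
    have 2: "(\<lambda>x. q (?m x)) holomorphic_on unit_disc"
      by (rule holomorphic_on_compose_gen[OF 1 q(1), unfolded o_def]) (use my in blast)
    have 3: "(\<lambda>x. g (q (?m x))) holomorphic_on unit_disc"
      by (rule holomorphic_on_compose_gen[OF 2 g(1), unfolded o_def]) (use my q(2) in blast)
    show ?thesis
      by (rule holomorphic_on_compose_gen[OF 3 Moebius_function_holomorphic[of z 0], unfolded o_def]) (use gq z in auto)
  qed
  have F0: "?F 0 = 0" using g(2)[OF z] eq by (simp add: Moebius_function_of_zero Moebius_function_eq_zero)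
  have dF: "norm (deriv ?F 0) \<le> 1"
    using Schwarz_Lemma(2)[OF F F0 _, of 0] M[OF z gq] by simp
  have qF: "q (?m x) = p (Moebius_function 0 (- z) (?F x))" if x: "x \<in> unit_disc" for x
  proof -
    have "q (?m x) \<in> D" using my[OF x] q(2) by blast
    then show ?thesis
      using Moebius_function_compose[of "- z" z "g (q (?m x))"] gq[OF x] z gD(2)[of "q (?m x)"] by simp
  qed
  have m0: "?m 0 = y" "Moebius_function 0 (- z) 0 = z" by (simp_all add: Moebius_function_of_zero)
  have "(q has_field_derivative deriv q y) (at (?m 0))" using holomorphic_derivI[OF q(1) open_ball y] m0 by simp
  from DERIV_chain2[OF this moebius_has_derivative_0]
  have d1: "((\<lambda>x. q (?m x)) has_field_derivative deriv q y * of_real (1 - (norm y)\<^sup>2)) (at 0)" .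
  have "(?F has_field_derivative deriv ?F 0) (at 0)" using holomorphic_derivI[OF F open_ball] by simp
  moreover have "(Moebius_function 0 (- z) has_field_derivative of_real (1 - (norm z)\<^sup>2)) (at (?F 0))"
    unfolding F0 by (rule moebius_has_derivative_0)
  ultimately have "((\<lambda>x. Moebius_function 0 (- z) (?F x)) has_field_derivative of_real (1 - (norm z)\<^sup>2) * deriv ?F 0) (at 0)"
    by (rule DERIV_chain2[rotated])
  moreover have "(p has_field_derivative deriv p z) (at (Moebius_function 0 (- z) (?F 0)))"
    using holomorphic_derivI[OF ph(1) open_ball z] F0 m0 by simp
  ultimately have "((\<lambda>x. p (Moebius_function 0 (- z) (?F x))) has_field_derivative
      deriv p z * (of_real (1 - (norm z)\<^sup>2) * deriv ?F 0)) (at 0)"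
    by (rule DERIV_chain2[rotated])
  moreover have "((\<lambda>x. p (Moebius_function 0 (- z) (?F x))) has_field_derivative deriv q y * of_real (1 - (norm y)\<^sup>2)) (at 0)"
    by (rule has_field_derivative_transform_within_open[OF d1, of unit_disc]) (use qF in auto)
  ultimately have "deriv q y * of_real (1 - (norm y)\<^sup>2) = deriv p z * (of_real (1 - (norm z)\<^sup>2) * deriv ?F 0)"
    by (metis DERIV_unique)
  then have "norm (deriv q y) * \<bar>1 - (norm y)\<^sup>2\<bar> = norm (deriv p z) * (\<bar>1 - (norm z)\<^sup>2\<bar> * norm (deriv ?F 0))"
    by (metis norm_mult norm_of_real)
  moreover have "0 < 1 - (norm y)\<^sup>2" "0 < 1 - (norm z)\<^sup>2" using y z one_minus_norm_sq_pos by auto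
  ultimately have "norm (deriv q y) * (1 - (norm y)\<^sup>2) = norm (deriv p z) * (1 - (norm z)\<^sup>2) * norm (deriv ?F 0)"
    by simp
  also have "\<dots> \<le> norm (deriv p z) * (1 - (norm z)\<^sup>2) * 1"
    using dF \<open>0 < 1 - (norm z)\<^sup>2\<close> by (intro mult_left_mono) auto
  finally show ?thesis by simp
qed

lemma riemann_map_deriv_nz: "riemann_map p D \<Longrightarrow> z \<in> unit_disc \<Longrightarrow> deriv p z \<noteq> 0"
  using holomorphic_injective_imp_regular[of p unit_disc z] by (auto simp: riemann_map_def univalent_on_def)

lemma hyp_density_eq:
  assumes p: "riemann_map p D" and z: "z \<in> unit_disc"
  shows "hyp_density D (p z) = 1 / (norm (deriv p z) * (1 - (norm z)\<^sup>2))"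
  unfolding hyp_density_def
proof (rule the_equality)
  have pz: "norm (deriv p z) * (1 - (norm z)\<^sup>2) > 0"
    using riemann_map_deriv_nz[OF p z] one_minus_norm_sq_pos[of z] z by simp
  show "\<forall>q. riemann_map q D \<longrightarrow> (\<forall>y\<in>unit_disc. q y = p z \<longrightarrow>
      1 / (norm (deriv p z) * (1 - (norm z)\<^sup>2)) * norm (deriv q y) = hyp_density_disc y)"
  proof (intro allI impI ballI)
    fix q y assume q: "riemann_map q D" and y: "y \<in> unit_disc" and eq: "q y = p z"
    have "norm (deriv q y) * (1 - (norm y)\<^sup>2) = norm (deriv p z) * (1 - (norm z)\<^sup>2)"
    proof (rule antisym)
      show "norm (deriv q y) * (1 - (norm y)\<^sup>2) \<le> norm (deriv p z) * (1 - (norm z)\<^sup>2)"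
        using Schwarz_Pick_riemann_map[OF p _ _ z y] q eq by (auto simp: riemann_map_def univalent_on_def)
      show "norm (deriv p z) * (1 - (norm z)\<^sup>2) \<le> norm (deriv q y) * (1 - (norm y)\<^sup>2)"
        using Schwarz_Pick_riemann_map[OF q _ _ y z] p eq by (auto simp: riemann_map_def univalent_on_def)
    qed
    moreover have "1 - (norm y)\<^sup>2 > 0" using one_minus_norm_sq_pos y by simp
    ultimately have "norm (deriv q y) = norm (deriv p z) * (1 - (norm z)\<^sup>2) / (1 - (norm y)\<^sup>2)"
      by (simp add: eq_divide_eq)
    then show "1 / (norm (deriv p z) * (1 - (norm z)\<^sup>2)) * norm (deriv q y) = hyp_density_disc y"
      using riemann_map_deriv_nz[OF p z] one_minus_norm_sq_pos[of z] z by (simp add: hyp_density_disc_def)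
  qed
  fix l assume "\<forall>q. riemann_map q D \<longrightarrow> (\<forall>y\<in>unit_disc. q y = p z \<longrightarrow> l * norm (deriv q y) = hyp_density_disc y)"
  then have "l * norm (deriv p z) = hyp_density_disc z" using p z by blast
  then have "l = 1 / (1 - (norm z)\<^sup>2) / norm (deriv p z)"
    using riemann_map_deriv_nz[OF p z] by (simp only: hyp_density_disc_def eq_divide_eq) simp
  then show "l = 1 / (norm (deriv p z) * (1 - (norm z)\<^sup>2))"
    by (simp only: divide_divide_eq_left mult.commute)
qed

text \<open>
  The upper bound comes from the inclusion of \<open>D\<close> in the unit disc, the lower one from the inclusion
  in \<open>D\<close> of the hyperbolic disc about \<open>w\<close> of Euclidean radius \<open>r\<close> after \<open>w\<close> is moved to the origin.
\<close>

lemma hyp_density_ratio_bounds: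
  assumes D: "open D" "simply_connected D" "D \<subseteq> unit_disc" and w: "w \<in> D"
    and r: "0 \<le> r" "r < 1" "Moebius_function 0 (- w) ` ball 0 r \<subseteq> D"
  shows "r \<le> hyp_density_disc w / hyp_density D w" "hyp_density_disc w / hyp_density D w \<le> 1"
proof -
  have "D \<noteq> UNIV" using D(3) by (metis UNIV_I dist_0_norm dual_order.strict_iff_not in_mono mem_ball norm_one)
  then obtain g p where gp: "p holomorphic_on unit_disc" "\<forall>z\<in>D. g z \<in> unit_disc \<and> p (g z) = z"
      "\<forall>z\<in>unit_disc. p z \<in> D \<and> g (p z) = z"
    using Riemann_mapping_theorem[of D] D w by blast
  have p: "riemann_map p D"
    using gp unfolding riemann_map_def univalent_on_def by (force intro: inj_on_inverseI)
  define z where "z = g w"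
  have z: "z \<in> unit_disc" "p z = w" using gp w by (auto simp: z_def)
  have w1: "w \<in> unit_disc" using D(3) w by blast
  define A where "A = norm (deriv p z) * (1 - (norm z)\<^sup>2)"
  have A: "0 < A" unfolding A_def
    using riemann_map_deriv_nz[OF p z(1)] one_minus_norm_sq_pos[of z] z(1) by simp
  have W: "0 < 1 - (norm w)\<^sup>2" using one_minus_norm_sq_pos w1 by simp
  have ratio: "hyp_density_disc w / hyp_density D w = A / (1 - (norm w)\<^sup>2)"
    using hyp_density_eq[OF p z(1)] z(2) by (simp add: hyp_density_disc_def A_def)
  have id: "riemann_map (\<lambda>z. z) unit_disc"
    by (auto simp: riemann_map_def univalent_on_def intro!: holomorphic_intros)
  have "A \<le> norm (deriv (\<lambda>z. z) w) * (1 - (norm w)\<^sup>2)"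
    unfolding A_def using D(3) gp(1,3) z(2)
    by (intro Schwarz_Pick_riemann_map[OF id _ _ w1 z(1)]) auto
  then show "hyp_density_disc w / hyp_density D w \<le> 1" unfolding ratio using W by simp
  let ?q = "\<lambda>x. Moebius_function 0 (- w) (of_real r * x)"
  have rx: "of_real r * x \<in> unit_disc" if "x \<in> unit_disc" for x :: complex
    using that r(1,2) by (auto simp: norm_mult intro: le_less_trans[OF mult_left_le_one_le])
  have "(?q has_field_derivative of_real (1 - (norm w)\<^sup>2) * of_real r) (at 0)"
    using moebius_has_derivative_0[of w] by (intro DERIV_chain2[where g = "\<lambda>x. of_real r * x"]) (auto intro!: derivative_eq_intros)
  then have dq: "norm (deriv ?q 0) = (1 - (norm w)\<^sup>2) * r"
    using W r(1) by (simp add: DERIV_imp_deriv norm_mult del: of_real_diff)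
  have "norm (deriv ?q 0) * (1 - (norm (0::complex))\<^sup>2) \<le> norm (deriv p z) * (1 - (norm z)\<^sup>2)"
  proof (rule Schwarz_Pick_riemann_map[OF p _ _ z(1)])
    show "?q holomorphic_on unit_disc"
      by (rule holomorphic_on_compose_gen[OF _ Moebius_function_holomorphic[of "- w" 0], unfolded o_def])
         (use w1 rx in \<open>auto intro!: holomorphic_intros\<close>)
    show "?q ` unit_disc \<subseteq> D"
    proof (cases "r = 0")
      case True then show ?thesis using w by (auto simp: Moebius_function_of_zero)
    next
      case False
      have "of_real r * x \<in> ball 0 r" if "x \<in> unit_disc" for x :: complex
        using that r(1) False by (simp add: norm_mult)
      then show ?thesis using r(3) by blast
    qed
    show "p z = ?q 0" using z(2) by (simp add: Moebius_function_of_zero)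
  qed simp
  then show "r \<le> hyp_density_disc w / hyp_density D w"
    unfolding ratio dq A_def[symmetric] using W by (simp add: pos_le_divide_eq mult.commute)
qed

section \<open>Non-tangential approach in half-plane coordinates\<close>

text \<open>
  In the coordinate \<open>cayley\<close> the Stolz regions at \<open>\<tau>\<close> become, up to the aperture, cones about the
  positive real axis.
\<close>

definition contains_cone_tails :: "complex \<Rightarrow> complex set \<Rightarrow> bool"
  where "contains_cone_tails \<tau> V \<longleftrightarrow> (\<forall>M. \<exists>T. \<forall>z. norm z < 1 \<and>
    norm (cayley \<tau> z) \<le> M * Re (cayley \<tau> z) \<and> T \<le> norm (cayley \<tau> z) \<longrightarrow> z \<in> V)"

lemma cayley_nontangential:
  assumes \<tau>: "norm \<tau> = 1" and z: "norm z < 1" "norm (\<tau> - z) < R * (1 - norm z)"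
  shows "norm (cayley \<tau> z) \<le> 2 * R * Re (cayley \<tau> z)"
proof -
  have nz: "norm (\<tau> - z) > 0" using \<tau> z(1) by auto
  have R: "R > 0" using nz z by (smt (verit) mult_nonpos_nonneg)
  have "norm (\<tau> + z) * norm (\<tau> - z) \<le> 2 * (R * (1 - norm z))"
    using norm_triangle_ineq[of \<tau> z] \<tau> z by (intro mult_mono) auto
  also have "\<dots> \<le> 2 * (R * (1 - (norm z)\<^sup>2))"
    using R z(1) by (intro mult_left_mono) (auto simp: power2_eq_square mult_left_le)
  finally have "norm (\<tau> + z) * norm (\<tau> - z) / (norm (\<tau> - z))\<^sup>2 \<le> 2 * (R * (1 - (norm z)\<^sup>2)) / (norm (\<tau> - z))\<^sup>2"
    by (rule divide_right_mono) simp
  moreover have "norm (\<tau> + z) * norm (\<tau> - z) / (norm (\<tau> - z))\<^sup>2 = norm (cayley \<tau> z)"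
    using nz by (simp add: cayley_def norm_divide power2_eq_square)
  ultimately show ?thesis by (simp add: Re_cayley[OF \<tau> z(1)])
qed

lemma cayley_tendsto_infinity:
  assumes \<tau>: "norm \<tau> = 1" and z: "\<And>n. norm (z n) < 1" "z \<longlonglongrightarrow> \<tau>"
  shows "\<forall>\<^sub>F n in sequentially. T \<le> norm (cayley \<tau> (z n))"
proof -
  define d where "d = 2 / (\<bar>T\<bar> + 1)"
  have d: "d > 0" by (simp add: d_def add_nonneg_pos)
  have "\<forall>\<^sub>F n in sequentially. dist (z n) \<tau> < d" using z(2) d by (rule tendstoD)
  then show ?thesis
  proof (rule eventually_mono)
    fix n assume "dist (z n) \<tau> < d"
    then have nd: "norm (\<tau> - z n) < d" by (simp add: dist_norm norm_minus_commute)
    have nz: "norm (\<tau> - z n) > 0" using \<tau> z(1)[of n] by auto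
    have "2 * \<tau> = (\<tau> + z n) + (\<tau> - z n)" by simp
    then have "norm (2 * \<tau>) \<le> norm (\<tau> + z n) + norm (\<tau> - z n)" by (metis norm_triangle_ineq)
    then have "2 - norm (\<tau> - z n) \<le> norm (\<tau> + z n)" using \<tau> by (simp add: norm_mult)
    moreover have "(\<bar>T\<bar> + 1) * norm (\<tau> - z n) \<le> (\<bar>T\<bar> + 1) * d" using nd by (intro mult_left_mono) auto
    moreover have "\<bar>T\<bar> + 1 \<noteq> 0" by linarith
    then have "(\<bar>T\<bar> + 1) * d = 2" unfolding d_def by (metis mult.commute nonzero_divide_eq_eq)
    ultimately have "\<bar>T\<bar> * norm (\<tau> - z n) \<le> norm (\<tau> + z n)" by (simp add: algebra_simps)
    then have "\<bar>T\<bar> \<le> norm (cayley \<tau> (z n))" using nz by (simp add: cayley_def norm_divide pos_le_divide_eq)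
    then show "T \<le> norm (cayley \<tau> (z n))" by linarith
  qed
qed

text \<open>
  By Harnack's inequality \<open>Re\<close> changes at most by a fixed factor within bounded hyperbolic distance,
  and the modulus does so in a cone. Hence cones and their tails are stable under such moves.
\<close>

lemma cone_tail_hyperbolic_disc:
  assumes \<tau>: "norm \<tau> = 1" and z: "norm z < 1" and w: "norm w < 1" and D: "disc_cosh2 z w \<le> D"
    and M: "norm (cayley \<tau> z) \<le> M * Re (cayley \<tau> z)"
  shows "norm (cayley \<tau> w) \<le> (M + 4 * D) * (4 * D) * Re (cayley \<tau> w)"
    and "norm (cayley \<tau> z) \<le> M * (4 * D) * norm (cayley \<tau> w)"
proof -
  define x y where "x = cayley \<tau> z" and "y = cayley \<tau> w"
  have pos: "0 < Re x" "0 < Re y" using Re_cayley_pos[OF \<tau>] z w by (auto simp: x_def y_def)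
  have D1: "D \<ge> 1" using disc_cosh2_ge_1[OF z w] D by linarith
  have h: "halfplane_cosh2 x y \<le> D" using cayley_cosh2[OF \<tau> z w] D by (simp add: x_def y_def)
  have "0 < M * Re x" using pos M x_def[symmetric] by (smt (verit) complex_Re_le_cmod)
  then have M0: "M > 0" using pos by (simp add: zero_less_mult_iff)
  have "Re x \<le> 4 * halfplane_cosh2 x y * Re y" by (rule halfplane_cosh2_Re_left_le[OF pos])
  also have "\<dots> \<le> 4 * D * Re y" using h pos by (intro mult_right_mono) auto
  finally have xy: "Re x \<le> 4 * D * Re y" .
  have "norm y \<le> norm x + norm (x - y)" by (metis norm_minus_commute norm_triangle_sub)
  also have "\<dots> \<le> M * Re x + 4 * D * Re x"
    using M norm_diff_le_norm_add_cnj[of x y] halfplane_cosh2_norm_le[OF pos h] pos by (simp add: x_def)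
  also have "\<dots> = (M + 4 * D) * Re x" by (simp add: algebra_simps)
  also have "\<dots> \<le> (M + 4 * D) * (4 * D * Re y)" using xy M0 D1 by (intro mult_left_mono) auto
  finally show "norm (cayley \<tau> w) \<le> (M + 4 * D) * (4 * D) * Re (cayley \<tau> w)" by (simp add: y_def)
  have "norm x \<le> M * Re x" using M by (simp add: x_def)
  also have "\<dots> \<le> M * (4 * D * Re y)" using xy M0 by (intro mult_left_mono) auto
  also have "\<dots> \<le> M * (4 * D * norm y)" using M0 D1 complex_Re_le_cmod[of y] by (intro mult_left_mono) auto
  finally show "norm (cayley \<tau> z) \<le> M * (4 * D) * norm (cayley \<tau> w)" by (simp add: x_def y_def)
qed

text \<open>
  For fixed \<open>r < 1\<close> the hyperbolic discs of radius parameter \<open>r\<close> about the points \<open>z n\<close> lie in the tail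
  of a single wider cone, so that they are eventually contained in \<open>V\<close>. Then the quotient is between
  \<open>r\<close> and \<open>1\<close>.
\<close>

lemma nontangential_density_ratio:
  assumes \<tau>: "norm \<tau> = 1" and V: "open V" "simply_connected V" "V \<subseteq> unit_disc"
    and cone: "contains_cone_tails \<tau> V"
    and z: "range z \<subseteq> unit_disc" "converges_non_tangentially z \<tau>"
  shows "\<forall>\<^sub>F n in sequentially. z n \<in> V"
    and "(\<lambda>n. hyp_density_disc (z n) / hyp_density V (z n)) \<longlonglongrightarrow> 1"
proof -
  have zn: "norm (z n) < 1" for n using z(1) by (auto simp: subset_iff)
  obtain R where R: "z \<longlonglongrightarrow> \<tau>" "\<And>n. norm (\<tau> - z n) < R * (1 - norm (z n))"
    using z(2) by (auto simp: converges_non_tangentially_def)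
  define M where "M = 2 * R"
  have M: "norm (cayley \<tau> (z n)) \<le> M * Re (cayley \<tau> (z n))" for n
    using cayley_nontangential[OF \<tau> zn R(2)] by (simp add: M_def)
  have M0: "M > 0"
  proof -
    have "0 < M * Re (cayley \<tau> (z 0))"
      using M[of 0] Re_cayley_pos[OF \<tau> zn[of 0]] complex_Re_le_cmod[of "cayley \<tau> (z 0)"] by linarith
    then show ?thesis using Re_cayley_pos[OF \<tau> zn[of 0]] by (simp add: zero_less_mult_iff)
  qed
  have discs: "\<forall>\<^sub>F n in sequentially. Moebius_function 0 (- z n) ` ball 0 r \<subseteq> V" if r: "0 \<le> r" "r < 1" for r
  proof -
    define D where "D = 1 / (1 - r\<^sup>2)"
    have r2: "r\<^sup>2 < 1" using r by (simp add: power_less_one_iff abs_square_less_1)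
    have D: "D > 0" using r2 by (simp add: D_def)
    obtain T where T: "\<And>w. norm w < 1 \<Longrightarrow> norm (cayley \<tau> w) \<le> (M + 4 * D) * (4 * D) * Re (cayley \<tau> w) \<Longrightarrow>
        T \<le> norm (cayley \<tau> w) \<Longrightarrow> w \<in> V"
      using cone unfolding contains_cone_tails_def by metis
    have "\<forall>\<^sub>F n in sequentially. M * (4 * D) * T \<le> norm (cayley \<tau> (z n))"
      by (rule cayley_tendsto_infinity[OF \<tau> zn R(1)])
    then show ?thesis
    proof (rule eventually_mono, intro subsetI)
      fix n w assume n: "M * (4 * D) * T \<le> norm (cayley \<tau> (z n))"
        and "w \<in> Moebius_function 0 (- z n) ` ball 0 r"
      then have w: "norm w < 1" "disc_cosh2 (z n) w \<le> D"
        using hyperbolic_disc_eq_moebius_image[OF zn r, of n] by (auto simp: D_def)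
      note c = cone_tail_hyperbolic_disc[OF \<tau> zn w M]
      have "M * (4 * D) * T \<le> M * (4 * D) * norm (cayley \<tau> w)" using n c(2) by linarith
      then have "T \<le> norm (cayley \<tau> w)" using M0 D by simp
      then show "w \<in> V" using T[OF w(1) c(1)] by blast
    qed
  qed
  have inV: "z n \<in> V" if "Moebius_function 0 (- z n) ` ball 0 r \<subseteq> V" "0 < r" for n r
  proof -
    have "Moebius_function 0 (- z n) 0 \<in> V" using that by auto
    then show ?thesis by (simp add: Moebius_function_of_zero)
  qed
  show "\<forall>\<^sub>F n in sequentially. z n \<in> V"
    using discs[of "1/2"] by (rule eventually_mono) (use inV[of _ "1/2"] in auto)
  show "(\<lambda>n. hyp_density_disc (z n) / hyp_density V (z n)) \<longlonglongrightarrow> 1"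
  proof (rule tendstoI)
    fix e :: real assume e: "e > 0"
    define r where "r = max (1/2) (1 - e / 2)"
    have r: "0 < r" "0 \<le> r" "r < 1" "1 - e < r" using e by (auto simp: r_def)
    show "\<forall>\<^sub>F n in sequentially. dist (hyp_density_disc (z n) / hyp_density V (z n)) 1 < e"
      using discs[OF r(2,3)]
    proof (rule eventually_mono)
      fix n assume n: "Moebius_function 0 (- z n) ` ball 0 r \<subseteq> V"
      have "r \<le> hyp_density_disc (z n) / hyp_density V (z n)" "hyp_density_disc (z n) / hyp_density V (z n) \<le> 1"
        using hyp_density_ratio_bounds[OF V inV[OF n r(1)] r(2,3) n] by auto
      then show "dist (hyp_density_disc (z n) / hyp_density V (z n)) 1 < e"
        using r(4) by (simp add: dist_real_def)
    qed
  qed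
qed

context koenigs_map begin

lemma f_norm: "norm z < 1 \<Longrightarrow> norm (f z) < 1"
  using f_in_disc[of z] by simp

lemma funpow_norm: "norm z < 1 \<Longrightarrow> norm ((f ^^ n) z) < 1"
  using funpow_in_disc[of z n] by simp

text \<open>
  The orbit of \<open>0\<close> tends to the unit circle, so infinitely often its modulus does not decrease in one
  step. Along these indices the Schwarz-Pick inequality between a point of the orbit and \<open>z\<close> passes
  to the limit and says that \<open>f\<close> maps horodiscs at \<open>\<tau>\<close> into themselves.
\<close>

lemma Wolff_halfplane:
  assumes dw: "denjoy_wolff_point f \<tau>" and z: "norm z < 1"
  shows "Re (cayley \<tau> z) \<le> Re (cayley \<tau> (f z))"
proof -
  have \<tau>: "norm \<tau> = 1" using dw by (simp add: denjoy_wolff_point_def)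
  define p where "p = (\<lambda>n. (f ^^ n) 0)"
  have p: "p \<longlonglongrightarrow> \<tau>" using dw by (simp add: denjoy_wolff_point_def p_def)
  have pn: "norm (p n) < 1" for n using funpow_norm[of 0] by (simp add: p_def)
  have freq: "\<exists>\<^sub>F n in sequentially. norm (p n) \<le> norm (p (Suc n))"
  proof (rule ccontr)
    assume "\<not> (\<exists>\<^sub>F n in sequentially. norm (p n) \<le> norm (p (Suc n)))"
    then have "\<forall>\<^sub>F n in sequentially. norm (p (Suc n)) < norm (p n)" by (simp add: frequently_def not_le)
    then obtain N where N: "\<And>n. n \<ge> N \<Longrightarrow> norm (p (Suc n)) < norm (p n)" by (auto simp: eventually_sequentially)
    have "norm (p n) \<le> norm (p N)" if "n \<ge> N" for n
      using that by (induction n rule: dec_induct) (use N in \<open>auto intro: less_imp_le order_trans\<close>)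
    then have "norm \<tau> \<le> norm (p N)"
      using tendsto_norm[OF p] by (intro tendsto_upperbound) (auto intro: eventually_sequentiallyI)
    then show False using \<tau> pn[of N] by simp
  qed
  define A where "A = (\<lambda>n. (norm (1 - cnj (p (Suc n)) * f z))\<^sup>2 / (1 - (norm (f z))\<^sup>2))"
  define B where "B = (\<lambda>n. (norm (1 - cnj (p n) * z))\<^sup>2 / (1 - (norm z)\<^sup>2))"
  have pos: "0 < 1 - (norm z)\<^sup>2" "0 < 1 - (norm (f z))\<^sup>2" "0 < 1 - (norm (p n))\<^sup>2" for n
    using one_minus_norm_sq_pos z f_norm[OF z] pn by auto
  have AB: "A n \<le> B n" if le: "norm (p n) \<le> norm (p (Suc n))" for n
  proof -
    have "disc_cosh2 (p (Suc n)) (f z) \<le> disc_cosh2 (p n) z"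
      using Schwarz_Pick_disc[OF f_holomorphic f_norm, of "p n" z] pn z by (simp add: p_def)
    then have "A n / (1 - (norm (p (Suc n)))\<^sup>2) \<le> B n / (1 - (norm (p n))\<^sup>2)"
      by (simp add: disc_cosh2_def A_def B_def mult.commute)
    also have "\<dots> \<le> B n / (1 - (norm (p (Suc n)))\<^sup>2)"
      using pos(1,2) pos(3)[of n] pos(3)[of "Suc n"] le by (intro divide_left_mono) (auto simp: B_def power_mono)
    finally show ?thesis using pos(3)[of "Suc n"] by (simp add: divide_le_cancel)
  qed
  have \<tau>n: "norm (1 - cnj \<tau> * x) = norm (\<tau> - x)" for x
  proof -
    have "\<tau> - x = \<tau> * (1 - cnj \<tau> * x)" using \<tau> complex_norm_square[of \<tau>] by (simp add: algebra_simps)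
    then show ?thesis using \<tau> by (simp add: norm_mult)
  qed
  have "A \<longlonglongrightarrow> (norm (1 - cnj \<tau> * f z))\<^sup>2 / (1 - (norm (f z))\<^sup>2)"
    unfolding A_def using pos LIMSEQ_Suc[OF p] by (intro tendsto_intros) auto
  moreover have "B \<longlonglongrightarrow> (norm (1 - cnj \<tau> * z))\<^sup>2 / (1 - (norm z)\<^sup>2)"
    unfolding B_def using pos p by (intro tendsto_intros) auto
  ultimately have lim: "(\<lambda>n. B n - A n) \<longlonglongrightarrow> (norm (\<tau> - z))\<^sup>2 / (1 - (norm z)\<^sup>2) - (norm (\<tau> - f z))\<^sup>2 / (1 - (norm (f z))\<^sup>2)"
    unfolding \<tau>n by (intro tendsto_diff)
  have "0 \<le> (norm (\<tau> - z))\<^sup>2 / (1 - (norm z)\<^sup>2) - (norm (\<tau> - f z))\<^sup>2 / (1 - (norm (f z))\<^sup>2)"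
  proof (rule ccontr)
    assume "\<not> ?thesis"
    then have "\<forall>\<^sub>F n in sequentially. B n - A n < 0" using order_tendstoD(2)[OF lim, of 0] by simp
    moreover have "\<exists>\<^sub>F n in sequentially. \<not> (B n - A n < 0)"
      by (rule frequently_elim1[OF freq]) (simp add: AB not_less)
    ultimately show False by (simp add: frequently_def)
  qed
  then have le: "(norm (\<tau> - f z))\<^sup>2 / (1 - (norm (f z))\<^sup>2) \<le> (norm (\<tau> - z))\<^sup>2 / (1 - (norm z)\<^sup>2)" by simp
  have nz: "\<tau> \<noteq> z" "\<tau> \<noteq> f z" using \<tau> z f_norm[OF z] by auto
  have "inverse ((norm (\<tau> - z))\<^sup>2 / (1 - (norm z)\<^sup>2)) \<le> inverse ((norm (\<tau> - f z))\<^sup>2 / (1 - (norm (f z))\<^sup>2))"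
    using le pos nz by (intro le_imp_inverse_le divide_pos_pos) auto
  then show ?thesis by (simp add: Re_cayley[OF \<tau> z] Re_cayley[OF \<tau> f_norm[OF z]])
qed

section \<open>Parabolic maps of zero hyperbolic step\<close>

lemma orbit_step_decreasing:
  assumes "norm z < 1"
  shows "disc_cosh2 ((f ^^ n) z) ((f ^^ Suc n) z) \<le> disc_cosh2 z (f z)"
  using Schwarz_Pick_disc[OF funpow_holomorphic funpow_norm, of z "f z" n] f_norm assms
  by (simp add: funpow_swap1)

text \<open>
  Here \<open>g z\<close> is \<open>f\<close> in a coordinate centred at \<open>z\<close>, a map without fixed points. If the step of \<open>z\<close> is
  small, so are the steps along its orbit, and \<open>f\<close> is injective on the discs \<open>B\<close> about all points of
  the orbit. As \<open>f\<close> maps these discs into each other, all iterates are injective on \<open>B z\<close>, and so is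
  \<open>h\<close>. The weak Koebe theorem then provides an inverse of \<open>h\<close> on a disc of radius \<open>3\<close> about \<open>h z\<close>.
\<close>

lemma small_step_imp_in_flow_domain:
  assumes nofix: "\<And>z. z \<in> unit_disc \<Longrightarrow> f z \<noteq> z"
  shows "\<exists>\<kappa>>1. \<forall>z\<in>unit_disc. disc_cosh2 z (f z) < \<kappa> \<longrightarrow> z \<in> flow_domain"
proof -
  obtain C where C: "C > 0" "\<And>H w p. H holomorphic_on ball 0 1 \<Longrightarrow> inj_on H (ball 0 1) \<Longrightarrow> w \<notin> H ` ball 0 1 \<Longrightarrow> norm p < 1/4
     \<Longrightarrow> norm (H p - H 0) \<le> C * norm p * norm (w - H (0::complex))"
    using univalent_omitted_value_bound by blast
  obtain \<epsilon>1 where e1: "\<epsilon>1 > 0" "\<And>g z. g holomorphic_on ball 0 1 \<Longrightarrow> (\<And>z. norm z < 1 \<Longrightarrow> norm (g z) < 1 \<and> g z \<noteq> z) \<Longrightarrow>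
      norm (g 0) < \<epsilon>1 \<Longrightarrow> norm z \<le> 3/4 \<Longrightarrow> norm (g z - z) < (1/8::real)"
    using fixed_point_free_near_identity[of "1/8"] by auto
  define \<epsilon> where "\<epsilon> = min \<epsilon>1 (min (1/8) (1 / (6 * C)))"
  have \<epsilon>: "0 < \<epsilon>" "\<epsilon> \<le> \<epsilon>1" "\<epsilon> \<le> 1/8" "\<epsilon> \<le> 1 / (6 * C)" using e1(1) C(1) by (auto simp: \<epsilon>_def)
  define \<kappa> where "\<kappa> = 1 / (1 - \<epsilon>\<^sup>2)"
  have \<epsilon>2: "0 < \<epsilon>\<^sup>2" "\<epsilon>\<^sup>2 < 1" using \<epsilon> by (auto simp: power_less_one_iff abs_square_less_1)
  then have \<kappa>: "1 < \<kappa>" by (simp add: \<kappa>_def)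
  define B where "B = (\<lambda>z. Moebius_function 0 (- z) ` ball 0 (1/2))"
  have B: "B z = {w \<in> unit_disc. disc_cosh2 z w < 4/3}" if "norm z < 1" for z
    using hyperbolic_disc_eq_moebius_image[of z "1/2"] that by (simp add: B_def power2_eq_square)
  define g where "g = (\<lambda>z x. Moebius_function 0 z (f (Moebius_function 0 (- z) x)))"
  have Mb: "norm (Moebius_function 0 z x) < 1" if "norm z < 1" "norm x < 1" for z x
    using Moebius_function_norm_lt_1 that by blast
  have g: "g z holomorphic_on ball 0 1" "norm x < 1 \<Longrightarrow> norm (g z x) < 1 \<and> g z x \<noteq> x"
      "norm x < 1 \<Longrightarrow> f (Moebius_function 0 (- z) x) = Moebius_function 0 (- z) (g z x)"
      if z: "norm z < 1" for z x
  proof -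
    have z': "norm (- z) < 1" using z by simp
    have 1: "(\<lambda>x. f (Moebius_function 0 (- z) x)) holomorphic_on ball 0 1"
      by (rule holomorphic_on_compose_gen[OF Moebius_function_holomorphic[OF z'] f_holomorphic, unfolded o_def])
         (use Mb[OF z'] in auto)
    show "g z holomorphic_on ball 0 1" unfolding g_def
      by (rule holomorphic_on_compose_gen[OF 1 Moebius_function_holomorphic[OF z], unfolded o_def])
         (use Mb[OF z'] f_norm in auto)
    have inv: "f (Moebius_function 0 (- z) x) = Moebius_function 0 (- z) (g z x)" if x: "norm x < 1" for x
      unfolding g_def using Moebius_function_compose[of "- z" z] z f_norm[OF Mb[OF z' x]] by simp
    then show "norm x < 1 \<Longrightarrow> f (Moebius_function 0 (- z) x) = Moebius_function 0 (- z) (g z x)" .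
    show "norm (g z x) < 1 \<and> g z x \<noteq> x" if x: "norm x < 1"
    proof
      show "norm (g z x) < 1" unfolding g_def using Mb[OF z f_norm[OF Mb[OF z' x]]] .
      show "g z x \<noteq> x"
        using inv[OF x] nofix[of "Moebius_function 0 (- z) x"] Mb[OF z' x] by auto
    qed
  qed
  have g0: "norm (g z 0) < \<epsilon>" if z: "norm z < 1" "disc_cosh2 z (f z) < \<kappa>" for z
  proof -
    have "1 - (norm (g z 0))\<^sup>2 = inverse (disc_cosh2 z (f z))"
      using moebius_norm_sq[OF z(1) f_norm[OF z(1)]] by (simp add: g_def Moebius_function_of_zero)
    moreover have "inverse \<kappa> < inverse (disc_cosh2 z (f z))"
      using z disc_cosh2_pos[OF z(1) f_norm[OF z(1)]] by simp
    ultimately have "(norm (g z 0))\<^sup>2 < \<epsilon>\<^sup>2" by (simp add: \<kappa>_def)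
    then show ?thesis using \<epsilon>(1) power2_less_imp_less by (metis less_imp_le)
  qed
  have finj: "inj_on f (B z)" if z: "norm z < 1" "disc_cosh2 z (f z) < \<kappa>" for z
  proof (rule inj_onI)
    fix a b assume ab: "a \<in> B z" "b \<in> B z" "f a = f b"
    then obtain x y where xy: "a = Moebius_function 0 (- z) x" "b = Moebius_function 0 (- z) y"
      "x \<in> ball 0 (1/2)" "y \<in> ball 0 (1/2)" by (auto simp: B_def)
    have n: "norm x < 1" "norm y < 1" using xy by auto
    have "inj_on (g z) (ball 0 (1/2))"
      using e1(2)[OF g(1)[OF z(1)] g(2)[OF z(1)]] g0[OF z] \<epsilon>(2) by (intro near_identity_injective[OF g(1)[OF z(1)]]) auto
    moreover have "g z x = g z y" using ab(3) by (simp add: g_def xy)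
    ultimately show "a = b" using xy by (auto dest: inj_onD)
  qed
  have "z \<in> flow_domain" if z: "norm z < 1" "disc_cosh2 z (f z) < \<kappa>" for z
  proof -
    have zd: "z \<in> unit_disc" using z by simp
    \<comment> \<open>\<open>h\<close> is injective on \<open>B z\<close>, since all iterates of \<open>f\<close> are.\<close>
    have iter: "(f ^^ n) ` B z \<subseteq> B ((f ^^ n) z) \<and> inj_on (f ^^ n) (B z)" for n
    proof (induction n)
      case (Suc n)
      let ?y = "(f ^^ n) z"
      have y: "norm ?y < 1" "disc_cosh2 ?y (f ?y) < \<kappa>"
        using funpow_norm[OF z(1)] orbit_step_decreasing[OF z(1), of n] z(2) by auto
      have "f ` B ?y \<subseteq> B (f ?y)"
        unfolding B[OF y(1)] B[OF f_norm[OF y(1)]]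
        using Schwarz_Pick_disc[OF f_holomorphic f_norm y(1)] f_in_disc by (fastforce intro: le_less_trans)
      moreover have "inj_on (f \<circ> (f ^^ n)) (B z)"
        using Suc finj[OF y] by (meson comp_inj_on inj_on_subset)
      ultimately have "(f ^^ Suc n) ` B z \<subseteq> B ((f ^^ Suc n) z)" "inj_on (f ^^ Suc n) (B z)"
        unfolding funpow.simps(2) using Suc by (auto simp only: image_subset_iff comp_apply)
      then show ?case ..
    qed (auto simp: id_def)
    have Bsub: "B z \<subseteq> unit_disc" using B[OF z(1)] by auto
    have hinj: "inj_on h (B z)"
    proof (rule inj_onI)
      fix a b assume ab: "a \<in> B z" "b \<in> B z" "h a = h b"
      then obtain n where "(f ^^ n) a = (f ^^ n) b" using h_eq_imp_orbits_merge Bsub by blast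
      then show "a = b" using iter[of n] ab by (auto dest: inj_onD)
    qed
    define \<phi> where "\<phi> = (\<lambda>x. Moebius_function 0 (- z) (x / 2))"
    have \<phi>B: "\<phi> x \<in> B z" if "x \<in> ball 0 1" for x
      unfolding \<phi>_def B_def using that by (intro imageI) (simp add: norm_divide)
    have \<phi>h: "\<phi> holomorphic_on ball 0 1" unfolding \<phi>_def
      by (rule holomorphic_on_compose_gen[OF _ Moebius_function_holomorphic[of "- z" 0], unfolded o_def])
         (use z in \<open>auto intro!: holomorphic_intros simp: norm_divide\<close>)
    have \<phi>inj: "inj_on \<phi> (ball 0 1)"
    proof (rule inj_on_inverseI[where g = "\<lambda>w. 2 * Moebius_function 0 z w"])
      fix x :: complex assume "x \<in> ball 0 1"
      then have "Moebius_function 0 z (\<phi> x) = x / 2"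
        unfolding \<phi>_def using z(1) by (intro Moebius_function_compose) (auto simp: norm_divide)
      then show "2 * Moebius_function 0 z (\<phi> x) = x" by (simp only:) simp
    qed
    define H where "H = (\<lambda>x. h (\<phi> x))"
    have Hh: "H holomorphic_on ball 0 1" unfolding H_def
      by (rule holomorphic_on_compose_gen[OF \<phi>h h_holomorphic, unfolded o_def]) (use \<phi>B Bsub in blast)
    have Hinj: "inj_on H (ball 0 1)"
    proof -
      have "inj_on (h \<circ> \<phi>) (ball 0 1)"
        using \<phi>inj hinj \<phi>B by (meson comp_inj_on inj_on_subset image_subsetI)
      then show ?thesis by (simp add: H_def o_def)
    qed
    define a where "a = g z 0"
    have a: "norm a < \<epsilon>" "a \<noteq> 0" using g0[OF z] g(2)[OF z(1), of 0] by (auto simp: a_def)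
    have \<phi>0: "\<phi> 0 = z" by (simp add: \<phi>_def Moebius_function_of_zero)
    have \<phi>a: "\<phi> (2 * a) = f z"
      using g(3)[OF z(1), of 0] by (simp add: \<phi>_def a_def Moebius_function_of_zero)
    have cover: "ball (h z) 3 \<subseteq> H ` ball 0 1"
    proof
      fix w assume w: "w \<in> ball (h z) 3"
      show "w \<in> H ` ball 0 1"
      proof (rule ccontr)
        assume "w \<notin> H ` ball 0 1"
        then have "norm (H (2 * a) - H 0) \<le> C * norm (2 * a) * norm (w - H 0)"
          using a(1) \<epsilon>(3) by (intro C(2)[OF Hh Hinj]) (auto simp: norm_mult)
        then have "1 \<le> C * (2 * norm a) * norm (w - h z)"
          using h_f[OF zd] by (simp add: H_def \<phi>0 \<phi>a norm_mult)
        also have "\<dots> \<le> C * (2 * norm a) * 3"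
          using w C(1) by (intro mult_left_mono) (auto simp: dist_norm norm_minus_commute)
        also have "\<dots> < C * (2 * (1 / (6 * C))) * 3"
          using a(1) \<epsilon>(4) C(1) by (intro mult_strict_right_mono mult_strict_left_mono) auto
        also have "\<dots> = 1" using C(1) by simp
        finally show False by simp
      qed
    qed
    obtain G where G: "G holomorphic_on H ` ball 0 1" "\<And>x. x \<in> ball 0 1 \<Longrightarrow> G (H x) = x"
      using holomorphic_has_inverse[OF Hh open_ball Hinj] by metis
    have G': "G w \<in> ball 0 1" "H (G w) = w" if w: "w \<in> ball (h z) 3" for w
    proof -
      obtain x where x: "x \<in> ball 0 1" "w = H x" using w cover by blast
      then have "G w = x" using G(2) by blast
      then show "G w \<in> ball 0 1" "H (G w) = w" using x by auto
    qed
    define u where "u = (\<lambda>w. \<phi> (G w))"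
    have "koenigs_section (ball (h z) 3) 0 u"
      unfolding koenigs_section_def
    proof (intro conjI ballI)
      show "u holomorphic_on ball (h z) 3" unfolding u_def
        by (rule holomorphic_on_compose_gen[OF holomorphic_on_subset[OF G(1) cover] \<phi>h, unfolded o_def]) (use G' in blast)
      show "u ` ball (h z) 3 \<subseteq> unit_disc" using G'(1) \<phi>B Bsub unfolding u_def by blast
      show "h (u w) = w + 0" if "w \<in> ball (h z) 3" for w
        using G'(2)[OF that] by (simp add: u_def H_def)
    qed
    moreover have "u (h z) = z" using G(2)[of 0] by (simp add: u_def H_def \<phi>0)
    moreover have "2 * a \<in> ball 0 1" using a(1) \<epsilon>(3) by (simp add: norm_mult)
    then have "G (H (2 * a)) = 2 * a" by (rule G(2))
    then have "u (h z + 1) = f z" using h_f[OF zd] by (simp add: u_def H_def \<phi>a)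
    ultimately show ?thesis
      by (intro section_imp_flow_domain[OF zd, where S = "ball (h z) 3" and u = u]) (auto simp: dist_norm)
  qed
  then show ?thesis using \<kappa> by auto
qed

text \<open>
  A section over the disc of radius \<open>r\<close> about \<open>h z\<close>, after enough iterations, takes the values
  \<open>(f ^^ k) z\<close> and \<open>(f ^^ (k + 1)) z\<close> at the points \<open>h z\<close> and \<open>h z + 1\<close>, whose distance in that disc
  tends to \<open>0\<close> as \<open>r\<close> grows.
\<close>

lemma zero_step_orbit:
  assumes univ: "backward_union \<Omega> = UNIV" and z: "z \<in> unit_disc" and \<kappa>: "1 < \<kappa>"
  shows "\<exists>n. disc_cosh2 ((f ^^ n) z) (f ((f ^^ n) z)) < \<kappa>"
proof -
  define r where "r = sqrt (\<kappa> / (\<kappa> - 1)) + 1"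
  have q: "\<kappa> / (\<kappa> - 1) > 1" using \<kappa> by simp
  then have r1: "r > 1" "r\<^sup>2 > \<kappa> / (\<kappa> - 1)"
  proof -
    show "r > 1" using q \<kappa> by (simp add: r_def)
    have "(sqrt (\<kappa> / (\<kappa> - 1)))\<^sup>2 < r\<^sup>2" using q by (intro power_strict_mono) (auto simp: r_def)
    then show "r\<^sup>2 > \<kappa> / (\<kappa> - 1)" using q by simp
  qed
  define w where "w = h z"
  obtain S n u where S: "open S" "cball w r \<subseteq> S" "koenigs_section S (of_nat n) u"
    using section_over_compact[of "cball w r"] univ by auto
  have wS: "w \<in> S" "w + 1 \<in> S" using S(2) r1(1) by (auto simp: subset_iff dist_norm)
  note fz = f_in_disc[OF z]
  have "\<forall>\<^sub>F m in sequentially. (f ^^ m) (u w) = (f ^^ m) ((f ^^ n) z)"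
    using koenigs_sectionD[OF S(3)] wS funpow_in_disc[OF z] h_funpow[OF z]
    by (intro eventually_orbits_merge) (auto simp: w_def)
  moreover have "\<forall>\<^sub>F m in sequentially. (f ^^ m) (u (w + 1)) = (f ^^ m) ((f ^^ n) (f z))"
    using koenigs_sectionD[OF S(3)] wS funpow_in_disc[OF fz] h_funpow[OF fz] h_f[OF z]
    by (intro eventually_orbits_merge) (auto simp: w_def)
  ultimately have "\<forall>\<^sub>F m in sequentially. (f ^^ m) (u w) = (f ^^ m) ((f ^^ n) z) \<and>
      (f ^^ m) (u (w + 1)) = (f ^^ m) ((f ^^ n) (f z))" by (rule eventually_conj)
  then obtain m where m: "(f ^^ m) (u w) = (f ^^ m) ((f ^^ n) z)" "(f ^^ m) (u (w + 1)) = (f ^^ m) ((f ^^ n) (f z))"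
    unfolding eventually_sequentially by blast
  let ?g = "\<lambda>x. (f ^^ m) (u (w + of_real r * x))"
  have in_S: "w + of_real r * x \<in> S" if "norm x < 1" for x
  proof -
    have "norm (of_real r * x) \<le> r" using that r1(1) by (simp add: norm_mult mult_left_le)
    then show ?thesis using S(2) by (auto simp: subset_iff dist_norm)
  qed
  note sec = koenigs_section_iterate[OF S(3), of m]
  have "disc_cosh2 (?g 0) (?g (of_real (1 / r))) \<le> disc_cosh2 0 (of_real (1 / r))"
  proof (rule Schwarz_Pick_disc[where g = ?g])
    show "?g holomorphic_on ball 0 1"
      by (rule holomorphic_on_compose_gen[OF _ koenigs_sectionD(1)[OF sec], unfolded o_def])
         (use in_S in \<open>auto intro!: holomorphic_intros\<close>)
    show "norm (?g x) < 1" if "norm x < 1" for x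
      using koenigs_sectionD(2)[OF sec in_S[OF that]] by simp
    show "norm (complex_of_real (1 / r)) < 1" using r1(1) by (simp add: norm_divide)
  qed simp
  also have "\<dots> = 1 / (1 - (1 / r)\<^sup>2)"
    unfolding disc_cosh2_zero using r1(1) by (simp only: norm_of_real) simp
  also have "\<dots> < \<kappa>"
  proof -
    have "(1 / r)\<^sup>2 = 1 / r\<^sup>2" by (simp add: power_divide)
    moreover have "1 / r\<^sup>2 < 1 / (\<kappa> / (\<kappa> - 1))" 
    proof (intro divide_strict_left_mono mult_pos_pos)
      show "0 < r\<^sup>2" "0 < \<kappa> / (\<kappa> - 1)" "\<kappa> / (\<kappa> - 1) < r\<^sup>2" using r1(2) q by linarith+
    qed simp
    moreover have "1 / (\<kappa> / (\<kappa> - 1)) = 1 - 1 / \<kappa>" using \<kappa> by (simp add: field_simps)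
    ultimately have "1 / \<kappa> < 1 - (1 / r)\<^sup>2" by linarith
    moreover have "0 < 1 / \<kappa>" using \<kappa> by simp
    moreover from calculation have "0 < 1 - (1 / r)\<^sup>2" by linarith
    ultimately have "1 / (1 - (1 / r)\<^sup>2) < 1 / (1 / \<kappa>)"
      by (intro divide_strict_left_mono mult_pos_pos) (assumption | simp)+
    then show ?thesis by simp
  qed
  finally have "disc_cosh2 (?g 0) (?g (of_real (1 / r))) < \<kappa>" .
  moreover have "?g 0 = (f ^^ (m + n)) z" using m(1) by (simp add: funpow_add)
  moreover have "?g (of_real (1 / r)) = f ((f ^^ (m + n)) z)"
  proof -
    have "complex_of_real r * complex_of_real (1 / r) = 1" using r1(1) by (simp flip: of_real_mult)
    then show ?thesis using m(2) by (simp only: funpow_add comp_apply funpow_swap1)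
  qed
  ultimately show ?thesis by (intro exI[of _ "m + n"]) simp
qed

text \<open>
  Let \<open>p\<close> be the displacement of \<open>f\<close> in the half-plane coordinate \<open>X\<close>. At a point \<open>b\<close> of an orbit with
  small step, \<open>Re p \<le> \<epsilon> Re X\<close>. The Schwarz-Pick lemma for \<open>G = p + \<epsilon> X\<close>, applied to \<open>b\<close> and a point
  \<open>z\<close> of the cone far out, carries this over to \<open>|p z| \<le> \<eta> |X z|\<close>, where \<open>\<epsilon>\<close> is chosen in terms of
  \<open>\<eta>\<close> and \<open>M\<close>. Adding \<open>\<epsilon> X\<close> makes the real part positive.
\<close>

lemma parabolic_cone_tails:
  assumes nofix: "\<And>z. z \<in> unit_disc \<Longrightarrow> f z \<noteq> z" and dw: "denjoy_wolff_point f \<tau>"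
    and univ: "backward_union \<Omega> = UNIV"
  shows "contains_cone_tails \<tau> flow_domain"
  unfolding contains_cone_tails_def
proof
  fix M0 :: real
  define M where "M = max 1 M0"
  have M: "M \<ge> 1" "M \<ge> M0" by (auto simp: M_def)
  have \<tau>: "norm \<tau> = 1" using dw by (simp add: denjoy_wolff_point_def)
  obtain \<kappa> where \<kappa>: "\<kappa> > 1" "\<And>z. z \<in> unit_disc \<Longrightarrow> disc_cosh2 z (f z) < \<kappa> \<Longrightarrow> z \<in> flow_domain"
    using small_step_imp_in_flow_domain[OF nofix] by blast
  define \<eta> where "\<eta> = (sqrt \<kappa> - 1) / M"
  have sk: "sqrt \<kappa> > 1" using \<kappa>(1) by simp
  have \<eta>: "\<eta> > 0" using sk M by (simp add: \<eta>_def)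
  define \<epsilon> where "\<epsilon> = \<eta> / (11 * M)"
  have \<epsilon>: "\<epsilon> > 0" using \<eta> M by (simp add: \<epsilon>_def)
  define X where "X = cayley \<tau>"
  define p where "p = (\<lambda>z. X (f z) - X z)"
  have Xpos: "0 < Re (X z)" if "norm z < 1" for z using Re_cayley_pos[OF \<tau> that] by (simp add: X_def)
  have ppos: "0 \<le> Re (p z)" if "norm z < 1" for z using Wolff_halfplane[OF dw that] by (simp add: p_def X_def)
  \<comment> \<open>The bound is the least value of \<open>halfplane_cosh2\<close> when \<open>Re X\<close> grows by the factor \<open>1 + \<epsilon>\<close>.\<close>
  have k: "1 < 1 + \<epsilon>\<^sup>2 / (4 * (1 + \<epsilon>))" using \<epsilon> by simp
  obtain n where n: "disc_cosh2 ((f ^^ n) 0) (f ((f ^^ n) 0)) < 1 + \<epsilon>\<^sup>2 / (4 * (1 + \<epsilon>))"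
    using zero_step_orbit[OF univ _ k, of 0] by auto
  define b where "b = (f ^^ n) 0"
  have b: "norm b < 1" using funpow_norm[of 0 n] by (simp add: b_def)
  define s where "s = Re (p b) / Re (X b)"
  have s0: "s \<ge> 0" using ppos[OF b] Xpos[OF b] by (simp add: s_def)
  have ps: "Re (p b) = s * Re (X b)" using Xpos[OF b] by (simp add: s_def)
  have sle: "s \<le> \<epsilon>"
  proof (rule ccontr)
    assume a: "\<not> s \<le> \<epsilon>"
    have fb: "Re (X (f b)) = (1 + s) * Re (X b)" using ps by (simp add: p_def algebra_simps)
    have "(2 + s)\<^sup>2 / (4 * (1 + s)) = (Re (X b) + Re (X (f b)))\<^sup>2 / (4 * Re (X b) * Re (X (f b)))"
    proof -
      have "Re (X b) + Re (X (f b)) = (2 + s) * Re (X b)" using fb by (simp add: algebra_simps)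
      moreover have "((2 + s) * R)\<^sup>2 / (4 * R * ((1 + s) * R)) = (2 + s)\<^sup>2 / (4 * (1 + s))" if "R > 0" for R
        using that s0 by (simp add: divide_simps power2_eq_square)
      ultimately show ?thesis using fb Xpos[OF b] by simp
    qed
    also have "\<dots> \<le> halfplane_cosh2 (X b) (X (f b))"
    proof -
      have "(Re (X b) + Re (X (f b)))\<^sup>2 = (Re (X b + cnj (X (f b))))\<^sup>2" by simp
      also have "\<dots> \<le> (norm (X b + cnj (X (f b))))\<^sup>2" by (metis abs_Re_le_cmod abs_le_square_iff abs_norm_cancel)
      finally show ?thesis unfolding halfplane_cosh2_def using Xpos[OF b] Xpos[OF f_norm[OF b]]
        by (intro divide_right_mono) auto
    qed
    also have "\<dots> < 1 + \<epsilon>\<^sup>2 / (4 * (1 + \<epsilon>))"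
      using n cayley_cosh2[OF \<tau> b f_norm[OF b]] by (simp add: X_def b_def)
    also have "\<dots> \<le> 1 + s\<^sup>2 / (4 * (1 + s))"
    proof -
      have "0 \<le> (s - \<epsilon>) * (s + \<epsilon> + s * \<epsilon>)" using a \<epsilon> s0 by (intro mult_nonneg_nonneg) auto
      then have "\<epsilon>\<^sup>2 * (1 + s) \<le> s\<^sup>2 * (1 + \<epsilon>)" by (simp add: algebra_simps power2_eq_square)
      then show ?thesis using \<epsilon> s0 by (simp add: divide_simps) (simp add: algebra_simps)
    qed
    also have "\<dots> = (2 + s)\<^sup>2 / (4 * (1 + s))" using s0 by (simp add: divide_simps power2_eq_square) (simp add: algebra_simps)
    finally show False by simp
  qed
  define G where "G = (\<lambda>z. p z + of_real \<epsilon> * X z)"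
  have Gpos: "0 < Re (G z)" if "norm z < 1" for z
    using ppos[OF that] Xpos[OF that] \<epsilon> by (simp add: G_def add_nonneg_pos)
  have Xh: "X holomorphic_on unit_disc" unfolding X_def by (rule cayley_holomorphic[OF \<tau>])
  have Gh: "G holomorphic_on unit_disc" unfolding G_def p_def
    by (intro holomorphic_intros Xh holomorphic_on_compose_gen[OF f_holomorphic Xh, unfolded o_def])
       (use f_in_disc in blast)
  have Gb: "Re (G b) \<le> 2 * \<epsilon> * Re (X b)"
    using mult_right_mono[OF sle, of "Re (X b)"] Xpos[OF b] ps by (simp add: G_def)
  define T where "T = max (norm (X b)) (norm (G b) / \<epsilon>)"
  have small: "norm (p z) \<le> \<eta> * norm (X z)"
    if z: "norm z < 1" "norm (X z) \<le> M * Re (X z)" "T \<le> norm (X z)" for z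
  proof -
    define c a where "c = norm (X z)" and "a = norm (G z)"
    have c: "norm (X b) \<le> c" "norm (G b) \<le> \<epsilon> * c"
      using z(3) \<epsilon> by (auto simp: T_def c_def field_simps)
    have c0: "c > 0" using Xpos[OF z(1)] by (auto simp: c_def)
    have \<Delta>: "disc_cosh2 z b \<le> M * c / Re (X b)"
    proof -
      have "disc_cosh2 z b = (norm (X z + cnj (X b)))\<^sup>2 / (4 * Re (X z) * Re (X b))"
        using cayley_cosh2[OF \<tau> z(1) b] by (simp add: X_def halfplane_cosh2_def)
      also have "\<dots> \<le> (2 * c)\<^sup>2 / (4 * Re (X z) * Re (X b))"
      proof (intro divide_right_mono power_mono)
        show "norm (X z + cnj (X b)) \<le> 2 * c"
          using norm_triangle_ineq[of "X z" "cnj (X b)"] c(1) by (simp add: c_def)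
      qed (use Xpos[OF b] Xpos[OF z(1)] in auto)
      also have "\<dots> = c * c / (Re (X z) * Re (X b))" by (simp add: power2_eq_square)
      also have "\<dots> \<le> c * (M * Re (X z)) / (Re (X z) * Re (X b))"
        using z(2) c0 Xpos[OF b] Xpos[OF z(1)] by (intro divide_right_mono mult_left_mono) (auto simp: c_def)
      also have "\<dots> = M * c / Re (X b)" using Xpos[OF z(1)] by simp
      finally show ?thesis .
    qed
    have "(norm (G z + cnj (G b)))\<^sup>2 = halfplane_cosh2 (G z) (G b) * (4 * Re (G z) * Re (G b))"
      using Gpos[OF z(1)] Gpos[OF b] by (simp add: halfplane_cosh2_def)
    also have "\<dots> \<le> (M * c / Re (X b)) * (4 * Re (G z) * Re (G b))"
      using Schwarz_Pick_halfplane[OF Gh Gpos z(1) b] \<Delta> Gpos[OF z(1)] Gpos[OF b] by (intro mult_right_mono) auto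
    also have "\<dots> \<le> (M * c / Re (X b)) * (4 * a * (2 * \<epsilon> * Re (X b)))"
      using Gb Gpos[OF z(1)] Gpos[OF b] c0 Xpos[OF b] M complex_Re_le_cmod[of "G z"]
      by (intro mult_left_mono mult_mono) (auto simp: a_def)
    also have "\<dots> = 8 * \<epsilon> * M * c * a" using Xpos[OF b] by simp
    finally have sq: "(norm (G z + cnj (G b)))\<^sup>2 \<le> 8 * \<epsilon> * M * c * a" .
    have ale: "a \<le> (8 * \<epsilon> * M + 2 * \<epsilon>) * c"
    proof (rule ccontr)
      assume "\<not> ?thesis"
      then have a1: "a > (8 * \<epsilon> * M) * c + 2 * \<epsilon> * c" by (simp add: algebra_simps)
      have pos: "0 \<le> \<epsilon> * M * c" "0 < \<epsilon> * c" using \<epsilon> M c0 by auto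
      have "a - \<epsilon> * c \<le> norm (G z + cnj (G b))"
        using norm_triangle_ineq2[of "G z" "- cnj (G b)"] c(2) by (simp add: a_def)
      then have "(a - \<epsilon> * c)\<^sup>2 \<le> (norm (G z + cnj (G b)))\<^sup>2"
        using a1 pos by (intro power_mono) auto
      then have "(a - \<epsilon> * c)\<^sup>2 \<le> 8 * \<epsilon> * M * c * a" using sq by linarith
      moreover have "a * (8 * \<epsilon> * M * c) \<le> a * (a - 2 * \<epsilon> * c)"
        using a1 by (intro mult_left_mono) (auto simp: a_def)
      moreover have "(a - \<epsilon> * c)\<^sup>2 = a * (a - 2 * \<epsilon> * c) + (\<epsilon> * c)\<^sup>2" by (simp add: power2_eq_square algebra_simps)
      moreover have "(\<epsilon> * c)\<^sup>2 > 0" using pos(2) by (rule zero_less_power)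
      ultimately show False by (simp add: mult.commute mult.left_commute)
    qed
    have "p z = G z - of_real \<epsilon> * X z" by (simp add: G_def)
    then have "norm (p z) \<le> a + \<epsilon> * c"
      using norm_triangle_ineq4[of "G z" "of_real \<epsilon> * X z"] \<epsilon> by (simp add: a_def c_def norm_mult)
    also have "\<dots> \<le> (8 * \<epsilon> * M + 3 * \<epsilon>) * c" using ale by (simp add: algebra_simps)
    also have "\<dots> \<le> (11 * \<epsilon> * M) * c" using \<epsilon> M c0 by (intro mult_right_mono) auto
    also have "11 * \<epsilon> * M = \<eta>" using M by (simp add: \<epsilon>_def)
    finally show ?thesis by (simp add: c_def)
  qed
  show "\<exists>T. \<forall>z. norm z < 1 \<and> norm (cayley \<tau> z) \<le> M0 * Re (cayley \<tau> z) \<and> T \<le> norm (cayley \<tau> z) \<longrightarrow> z \<in> flow_domain"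
  proof (intro exI[of _ T] allI impI)
    fix z assume "norm z < 1 \<and> norm (cayley \<tau> z) \<le> M0 * Re (cayley \<tau> z) \<and> T \<le> norm (cayley \<tau> z)"
    then have z: "norm z < 1" "norm (X z) \<le> M0 * Re (X z)" "T \<le> norm (X z)" by (auto simp: X_def)
    define R where "R = Re (X z)"
    have R: "R > 0" using Xpos[OF z(1)] by (simp add: R_def)
    have zM: "norm (X z) \<le> M * R" using z(2) mult_right_mono[OF M(2) less_imp_le[OF R]] unfolding R_def by linarith
    have "norm (p z) \<le> \<eta> * norm (X z)" using small[OF z(1) _ z(3)] zM by (simp add: R_def)
    also have "\<dots> \<le> \<eta> * (M * R)" using zM \<eta> by (intro mult_left_mono) auto
    also have "\<dots> = (sqrt \<kappa> - 1) * R" using M by (simp add: \<eta>_def)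
    finally have pz: "norm (p z) \<le> (sqrt \<kappa> - 1) * R" .
    have "disc_cosh2 z (f z) = (norm (X z + cnj (X (f z))))\<^sup>2 / (4 * R * Re (X (f z)))"
      using cayley_cosh2[OF \<tau> z(1) f_norm[OF z(1)]] by (simp add: X_def halfplane_cosh2_def R_def)
    also have "\<dots> \<le> (norm (X z + cnj (X (f z))))\<^sup>2 / (4 * R * R)"
      using R ppos[OF z(1)] by (intro divide_left_mono mult_left_mono) (auto simp: R_def p_def intro!: mult_pos_pos)
    also have "\<dots> \<le> ((sqrt \<kappa> + 1) * R)\<^sup>2 / (4 * R * R)"
    proof (intro divide_right_mono power_mono)
      have "X z + cnj (X (f z)) = of_real (2 * R) + cnj (p z)" by (simp add: complex_eq_iff p_def R_def)
      then have "norm (X z + cnj (X (f z))) \<le> norm (complex_of_real (2 * R)) + norm (p z)"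
        by (metis complex_mod_cnj norm_triangle_ineq)
      also have "norm (complex_of_real (2 * R)) = 2 * R" using R by (simp only: norm_of_real)
      finally show "norm (X z + cnj (X (f z))) \<le> (sqrt \<kappa> + 1) * R" using pz by (simp add: algebra_simps)
    qed (use R in auto)
    also have "\<dots> = ((sqrt \<kappa> + 1) / 2)\<^sup>2" using R by (simp add: power2_eq_square field_simps)
    also have "\<dots> < (sqrt \<kappa>)\<^sup>2" using sk by (intro power_strict_mono) auto
    also have "\<dots> = \<kappa>" using \<kappa>(1) by simp
    finally show "z \<in> flow_domain" using \<kappa>(2) z(1) by simp
  qed
qed

section \<open>Hyperbolic maps\<close>

lemma strip_coordinates:
  assumes "a < b" "backward_union \<Omega> = {w. a < Im w \<and> Im w < b}"
  obtains \<beta> c :: real where "0 < \<beta>"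
    "\<And>w. w \<in> backward_union \<Omega> \<longleftrightarrow> \<bar>Im (of_real \<beta> * (w - \<i> * of_real c))\<bar> < pi / 2"
proof
  show "0 < pi / (b - a)" using assms(1) by simp
  fix w
  have eq: "pi / (b - a) * ((b - a) / 2) = pi / 2" using assms(1) by simp
  have "w \<in> backward_union \<Omega> \<longleftrightarrow> \<bar>Im w - (a + b) / 2\<bar> < (b - a) / 2"
    unfolding assms(2) by (auto simp: abs_less_iff field_simps)
  also have "\<dots> \<longleftrightarrow> pi / (b - a) * \<bar>Im w - (a + b) / 2\<bar> < pi / (b - a) * ((b - a) / 2)"
    using assms(1) by (intro mult_less_cancel_left_pos[symmetric]) simp
  also have "\<dots> \<longleftrightarrow> \<bar>Im (of_real (pi / (b - a)) * (w - \<i> * of_real ((a + b) / 2)))\<bar> < pi / 2"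
  proof -
    have gen: "Im (of_real s * (w - \<i> * of_real t)) = s * (Im w - t)" for s t by simp
    have "Im (of_real (pi / (b - a)) * (w - \<i> * of_real ((a + b) / 2))) = pi / (b - a) * (Im w - (a + b) / 2)"
      using gen .
    then show ?thesis unfolding eq using assms(1) by (simp only: abs_mult) simp
  qed
  finally show "w \<in> backward_union \<Omega> \<longleftrightarrow>
      \<bar>Im (of_real (pi / (b - a)) * (w - \<i> * of_real ((a + b) / 2)))\<bar> < pi / 2" .
qed

text \<open>
  With \<open>\<beta>\<close> and \<open>c\<close> such that \<open>w \<mapsto> \<beta> (w - \<i> c)\<close> maps the strip onto \<open>|Im w| < pi / 2\<close>, this
  is a map of the disc into the right half-plane which turns \<open>f\<close> into multiplication by \<open>exp \<beta>\<close>.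
\<close>

definition koenigs_exp :: "real \<Rightarrow> real \<Rightarrow> complex \<Rightarrow> complex"
  where "koenigs_exp \<beta> c z = exp (of_real \<beta> * (h z - \<i> * of_real c))"

context
  fixes \<beta> c :: real
  assumes \<beta>: "0 < \<beta>"
    and strip: "\<And>w. w \<in> backward_union \<Omega> \<longleftrightarrow> \<bar>Im (of_real \<beta> * (w - \<i> * of_real c))\<bar> < pi / 2"
begin

lemma koenigs_exp_holomorphic: "koenigs_exp \<beta> c holomorphic_on unit_disc"
  unfolding koenigs_exp_def by (intro holomorphic_intros h_holomorphic)

lemma Re_koenigs_exp_pos:
  assumes "norm z < 1" shows "0 < Re (koenigs_exp \<beta> c z)"
proof -
  have "\<bar>Im (of_real \<beta> * (h z - \<i> * of_real c))\<bar> < pi / 2"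
    using h_in_backward_union[of z] assms strip by simp
  then show ?thesis
    unfolding koenigs_exp_def Re_exp by (intro mult_pos_pos cos_gt_zero_pi) (auto simp only: abs_less_iff exp_gt_zero)
qed

lemma koenigs_exp_orbit:
  assumes "norm z < 1" shows "koenigs_exp \<beta> c ((f ^^ n) z) = of_real (exp (\<beta> * n)) * koenigs_exp \<beta> c z"
proof -
  have "of_real \<beta> * (h ((f ^^ n) z) - \<i> * of_real c) = of_real (\<beta> * n) + of_real \<beta> * (h z - \<i> * of_real c)"
    using h_funpow[of z n] assms by (simp add: algebra_simps)
  then show ?thesis unfolding koenigs_exp_def by (simp only: exp_add exp_of_real)
qed

text \<open>
  The preimage under the exponential of the hyperbolic disc about \<open>koenigs_exp \<beta> c 0\<close> lies in a compact
  subset \<open>K\<close> of the strip. By the Schwarz-Pick lemma \<open>h - n\<close> maps the disc about \<open>(f ^^ n) 0\<close> into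
  \<open>K\<close>. The iterated section over \<open>K\<close> passes through \<open>(f ^^ n) 0\<close>, so its image contains the whole
  disc, and the image of \<open>K\<close> is compact, hence absorbed by \<open>flow_domain\<close>.
\<close>

lemma hyperbolic_discs_in_flow_domain:
  shows "\<exists>N. \<forall>n\<ge>N. \<forall>z. norm z < 1 \<and> disc_cosh2 ((f ^^ n) 0) z \<le> D \<longrightarrow> z \<in> flow_domain"
proof -
  define Q where "Q = koenigs_exp \<beta> c"
  note Qpos = Re_koenigs_exp_pos[folded Q_def] and Qh = koenigs_exp_holomorphic[folded Q_def]
    and Qn = koenigs_exp_orbit[folded Q_def]
  define q where "q = Q 0"
  have q: "0 < Re q" using Qpos[of 0] by (simp add: q_def)
  define r where "r = sqrt (1 - 1 / (\<bar>D\<bar> + 2))"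
  have D2: "0 < 1 / (\<bar>D\<bar> + 2)" "1 / (\<bar>D\<bar> + 2) < 1" by (auto simp: divide_simps)
  have r: "0 < r" "r < 1" "1 / (1 - r\<^sup>2) = \<bar>D\<bar> + 2" using D2 by (auto simp: r_def)
  define D1 where "D1 = \<bar>D\<bar> + 2"
  define KH where "KH = {y. Re q / (4 * D1) \<le> Re y} \<inter> cball (- cnj q) (4 * D1 * Re q)"
  have KHc: "compact KH" unfolding KH_def by (intro closed_Int_compact closed_halfspace_Re_ge compact_cball)
  have KHpos: "0 < Re y" if "y \<in> KH" for y
  proof -
    have "0 < Re q / (4 * D1)" using q by (auto simp: D1_def intro!: divide_pos_pos)
    then show ?thesis using that unfolding KH_def by auto
  qed
  have KHI: "y \<in> KH" if y: "0 < Re y" "halfplane_cosh2 q y \<le> D1" for y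
  proof -
    have D1: "D1 > 0" by (simp add: D1_def)
    have "Re q \<le> 4 * halfplane_cosh2 q y * Re y" by (rule halfplane_cosh2_Re_left_le[OF q y(1)])
    also have "\<dots> \<le> 4 * D1 * Re y" using y by (intro mult_right_mono) auto
    finally have "Re q / (4 * D1) \<le> Re y" using D1 by (simp add: divide_le_eq mult.commute)
    moreover have "norm (q + cnj y) \<le> 4 * D1 * Re q" by (rule halfplane_cosh2_norm_le[OF q y])
    then have "norm (- cnj q - y) \<le> 4 * D1 * Re q"
      using complex_mod_cnj[of "q + cnj y"] norm_minus_cancel[of "cnj q + y"] by simp
    ultimately show ?thesis by (simp add: KH_def dist_norm)
  qed
  define L where "L = (\<lambda>y. Ln y / of_real \<beta> + \<i> * of_real c)"
  define K where "K = L ` KH"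
  have KHnp: "y \<notin> \<real>\<^sub>\<le>\<^sub>0" if "y \<in> KH" for y using KHpos[OF that] by (auto simp: complex_nonpos_Reals_iff)
  have Kc: "compact K" unfolding K_def L_def
    by (intro compact_continuous_image KHc continuous_intros) (use \<beta> KHnp in auto)
  have Ksub: "K \<subseteq> backward_union \<Omega>"
  proof
    fix w assume "w \<in> K"
    then obtain y where y: "y \<in> KH" "w = L y" by (auto simp: K_def)
    have "\<bar>Im (Ln y)\<bar> < pi / 2" 
    proof -
      have "y \<noteq> 0" using KHpos[OF y(1)] by auto
      then show ?thesis using Re_Ln_pos_lt[of y] KHpos[OF y(1)] by auto
    qed
    moreover have "of_real \<beta> * (w - \<i> * of_real c) = Ln y" using \<beta> by (simp add: y(2) L_def)
    ultimately show "w \<in> backward_union \<Omega>" by (simp only: strip)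
  qed
  have LQ: "L (of_real (exp (- (\<beta> * n))) * Q z) = h z - of_nat n" if "norm z < 1" for z n
  proof -
    have "of_real (exp (- (\<beta> * n))) * Q z = exp (of_real \<beta> * (h z - of_nat n - \<i> * of_real c))"
      unfolding Q_def koenigs_exp_def by (simp add: exp_add[symmetric] algebra_simps exp_of_real[symmetric])
    moreover have "Im (of_real \<beta> * (h z - of_nat n - \<i> * of_real c)) = Im (of_real \<beta> * (h z - \<i> * of_real c))"
      by simp
    then have "Ln (exp (of_real \<beta> * (h z - of_nat n - \<i> * of_real c))) = of_real \<beta> * (h z - of_nat n - \<i> * of_real c)"
    proof -
      assume im: "Im (of_real \<beta> * (h z - of_nat n - \<i> * of_real c)) = Im (of_real \<beta> * (h z - \<i> * of_real c))"
      have "\<bar>Im (of_real \<beta> * (h z - \<i> * of_real c))\<bar> < pi / 2"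
        using h_in_backward_union[of z] that strip by simp
      then show ?thesis unfolding im[symmetric] abs_less_iff
        using pi_gt_zero by (intro Ln_exp) linarith+
    qed
    ultimately show ?thesis using \<beta> by (simp add: L_def)
  qed
  have inK: "h z - of_nat n \<in> K" if z: "norm z < 1" "disc_cosh2 ((f ^^ n) 0) z \<le> D1" for z n
  proof -
    let ?y = "of_real (exp (- (\<beta> * n))) * Q z"
    have "halfplane_cosh2 (Q ((f ^^ n) 0)) (Q z) \<le> D1"
      using Schwarz_Pick_halfplane[OF Qh Qpos funpow_norm[of 0 n] z(1)] z(2) by simp
    moreover have "halfplane_cosh2 (of_real (exp (- (\<beta> * n))) * Q ((f ^^ n) 0)) ?y = halfplane_cosh2 (Q ((f ^^ n) 0)) (Q z)"
      by (rule halfplane_cosh2_scale) simp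
    moreover have "of_real (exp (- (\<beta> * n))) * Q ((f ^^ n) 0) = q"
      using Qn[of 0 n] by (simp add: q_def mult.assoc[symmetric] exp_add[symmetric] flip: of_real_mult)
    ultimately have "halfplane_cosh2 q ?y \<le> D1" by simp
    moreover have "0 < Re ?y" using Qpos[OF z(1)] by simp
    ultimately have "?y \<in> KH" by (intro KHI)
    then have "L ?y \<in> K" by (auto simp: K_def)
    then show ?thesis by (simp only: LQ[OF z(1)])
  qed
  obtain S n0 u where S: "open S" "K \<subseteq> S" "koenigs_section S (of_nat n0) u"
    using section_over_compact[OF Kc Ksub] by blast
  have D1_1: "D1 \<ge> 1" by (simp add: D1_def)
  have h0K: "h 0 \<in> K" using inK[of 0 0] disc_cosh2_self[of 0] D1_1 by simp
  have "\<forall>\<^sub>F m in sequentially. (f ^^ m) (u (h 0)) = (f ^^ m) ((f ^^ n0) 0)"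
    using koenigs_sectionD[OF S(3)] h0K S(2) h_funpow[of 0] funpow_in_disc[of 0]
    by (intro eventually_orbits_merge) auto
  then obtain m0 where m0: "\<And>m. m \<ge> m0 \<Longrightarrow> (f ^^ m) (u (h 0)) = (f ^^ m) ((f ^^ n0) 0)"
    by (auto simp: eventually_sequentially)
  have "compact (u ` K)"
    using koenigs_sectionD(1)[OF S(3)] S(2)
    by (intro compact_continuous_image Kc) (meson holomorphic_on_imp_continuous_on holomorphic_on_subset)
  moreover have "u ` K \<subseteq> unit_disc" using koenigs_sectionD(2)[OF S(3)] S(2) by blast
  ultimately obtain N1 where N1: "\<And>m. m \<ge> N1 \<Longrightarrow> (f ^^ m) ` u ` K \<subseteq> flow_domain"
    using compact_eventually_in_flow_domain by blast
  show ?thesis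
  proof (intro exI[of _ "n0 + max m0 N1"] allI impI)
    fix n z assume n: "n0 + max m0 N1 \<le> n" and z: "norm z < 1 \<and> disc_cosh2 ((f ^^ n) 0) z \<le> D"
    define m where "m = n - n0"
    have m: "n = n0 + m" "m0 \<le> m" "N1 \<le> m" using n by (auto simp: m_def)
    define A where "A = Moebius_function 0 (- ((f ^^ n) 0)) ` ball 0 r"
    have pn: "norm ((f ^^ n) 0) < 1" using funpow_norm[of 0] by simp
    have A: "A = {w \<in> unit_disc. disc_cosh2 ((f ^^ n) 0) w < D1}"
      unfolding A_def using hyperbolic_disc_eq_moebius_image[OF pn, of r] r by (simp add: D1_def)
    have "disc_cosh2 ((f ^^ n) 0) z < D1" using z unfolding D1_def by linarith
    then have zA: "z \<in> A" using z by (simp add: A)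
    have aA: "(f ^^ n) 0 \<in> A" using pn D1_1 disc_cosh2_self[OF pn] by (simp add: A D1_def)
    have Mh: "Moebius_function 0 (- ((f ^^ n) 0)) holomorphic_on ball 0 r"
      using pn r by (intro holomorphic_on_subset[OF Moebius_function_holomorphic] subset_ball) auto
    have Aconn: "connected A" unfolding A_def
      by (intro connected_continuous_image holomorphic_on_imp_continuous_on Mh connected_ball)
    have Aopen: "open A"
    proof -
      have "inj_on (Moebius_function 0 (- ((f ^^ n) 0))) (ball 0 r)"
        by (rule inj_on_inverseI[where g = "Moebius_function 0 ((f ^^ n) 0)"])
           (use pn r in \<open>auto intro!: Moebius_function_compose\<close>)
      then show ?thesis unfolding A_def using open_mapping_thm3[OF Mh open_ball] by blast
    qed
    have sec: "koenigs_section S (of_nat n) (\<lambda>w. (f ^^ m) (u w))"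
      using koenigs_section_iterate[OF S(3), of m] by (simp add: m(1))
    have AK: "h w - of_nat n \<in> K" if "w \<in> A" for w
      using that inK[of w n] by (simp add: A)
    have "A \<subseteq> (\<lambda>w. (f ^^ m) (u w)) ` S"
    proof (rule koenigs_section_captures[OF Aopen Aconn _ S(1) sec _ aA])
      show "A \<subseteq> unit_disc" by (auto simp: A)
      show "h w - of_nat n \<in> S" if "w \<in> A" for w using AK[OF that] S(2) by blast
      have "(f ^^ m) (u (h 0)) = (f ^^ n) 0" using m0[OF m(2)] by (simp add: m(1) funpow_add add.commute[of n0])
      then show "(f ^^ n) 0 \<in> (\<lambda>w. (f ^^ m) (u w)) ` S" using h0K S(2) by (metis image_eqI in_mono)
    qed
    then obtain w where w: "w \<in> S" "z = (f ^^ m) (u w)" using zA by blast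
    then have "h z = w + of_nat n" using koenigs_sectionD(3)[OF sec] by simp
    then have "w \<in> K" using AK[OF zA] by simp
    then show "z \<in> flow_domain" using N1[OF m(3)] w(2) by blast
  qed
qed

text \<open>
  Orbits move at linear speed, because \<open>koenigs_exp\<close> maps them to geometric progressions in the
  half-plane.
\<close>

lemma hyperbolic_orbit_distance:
  "exp (\<beta> * real m) \<le> 4 * disc_cosh2 ((f ^^ n) 0) ((f ^^ (n + m)) 0)"
proof -
  define q where "q = koenigs_exp \<beta> c ((f ^^ n) 0)"
  define e where "e = exp (\<beta> * real m)"
  have e: "e > 0" by (simp add: e_def)
  have pn: "norm ((f ^^ n) 0) < 1" for n using funpow_norm[of 0 n] by simp
  have q: "0 < Re q" using Re_koenigs_exp_pos[OF pn] by (simp add: q_def)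
  have "(f ^^ (n + m)) 0 = (f ^^ m) ((f ^^ n) 0)" by (simp add: add.commute[of n] funpow_add)
  then have "koenigs_exp \<beta> c ((f ^^ (n + m)) 0) = of_real e * q"
    using koenigs_exp_orbit[OF pn, of m n] by (simp add: q_def e_def)
  then have "halfplane_cosh2 q (of_real e * q) \<le> disc_cosh2 ((f ^^ n) 0) ((f ^^ (n + m)) 0)"
    using Schwarz_Pick_halfplane[OF koenigs_exp_holomorphic Re_koenigs_exp_pos pn pn, of n "n + m"] by (simp add: q_def)
  moreover have "e / 4 \<le> halfplane_cosh2 q (of_real e * q)"
  proof -
    have "(e * Re q)\<^sup>2 \<le> (Re (q + cnj (of_real e * q)))\<^sup>2" using q e by (intro power_mono) auto
    also have "\<dots> \<le> (norm (q + cnj (of_real e * q)))\<^sup>2" by (metis abs_Re_le_cmod abs_le_square_iff abs_norm_cancel)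
    finally have "(e * Re q)\<^sup>2 / (4 * Re q * (e * Re q)) \<le> (norm (q + cnj (of_real e * q)))\<^sup>2 / (4 * Re q * (e * Re q))"
      using q e by (intro divide_right_mono) auto
    moreover have "(e * Re q)\<^sup>2 / (4 * Re q * (e * Re q)) = e / 4" using q e by (simp add: power2_eq_square)
    ultimately show ?thesis by (simp add: halfplane_cosh2_def)
  qed
  ultimately show ?thesis by (simp add: e_def)
qed

text \<open>
  Let \<open>R\<close> be the real part of the orbit of \<open>0\<close> in the half-plane coordinate. It is nondecreasing, and
  grows at most by a fixed factor in one step. If it did not double in \<open>m\<close> steps, then the distance
  covered in these steps would be only logarithmic in \<open>m\<close>. Hence \<open>R\<close> grows geometrically, the
  increments of the orbit are bounded by multiples of \<open>R\<close>, and their sum keeps the orbit in a cone.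
  For a point \<open>y\<close> of a cone far out, the \<open>n\<close> with \<open>R n \<le> Re y < R (n + 1)\<close> gives a point of the orbit
  at bounded distance.
\<close>

lemma hyperbolic_cone_tails:
  assumes dw: "denjoy_wolff_point f \<tau>"
  shows "contains_cone_tails \<tau> flow_domain"
  unfolding contains_cone_tails_def
proof
  fix M0 :: real
  have \<tau>: "norm \<tau> = 1" using dw by (simp add: denjoy_wolff_point_def)
  define x where "x = (\<lambda>n. cayley \<tau> ((f ^^ n) 0))"
  define R where "R = (\<lambda>n. Re (x n))"
  have pn: "norm ((f ^^ n) 0) < 1" for n using funpow_norm[of 0 n] by simp
  have xpos: "0 < Re (x n)" for n using Re_cayley_pos[OF \<tau> pn] by (simp add: x_def)
  have ReR: "Re (x k) = R k" for k by (simp add: R_def)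
  have Rpos: "0 < R n" for n using xpos by (simp add: R_def)
  have x0: "x 0 = 1" using \<tau> by (auto simp: x_def cayley_def)
  have Rmono: "R m \<le> R n" if "m \<le> n" for m n
    using that
  proof (induction n rule: dec_induct)
    case (step n)
    have "R n \<le> R (Suc n)" using Wolff_halfplane[OF dw pn, of n] by (simp add: R_def x_def)
    then show ?case using step by linarith
  qed simp
  define B where "B = disc_cosh2 0 (f 0)"
  have B1: "B \<ge> 1" using disc_cosh2_ge_1[of 0 "f 0"] f_norm[of 0] by (simp add: B_def)
  have step: "halfplane_cosh2 (x n) (x (Suc n)) \<le> B" for n
    using orbit_step_decreasing[of 0 n] cayley_cosh2[OF \<tau> pn pn, of n "Suc n"] by (simp only: x_def B_def norm_zero zero_less_one)
  have Rstep: "R (Suc n) \<le> 4 * B * R n" for n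
  proof -
    have "R (Suc n) \<le> 4 * halfplane_cosh2 (x n) (x (Suc n)) * R n"
      unfolding R_def by (rule halfplane_cosh2_Re_right_le[OF xpos xpos])
    also have "\<dots> \<le> 4 * B * R n" using step[of n] Rpos[of n] by (intro mult_right_mono) auto
    finally show ?thesis .
  qed
  have xstep: "norm (x (Suc n) - x n) \<le> 4 * B * R n" for n
    using norm_diff_le_norm_add_cnj[of "x n" "x (Suc n)"] halfplane_cosh2_norm_le[OF xpos xpos step, of n]
      xpos[of n] xpos[of "Suc n"] by (simp add: R_def norm_minus_commute)
  have xsum: "norm (x (n + m) - x n) \<le> 4 * B * real m * R (n + m)" for n m
  proof (induction m)
    case (Suc m)
    have "norm (x (n + Suc m) - x n) \<le> norm (x (Suc (n + m)) - x (n + m)) + norm (x (n + m) - x n)"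
      using norm_triangle_ineq[of "x (Suc (n + m)) - x (n + m)" "x (n + m) - x n"] by simp
    also have "\<dots> \<le> 4 * B * R (n + m) + 4 * B * real m * R (n + m)" using xstep[of "n + m"] Suc by linarith
    also have "\<dots> = 4 * B * real (Suc m) * R (n + m)" by (simp add: algebra_simps)
    also have "\<dots> \<le> 4 * B * real (Suc m) * R (n + Suc m)"
      using Rmono[of "n + m" "n + Suc m"] B1 by (intro mult_left_mono) auto
    finally show ?case .
  qed simp
  \<comment> \<open>The choice of \<open>m\<close> makes \<open>exp (\<beta> m) \<ge> (1 + \<beta> m / 4)\<^sup>4\<close> exceed the bound for slow growth.\<close>
  obtain m where m: "real m \<ge> 128 * B / \<beta>\<^sup>2 + 8 / \<beta>" using real_arch_simple by blast
  have dbl: "2 * R n \<le> R (n + m)" for n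
  proof (rule ccontr)
    assume a: "\<not> 2 * R n \<le> R (n + m)"
    define t where "t = real m"
    have t: "t > 0" "\<beta> * t / 4 \<ge> 2" "\<beta>\<^sup>2 * t / 16 \<ge> 8 * B"
    proof -
      have p: "128 * B / \<beta>\<^sup>2 > 0" "8 / \<beta> > 0" using \<beta> B1 by auto
      then show "t > 0" using m unfolding t_def by linarith
      have "t \<ge> 8 / \<beta>" "t \<ge> 128 * B / \<beta>\<^sup>2" using m p by (simp_all only: t_def)
      then show "\<beta> * t / 4 \<ge> 2" "\<beta>\<^sup>2 * t / 16 \<ge> 8 * B" using \<beta> by (simp_all add: field_simps)
    qed
    have "norm (x n + cnj (x (n + m))) \<le> norm (x n - x (n + m)) + norm (complex_of_real (2 * R (n + m)))"
    proof -
      have "x n + cnj (x (n + m)) = (x n - x (n + m)) + complex_of_real (2 * R (n + m))"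
        by (simp add: complex_eq_iff R_def)
      then show ?thesis by (metis norm_triangle_ineq)
    qed
    also have "norm (complex_of_real (2 * R (n + m))) = 2 * R (n + m)"
      using Rpos[of "n + m"] by (simp only: norm_of_real)
    also have "norm (x n - x (n + m)) + 2 * R (n + m) \<le> (4 * B * t + 2) * R (n + m)"
      using xsum[of n m] by (simp add: norm_minus_commute t_def algebra_simps)
    also have "\<dots> \<le> (4 * B * t + 2) * (2 * R n)"
      using a B1 t by (intro mult_left_mono) auto
    finally have "(norm (x n + cnj (x (n + m))))\<^sup>2 \<le> ((4 * B * t + 2) * (2 * R n))\<^sup>2"
      by (intro power_mono) auto
    then have "halfplane_cosh2 (x n) (x (n + m)) \<le> ((4 * B * t + 2) * (2 * R n))\<^sup>2 / (4 * R n * R (n + m))"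
      unfolding halfplane_cosh2_def ReR using Rpos[of n] Rpos[of "n + m"] by (intro divide_right_mono) auto
    also have "\<dots> \<le> ((4 * B * t + 2) * (2 * R n))\<^sup>2 / (4 * R n * R n)"
      using Rpos[of n] Rpos[of "n + m"] Rmono[of n "n + m"]
      by (intro divide_left_mono mult_left_mono mult_pos_pos) auto
    also have "\<dots> = (4 * B * t + 2)\<^sup>2" using Rpos[of n] by (simp add: power2_eq_square)
    finally have "disc_cosh2 ((f ^^ n) 0) ((f ^^ (n + m)) 0) \<le> (4 * B * t + 2)\<^sup>2"
      using cayley_cosh2[OF \<tau> pn pn, of n "n + m"] by (simp add: x_def)
    then have "exp (\<beta> * t) \<le> 4 * (4 * B * t + 2)\<^sup>2"
      using hyperbolic_orbit_distance[of m n] unfolding t_def by linarith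
    moreover have "4 * (4 * B * t + 2)\<^sup>2 < exp (\<beta> * t)"
    proof -
      have "8 * B * t \<le> \<beta>\<^sup>2 * t / 16 * t" using t by (intro mult_right_mono) auto
      then have "2 * (4 * B * t + 2) < (1 + \<beta> * t / 4)\<^sup>2"
        using t(2) by (simp add: power2_eq_square algebra_simps)
      moreover have "0 < 2 * (4 * B * t + 2)" using B1 t(1) by (intro mult_pos_pos add_pos_pos) auto
      ultimately have "(2 * (4 * B * t + 2))\<^sup>2 < ((1 + \<beta> * t / 4)\<^sup>2)\<^sup>2" by (intro power_strict_mono) auto
      also have "\<dots> = (1 + \<beta> * t / 4) ^ 4" by (simp flip: power_mult)
      also have "\<dots> \<le> exp (\<beta> * t / 4) ^ 4" using t(2) exp_ge_add_one_self[of "\<beta> * t / 4"] by (intro power_mono) auto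
      also have "\<dots> = exp (\<beta> * t)" by (simp flip: exp_of_nat_mult)
      finally have "(2 * (4 * B * t + 2))\<^sup>2 < exp (\<beta> * t)" .
      moreover have "4 * (4 * B * t + 2)\<^sup>2 = (2 * (4 * B * t + 2))\<^sup>2" by (simp only: power_mult_distrib) simp
      ultimately show ?thesis by (simp only:)
    qed
    ultimately show False by simp
  qed
  have m1: "m \<ge> 1"
  proof (rule ccontr)
    assume "\<not> m \<ge> 1"
    then have "m = 0" by simp
    then show False using dbl[of 0] Rpos[of 0] by simp
  qed
  define C where "C = 1 + 8 * B * real m"
  have C1: "C \<ge> 1" using B1 by (simp add: C_def)
  have cone: "norm (x n) \<le> C * R n" for n
  proof (induction n rule: less_induct)
    case (less n)
    show ?case
    proof (cases "n < m")
      case True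
      have "norm (x n) \<le> norm (x 0) + norm (x n - x 0)" by (metis norm_minus_commute norm_triangle_sub)
      also have "\<dots> \<le> R n + 4 * B * real n * R n"
        using xsum[of 0 n] Rmono[of 0 n] x0 by (simp add: R_def)
      also have "\<dots> \<le> R n + 4 * B * real m * R n"
        using True B1 Rpos[of n] by (intro add_left_mono mult_right_mono mult_left_mono) auto
      also have "\<dots> \<le> C * R n" using B1 Rpos[of n] by (simp add: C_def algebra_simps)
      finally show ?thesis .
    next
      case False
      define k where "k = n - m"
      have n: "n = k + m" "k < n" using False m1 by (auto simp: k_def)
      have "norm (x n) \<le> norm (x k) + norm (x n - x k)" by (metis norm_minus_commute norm_triangle_sub)
      also have "\<dots> \<le> C * R k + 4 * B * real m * R n"
        using less[OF n(2)] xsum[of k m] by (simp add: n(1))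
      also have "\<dots> \<le> C * (R n / 2) + 4 * B * real m * R n"
        using dbl[of k] C1 by (intro add_right_mono mult_left_mono) (auto simp: n(1))
      also have "\<dots> \<le> C * R n"
      proof -
        have "8 * B * real m * R n \<le> C * R n" using Rpos[of n] by (intro mult_right_mono) (auto simp: C_def)
        then show ?thesis by (simp add: algebra_simps)
      qed
      finally show ?thesis .
    qed
  qed
  have unbdd: "\<exists>n. y < R n" for y
  proof -
    have "2 ^ k \<le> R (k * m)" for k
    proof (induction k)
      case 0 then show ?case using x0 by (simp add: R_def)
    next
      case (Suc k)
      then show ?case using dbl[of "k * m"] by (simp add: add.commute)
    qed
    moreover obtain k where "y < 2 ^ k" using real_arch_pow[of 2 y] by auto
    ultimately show ?thesis by (meson less_le_trans)
  qed
  define M where "M = max 1 M0"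
  define D where "D = (M + C)\<^sup>2 * B"
  obtain N where N: "\<And>n z. n \<ge> N \<Longrightarrow> norm z < 1 \<Longrightarrow> disc_cosh2 ((f ^^ n) 0) z \<le> D \<Longrightarrow> z \<in> flow_domain"
    using hyperbolic_discs_in_flow_domain[of D] by blast
  show "\<exists>T. \<forall>z. norm z < 1 \<and> norm (cayley \<tau> z) \<le> M0 * Re (cayley \<tau> z) \<and> T \<le> norm (cayley \<tau> z) \<longrightarrow> z \<in> flow_domain"
  proof (intro exI[of _ "M * R N"] allI impI)
    fix z assume "norm z < 1 \<and> norm (cayley \<tau> z) \<le> M0 * Re (cayley \<tau> z) \<and> M * R N \<le> norm (cayley \<tau> z)"
    then have z: "norm z < 1" "norm (cayley \<tau> z) \<le> M0 * Re (cayley \<tau> z)" "M * R N \<le> norm (cayley \<tau> z)" by auto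
    define y where "y = cayley \<tau> z"
    have y0: "0 < Re y" using Re_cayley_pos[OF \<tau> z(1)] by (simp add: y_def)
    have yM: "norm y \<le> M * Re y" using z(2) mult_right_mono[of M0 M, OF _ less_imp_le[OF y0]] by (auto simp: M_def y_def intro: order_trans)
    have "M * R N \<le> M * Re y" using z(3) yM by (simp add: y_def)
    moreover have "0 < M" by (simp add: M_def)
    ultimately have yN: "R N \<le> Re y" by (simp only: mult_le_cancel_left_pos)
    define k where "k = (LEAST k. Re y < R k)"
    have k: "Re y < R k" unfolding k_def by (rule LeastI_ex) (rule unbdd)
    have "N < k"
    proof (rule ccontr)
      assume "\<not> N < k"
      then have "R k \<le> R N" by (intro Rmono) simp
      then show False using k yN by simp
    qed
    then obtain n where n: "k = Suc n" "N \<le> n" by (cases k) auto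
    have Rn: "R n \<le> Re y" using not_less_Least[of n "\<lambda>k. Re y < R k"] n(1) by (auto simp: k_def[symmetric])
    have yR: "Re y \<le> 4 * B * R n" using k n(1) Rstep[of n] by simp
    have "disc_cosh2 ((f ^^ n) 0) z = (norm (x n + cnj y))\<^sup>2 / (4 * R n * Re y)"
      using cayley_cosh2[OF \<tau> pn z(1), of n] by (simp add: x_def y_def R_def halfplane_cosh2_def)
    also have "\<dots> \<le> ((M + C) * Re y)\<^sup>2 / (4 * R n * Re y)"
    proof (intro divide_right_mono power_mono)
      have "norm (x n + cnj y) \<le> norm (x n) + norm y" using norm_triangle_ineq[of "x n" "cnj y"] by simp
      also have "\<dots> \<le> C * Re y + M * Re y" using cone[of n] yM mult_left_mono[OF Rn, of C] C1 by linarith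
      finally show "norm (x n + cnj y) \<le> (M + C) * Re y" by (simp add: algebra_simps)
    qed (use Rpos[of n] y0 in auto)
    also have "\<dots> = (M + C)\<^sup>2 * Re y / (4 * R n)" using y0 by (simp add: power2_eq_square)
    also have "\<dots> \<le> (M + C)\<^sup>2 * (4 * B * R n) / (4 * R n)"
      using yR Rpos[of n] by (intro divide_right_mono mult_left_mono) auto
    also have "\<dots> = D" using Rpos[of n] by (simp add: D_def)
    finally show "z \<in> flow_domain" using N[OF n(2) z(1)] by blast
  qed
qed

end

end

section \<open>Fundamental domains with starlike image\<close>

theorem theoremA:
  fixes f h :: "complex \<Rightarrow> complex" and \<tau> :: complex and \<Omega> :: "complex set"
  assumes "non_elliptic f"
    and "denjoy_wolff_point f \<tau>"
    and "koenigs f h \<Omega>"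
  shows "\<exists>V. fundamental_domain f V \<and> univalent_on h V \<and> starlike_at_infinity (h ` V) \<and>
    (\<Union>t\<in>{0::real..}. (\<lambda>w. w - complex_of_real t) ` (h ` V)) =
      (\<Union>n\<in>{1::nat..}. (\<lambda>w. w - of_nat n) ` \<Omega>) \<and>
    (hyperbolic_type \<Omega> \<or> parabolic_zero_step_type \<Omega> \<longrightarrow>
      (\<forall>z :: nat \<Rightarrow> complex. range z \<subseteq> unit_disc \<and> converges_non_tangentially z \<tau> \<longrightarrow>
        (\<forall>\<^sub>F n in sequentially. z n \<in> V) \<and>
        (\<lambda>n. hyp_density_disc (z n) / hyp_density V (z n)) \<longlonglongrightarrow> 1))"
proof -
  interpret koenigs_map f h \<Omega>
    using assms by unfold_locales (auto simp: non_elliptic_def)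
  have \<tau>: "norm \<tau> = 1" using assms(2) by (simp add: denjoy_wolff_point_def)
  have cone: "contains_cone_tails \<tau> flow_domain"
    if "hyperbolic_type \<Omega> \<or> parabolic_zero_step_type \<Omega>"
    using that
  proof
    assume "hyperbolic_type \<Omega>"
    then obtain a b where ab: "a < b" "backward_union \<Omega> = {w. a < Im w \<and> Im w < b}"
      by (auto simp: hyperbolic_type_def)
    obtain \<beta> c where "0 < \<beta>"
      "\<And>w. w \<in> backward_union \<Omega> \<longleftrightarrow> \<bar>Im (of_real \<beta> * (w - \<i> * of_real c))\<bar> < pi / 2"
      using strip_coordinates[OF ab] by blast
    then show ?thesis using hyperbolic_cone_tails assms(2) by blast
  next
    assume "parabolic_zero_step_type \<Omega>"
    then show ?thesis
      using parabolic_cone_tails assms by (auto simp: non_elliptic_def parabolic_zero_step_type_def)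
  qed
  have "(\<forall>\<^sub>F n in sequentially. z n \<in> flow_domain) \<and>
      (\<lambda>n. hyp_density_disc (z n) / hyp_density flow_domain (z n)) \<longlonglongrightarrow> 1"
    if "hyperbolic_type \<Omega> \<or> parabolic_zero_step_type \<Omega>"
      "range z \<subseteq> unit_disc \<and> converges_non_tangentially z \<tau>" for z
    using nontangential_density_ratio[OF \<tau> open_flow_domain simply_connected_flow_domain
        flow_domain_subset cone[OF that(1)], of z] that(2) by blast
  then show ?thesis
    using fundamental_flow_domain univalent_h_flow_domain starlike_h_flow_domain
      backward_translates_flow_domain[unfolded backward_union_def]
    by (intro exI[of _ flow_domain]) blast
qed

end
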